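(* With $\delta=(\delta_1,\dots,\delta_s)$, $\delta_j=\sum_{i=1}^r d_{i,j}-n_j-1$, and $N=1+n_1+\dots+n_s$: 1. If $r<N$, then (a) the complex $K^\bullet_\delta$ is acyclic except in degree $0$: $(H^i(K^\bullet))_\delta=0$ for $i\ne 0$; (b) for $i\ge 0$ and $i\ne N-r$, $(H^i_{\mathfrak{M}}(B))_\delta=0$. 2. If $r=N$, then (a) the complex $K^\bullet_\delta$ is acyclic except in degree $0$: $(H^i(K^\bullet))_\delta=0$ for $i\ne 0$; (b) the $A$-module $(H^0_{\mathfrak{M}}(B))_\delta$ is free of rank $1$, and $(H^i_{\mathfrak{M}}(B))_\delta=0$ for $i>0$. 3. If $r>N$, then (a) for $i\ne 0$: $(H^i(K^\bullet))_\delta\cong A$ (as $A$-module) if $i=N-r$, and $(H^i(K^\bullet))_\delta=0$ if $i\ne N-r$; (b) for $i\ge 0$, $(H^i_{\mathfrak{M}}(B))_\delta=0$.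
   Context: Let $K$ be a commutative integral domain, $s\ge 1$, and $n_s\ge\dots\ge n_1\ge 1$ integers. For $1\le j\le s$ let $\underline{X}_j=(X_{j,1},\dots,X_{j,n_j+1})$ be a packet of indeterminates; for $\underline{\alpha}_j\in\mathbb{N}^{n_j+1}$ let $|\underline{\alpha}_j|$ be the sum of its entries and $\underline{X}_j^{\underline{\alpha}_j}$ the corresponding monomial. Let $r\in\mathbb{N}$ and $d_{i,j}\ge 1$ ($1\le i\le r$, $1\le j\le s$) be integers. Let $A=K[U_{i,\underline{\alpha}_1,\dots,\underline{\alpha}_s}]$ be the polynomial ring in indeterminates indexed by $1\le i\le r$ and $\underline{\alpha}_j\in\mathbb{N}^{n_j+1}$ with $|\underline{\alpha}_j|=d_{i,j}$ for all $j$. Let $C=A[\underline{X}_1,\dots,\underline{X}_s]$ and $f_i=\sum U_{i,\underline{\alpha}_1,\dots,\underline{\alpha}_s}\underline{X}_1^{\underline{\alpha}_1}\cdots\underline{X}_s^{\underline{\alpha}_s}\in C$ (sum over all $(\underline{\alpha}_j)_j$ with $|\underline{\alpha}_j|=d_{i,j}$). $C$ is $\mathbb{N}^s$-graded with $A$ in degree $0$ and $\deg X_{j,l}$ the $j$-th standard basis vector; $f_i$ is homogeneous of degree $\underline{d}_i=(d_{i,1},\dots,d_{i,s})$. Put $B=C/(f_1,\dots,f_r)$, with the induced grading. Let $\mathfrak{M}\subset C$ be the ideal generated by the monomials $\sigma_{i_1\dots i_s}=X_{1,i_1}\cdots X_{s,i_s}$, $1\le i_j\le n_j+1$. $K^\bullet$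 is the graded Koszul complex of $f_1,\dots,f_r$ over $C$, placed in cohomological degrees $-r,\dots,0$: $K^{-l}=\bigwedge^l(C^r)\cong\bigoplus_{1\le i_1<\dots<i_l\le r}C[-\underline{d}_{i_1}-\dots-\underline{d}_{i_l}]$, where $M[\nu]_t=M_{\nu+t}$, with differentials homogeneous of degree $0$. For a $C$-module $M$, $H^i_{\mathfrak{M}}(M)$ denotes the $i$-th cohomology of the augmented Čech complex of $M$ with respect to the monomials $\sigma_{i_1\dots i_s}$, i.e. $0\to M\to\prod_{|I|=1}M_{\sigma_I}\to\prod_{|I|=2}M_{\sigma_I}\to\cdots$ with $M$ in degree $0$, where $I$ runs over sets of these monomials and $\sigma_I$ is their product; it is $\mathbb{Z}^s$-graded when $M$ is. A subscript $\nu\in\mathbb{Z}^s$ denotes the homogeneous part of degree $\nu$. *)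

theory Defs
  imports "HOL-Algebra.QuotRing" "HOL-Algebra.Module" "HOL-Library.Poly_Mapping"
begin

section \<open>Graded modules over a commutative ring\<close>

text \<open>
  Degrees are functions from \<^typ>\<open>nat\<close> to \<^typ>\<open>int\<close>; for a \<open>\<int>\<^sup>s\<close>-grading only the
  values at \<open>1, \<dots>, s\<close> matter.  A graded module is a module record together with its
  homogeneous parts.  The inherited ring fields \<open>mult\<close> and \<open>one\<close> play no role for modules
  and are left \<open>undefined\<close> when there is no multiplication around.
\<close>

type_synonym mdegree = "nat \<Rightarrow> int"

record ('a, 'b) graded_module = "('a, 'b) module" +
  hpart :: "mdegree \<Rightarrow> 'b set"

definition shift_module :: "('a, 'b) graded_module \<Rightarrow> mdegree \<Rightarrow> ('a, 'b) graded_module" where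
  "shift_module M \<nu> = M\<lparr>hpart := (\<lambda>t. hpart M (\<lambda>j. \<nu> j + t j))\<rparr>"

text \<open>Only used for finite index sets, where it is both the product and the direct sum.\<close>

definition prod_module :: "'i set \<Rightarrow> ('i \<Rightarrow> ('a, 'b) graded_module) \<Rightarrow> ('a, 'i \<Rightarrow> 'b) graded_module"
  where
  "prod_module S M =
    \<lparr>carrier = (\<Pi>\<^sub>E i\<in>S. carrier (M i)), mult = undefined, one = undefined,
     zero = (\<lambda>i\<in>S. \<zero>\<^bsub>M i\<^esub>), add = (\<lambda>x y. \<lambda>i\<in>S. x i \<oplus>\<^bsub>M i\<^esub> y i),
     smult = (\<lambda>a x. \<lambda>i\<in>S. a \<odot>\<^bsub>M i\<^esub> x i), hpart = (\<lambda>\<nu>. \<Pi>\<^sub>E i\<in>S. hpart (M i) \<nu>)\<rparr>"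

text \<open>
  The ring fields are those of \<^const>\<open>FactRing\<close>, so that the quotient of a ring by an ideal is
  the quotient ring, see \<open>quot_module_FactRing\<close> below.
\<close>

definition quot_module :: "('a, 'b) graded_module \<Rightarrow> 'b set \<Rightarrow> ('a, 'b set) graded_module" where
  "quot_module M N =
    \<lparr>carrier = a_rcosets\<^bsub>M\<^esub> N, mult = rcoset_mult M N, one = N +>\<^bsub>M\<^esub> \<one>\<^bsub>M\<^esub>,
     zero = N, add = set_add M,
     smult = (\<lambda>a X. \<Union>x\<in>X. N +>\<^bsub>M\<^esub> (a \<odot>\<^bsub>M\<^esub> x)),
     hpart = (\<lambda>\<nu>. (\<lambda>x. N +>\<^bsub>M\<^esub> x) ` hpart M \<nu>)\<rparr>"

lemma quot_module_FactRing: "ring.truncate (quot_module M N) = M Quot N"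
  by (simp add: quot_module_def FactRing_def ring.truncate_def)

text \<open>
  Complexes are families \<open>M\<close> of graded modules indexed by \<^typ>\<open>int\<close> with maps \<open>d i\<close>
  from \<open>M i\<close> to \<open>M (i + 1)\<close>.  Since the quotient map is applied to the homogeneous
  cocycles, the homogeneous parts are those of the graded module \<open>ker / im\<close>.
\<close>

definition cocycles :: "(int \<Rightarrow> ('a, 'b) graded_module) \<Rightarrow> (int \<Rightarrow> 'b \<Rightarrow> 'b) \<Rightarrow> int
    \<Rightarrow> ('a, 'b) graded_module" where
  "cocycles M d i =
    (let Z = {x \<in> carrier (M i). d i x = \<zero>\<^bsub>M (i + 1)\<^esub>}
     in (M i)\<lparr>carrier := Z, hpart := (\<lambda>\<nu>. Z \<inter> hpart (M i) \<nu>)\<rparr>)"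

definition cohomology :: "(int \<Rightarrow> ('a, 'b) graded_module) \<Rightarrow> (int \<Rightarrow> 'b \<Rightarrow> 'b) \<Rightarrow> int
    \<Rightarrow> ('a, 'b set) graded_module" where
  "cohomology M d i = quot_module (cocycles M d i) (d (i - 1) ` carrier (M (i - 1)))"

section \<open>Localization at the powers of an element\<close>

text \<open>\<open>mfrac R M \<sigma> m k\<close> is the fraction \<open>m / \<sigma>\<^sup>k\<close>, as an equivalence class of pairs.\<close>

definition mfrac :: "('a, 'x) ring_scheme \<Rightarrow> ('a, 'b) graded_module \<Rightarrow> 'a \<Rightarrow> 'b \<Rightarrow> nat
    \<Rightarrow> ('b \<times> nat) set" where
  "mfrac R M \<sigma> m k =
    {(m', k'). m' \<in> carrier M \<and>
      (\<exists>e::nat. (\<sigma> [^]\<^bsub>R\<^esub> (e + k')) \<odot>\<^bsub>M\<^esub> m = (\<sigma> [^]\<^bsub>R\<^esub> (e + k)) \<odot>\<^bsub>M\<^esub> m')}"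

text \<open>The argument \<open>\<epsilon>\<close> is the degree of \<open>\<sigma>\<close>.\<close>

definition localization :: "('a, 'x) ring_scheme \<Rightarrow> ('a, 'b) graded_module \<Rightarrow> 'a \<Rightarrow> mdegree
    \<Rightarrow> ('a, ('b \<times> nat) set) graded_module" where
  "localization R M \<sigma> \<epsilon> =
    \<lparr>carrier = {mfrac R M \<sigma> m k | m k. m \<in> carrier M},
     mult = undefined, one = undefined,
     zero = mfrac R M \<sigma> \<zero>\<^bsub>M\<^esub> 0,
     add = (\<lambda>X Y. \<Union>(m, k)\<in>X. \<Union>(m', k')\<in>Y.
       mfrac R M \<sigma> (((\<sigma> [^]\<^bsub>R\<^esub> k') \<odot>\<^bsub>M\<^esub> m) \<oplus>\<^bsub>M\<^esub> ((\<sigma> [^]\<^bsub>R\<^esub> k) \<odot>\<^bsub>M\<^esub> m')) (k + k')),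
     smult = (\<lambda>a X. \<Union>(m, k)\<in>X. mfrac R M \<sigma> (a \<odot>\<^bsub>M\<^esub> m) k),
     hpart = (\<lambda>\<nu>. {mfrac R M \<sigma> m k | m k. m \<in> hpart M (\<lambda>j. \<nu> j + int k * \<epsilon> j)})\<rparr>"

lemma mfrac_eq_iff:
  assumes M: "module R M" and s: "\<sigma> \<in> carrier R" and m: "m \<in> carrier M" "m' \<in> carrier M"
  shows "mfrac R M \<sigma> m k = mfrac R M \<sigma> m' k' \<longleftrightarrow>
    (\<exists>e::nat. (\<sigma> [^]\<^bsub>R\<^esub> (e + k')) \<odot>\<^bsub>M\<^esub> m = (\<sigma> [^]\<^bsub>R\<^esub> (e + k)) \<odot>\<^bsub>M\<^esub> m')"
proof -
  interpret module R M by fact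
  have step: "(\<sigma> [^]\<^bsub>R\<^esub> (i + j)) \<odot>\<^bsub>M\<^esub> x = (\<sigma> [^]\<^bsub>R\<^esub> i) \<odot>\<^bsub>M\<^esub> ((\<sigma> [^]\<^bsub>R\<^esub> j) \<odot>\<^bsub>M\<^esub> x)"
    if "x \<in> carrier M" for i j :: nat and x
    using s that by (simp add: R.nat_pow_mult[symmetric] smult_assoc1)
  have trans: "\<exists>e::nat. (\<sigma> [^]\<^bsub>R\<^esub> (e + c)) \<odot>\<^bsub>M\<^esub> x = (\<sigma> [^]\<^bsub>R\<^esub> (e + a)) \<odot>\<^bsub>M\<^esub> z"
    if x: "x \<in> carrier M" "y \<in> carrier M" "z \<in> carrier M"
    and 1: "(\<sigma> [^]\<^bsub>R\<^esub> (e + b)) \<odot>\<^bsub>M\<^esub> x = (\<sigma> [^]\<^bsub>R\<^esub> (e + a)) \<odot>\<^bsub>M\<^esub> y"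
    and 2: "(\<sigma> [^]\<^bsub>R\<^esub> (e' + c)) \<odot>\<^bsub>M\<^esub> y = (\<sigma> [^]\<^bsub>R\<^esub> (e' + b)) \<odot>\<^bsub>M\<^esub> z"
    for x y z and a b c e e' :: nat
  proof
    have "(\<sigma> [^]\<^bsub>R\<^esub> ((e + e' + b) + c)) \<odot>\<^bsub>M\<^esub> x = (\<sigma> [^]\<^bsub>R\<^esub> ((e' + c) + (e + b))) \<odot>\<^bsub>M\<^esub> x"
      by (simp add: add_ac)
    also have "\<dots> = (\<sigma> [^]\<^bsub>R\<^esub> ((e' + c) + (e + a))) \<odot>\<^bsub>M\<^esub> y"
      using x by (simp only: step 1)
    also have "\<dots> = (\<sigma> [^]\<^bsub>R\<^esub> ((e + a) + (e' + c))) \<odot>\<^bsub>M\<^esub> y" by (simp add: add_ac)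
    also have "\<dots> = (\<sigma> [^]\<^bsub>R\<^esub> ((e + a) + (e' + b))) \<odot>\<^bsub>M\<^esub> z"
      using x by (simp only: step 2)
    also have "\<dots> = (\<sigma> [^]\<^bsub>R\<^esub> ((e + e' + b) + a)) \<odot>\<^bsub>M\<^esub> z" by (simp add: add_ac)
    finally show "(\<sigma> [^]\<^bsub>R\<^esub> ((e + e' + b) + c)) \<odot>\<^bsub>M\<^esub> x = (\<sigma> [^]\<^bsub>R\<^esub> ((e + e' + b) + a)) \<odot>\<^bsub>M\<^esub> z" .
  qed
  show ?thesis (is "?L = ?R")
  proof
    assume ?L
    moreover have "(m', k') \<in> mfrac R M \<sigma> m' k'" using m by (auto simp: mfrac_def)
    ultimately have "(m', k') \<in> mfrac R M \<sigma> m k" by simp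
    then show ?R by (simp add: mfrac_def)
  next
    assume ?R
    then obtain e :: nat where e: "(\<sigma> [^]\<^bsub>R\<^esub> (e + k')) \<odot>\<^bsub>M\<^esub> m = (\<sigma> [^]\<^bsub>R\<^esub> (e + k)) \<odot>\<^bsub>M\<^esub> m'" ..
    show ?L
      unfolding mfrac_def using trans m e by (fastforce dest: sym)
  qed
qed

lemma mfrac_one_bij:
  assumes M: "module R M"
  shows "bij_betw (\<lambda>m. mfrac R M \<one>\<^bsub>R\<^esub> m 0) (carrier M) (carrier (localization R M \<one>\<^bsub>R\<^esub> \<epsilon>))"
proof -
  interpret module R M by fact
  note eq = mfrac_eq_iff[OF M R.one_closed]
  show ?thesis
    unfolding bij_betw_def inj_on_def localization_def
  proof (safe; clarsimp simp: eq)
    fix m k assume "m \<in> carrier M"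
    then show "mfrac R M \<one>\<^bsub>R\<^esub> m k \<in> (\<lambda>m. mfrac R M \<one>\<^bsub>R\<^esub> m 0) ` carrier M"
      by (intro image_eqI[of _ _ m]) (auto simp: eq)
  qed blast
qed

lemma localization_add:
  assumes M: "module R M" and s: "\<sigma> \<in> carrier R" and m: "m \<in> carrier M" "m' \<in> carrier M"
  shows "mfrac R M \<sigma> m k \<oplus>\<^bsub>localization R M \<sigma> \<epsilon>\<^esub> mfrac R M \<sigma> m' k' =
    mfrac R M \<sigma> (((\<sigma> [^]\<^bsub>R\<^esub> k') \<odot>\<^bsub>M\<^esub> m) \<oplus>\<^bsub>M\<^esub> ((\<sigma> [^]\<^bsub>R\<^esub> k) \<odot>\<^bsub>M\<^esub> m')) (k + k')"
proof -
  interpret module R M by fact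
  have step: "(\<sigma> [^]\<^bsub>R\<^esub> (i::nat)) \<odot>\<^bsub>M\<^esub> ((\<sigma> [^]\<^bsub>R\<^esub> (j::nat)) \<odot>\<^bsub>M\<^esub> x) = (\<sigma> [^]\<^bsub>R\<^esub> (i + j)) \<odot>\<^bsub>M\<^esub> x"
    if "x \<in> carrier M" for i j x
    using s that by (simp add: R.nat_pow_mult[symmetric] smult_assoc1)
  have *: "mfrac R M \<sigma> (((\<sigma> [^]\<^bsub>R\<^esub> b) \<odot>\<^bsub>M\<^esub> x) \<oplus>\<^bsub>M\<^esub> ((\<sigma> [^]\<^bsub>R\<^esub> a) \<odot>\<^bsub>M\<^esub> y)) (a + b) =
     mfrac R M \<sigma> (((\<sigma> [^]\<^bsub>R\<^esub> k') \<odot>\<^bsub>M\<^esub> m) \<oplus>\<^bsub>M\<^esub> ((\<sigma> [^]\<^bsub>R\<^esub> k) \<odot>\<^bsub>M\<^esub> m')) (k + k')"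
    if "(x, a) \<in> mfrac R M \<sigma> m k" "(y, b) \<in> mfrac R M \<sigma> m' k'" for x y a b
  proof -
    from that obtain e e' :: nat where x: "x \<in> carrier M" "y \<in> carrier M"
      and e: "(\<sigma> [^]\<^bsub>R\<^esub> (e + a)) \<odot>\<^bsub>M\<^esub> m = (\<sigma> [^]\<^bsub>R\<^esub> (e + k)) \<odot>\<^bsub>M\<^esub> x"
      and e': "(\<sigma> [^]\<^bsub>R\<^esub> (e' + b)) \<odot>\<^bsub>M\<^esub> m' = (\<sigma> [^]\<^bsub>R\<^esub> (e' + k')) \<odot>\<^bsub>M\<^esub> y"
      by (auto simp: mfrac_def)
    have E: "(\<sigma> [^]\<^bsub>R\<^esub> (c + (e + k))) \<odot>\<^bsub>M\<^esub> x = (\<sigma> [^]\<^bsub>R\<^esub> (c + (e + a))) \<odot>\<^bsub>M\<^esub> m" for c :: nat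
      using x m by (simp add: step[symmetric] e del: R.nat_pow_Suc)
    have E': "(\<sigma> [^]\<^bsub>R\<^esub> (c + (e' + k'))) \<odot>\<^bsub>M\<^esub> y = (\<sigma> [^]\<^bsub>R\<^esub> (c + (e' + b))) \<odot>\<^bsub>M\<^esub> m'" for c :: nat
      using x m by (simp add: step[symmetric] e' del: R.nat_pow_Suc)
    show ?thesis
      apply (subst mfrac_eq_iff[OF M s])
      using x m s apply simp_all[2]
      apply (rule exI[of _ "e + e'"])
      using x m s apply (simp add: smult_r_distr step)
      using E[of "e' + k' + b"] E'[of "e + k + a"] by (simp add: add_ac)
  qed
  have ne: "(m, k) \<in> mfrac R M \<sigma> m k" "(m', k') \<in> mfrac R M \<sigma> m' k'" using m by (auto simp: mfrac_def)
  show ?thesis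
    unfolding localization_def graded_module.simps module.simps ring.simps
  proof (intro subset_antisym subsetI)
    fix z assume "z \<in> mfrac R M \<sigma> (((\<sigma> [^]\<^bsub>R\<^esub> k') \<odot>\<^bsub>M\<^esub> m) \<oplus>\<^bsub>M\<^esub> ((\<sigma> [^]\<^bsub>R\<^esub> k) \<odot>\<^bsub>M\<^esub> m')) (k + k')"
    with ne show "z \<in> (\<Union>(m, k)\<in>mfrac R M \<sigma> m k. \<Union>(m', k')\<in>mfrac R M \<sigma> m' k'.
       mfrac R M \<sigma> (((\<sigma> [^]\<^bsub>R\<^esub> k') \<odot>\<^bsub>M\<^esub> m) \<oplus>\<^bsub>M\<^esub> ((\<sigma> [^]\<^bsub>R\<^esub> k) \<odot>\<^bsub>M\<^esub> m')) (k + k'))"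
      by (intro UN_I[OF ne(1)], unfold prod.case) (rule UN_I[OF ne(2)], simp)
  next
    fix z
    assume "z \<in> (\<Union>(m, k)\<in>mfrac R M \<sigma> m k. \<Union>(m', k')\<in>mfrac R M \<sigma> m' k'.
       mfrac R M \<sigma> (((\<sigma> [^]\<^bsub>R\<^esub> k') \<odot>\<^bsub>M\<^esub> m) \<oplus>\<^bsub>M\<^esub> ((\<sigma> [^]\<^bsub>R\<^esub> k) \<odot>\<^bsub>M\<^esub> m')) (k + k'))"
    then obtain x a y b where "(x, a) \<in> mfrac R M \<sigma> m k" "(y, b) \<in> mfrac R M \<sigma> m' k'"
      "z \<in> mfrac R M \<sigma> (((\<sigma> [^]\<^bsub>R\<^esub> b) \<odot>\<^bsub>M\<^esub> x) \<oplus>\<^bsub>M\<^esub> ((\<sigma> [^]\<^bsub>R\<^esub> a) \<odot>\<^bsub>M\<^esub> y)) (a + b)"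
      by (elim UN_E) (simp only: split_beta UN_iff, metis prod.collapse)
    then show "z \<in> mfrac R M \<sigma> (((\<sigma> [^]\<^bsub>R\<^esub> k') \<odot>\<^bsub>M\<^esub> m) \<oplus>\<^bsub>M\<^esub> ((\<sigma> [^]\<^bsub>R\<^esub> k) \<odot>\<^bsub>M\<^esub> m')) (k + k')"
      by (simp only: *)
  qed
qed

section \<open>Augmented Cech complex\<close>

text \<open>
  The complex is taken with respect to the elements of a list \<open>g\<close>, with \<open>\<epsilon> k\<close> the degree of
  \<open>g ! k\<close>.  The order of the list only serves to fix the signs.  The term in degree \<open>0\<close> is
  the localization of \<open>M\<close> at the empty product \<open>1\<close>, which is \<open>M\<close> itself up to the
  isomorphism sending \<open>m\<close> to \<open>m / 1\<close>, see \<open>mfrac_one_bij\<close>.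
\<close>

definition cech_loc :: "('a, 'x) ring_scheme \<Rightarrow> ('a, 'b) graded_module \<Rightarrow> 'a list \<Rightarrow> (nat \<Rightarrow> mdegree)
    \<Rightarrow> nat set \<Rightarrow> ('a, ('b \<times> nat) set) graded_module" where
  "cech_loc R M g \<epsilon> I =
    localization R M (\<Otimes>\<^bsub>R\<^esub>k\<in>I. g ! k) (\<lambda>j. \<Sum>k\<in>I. \<epsilon> k j)"

definition cech_term :: "('a, 'x) ring_scheme \<Rightarrow> ('a, 'b) graded_module \<Rightarrow> 'a list \<Rightarrow> (nat \<Rightarrow> mdegree)
    \<Rightarrow> int \<Rightarrow> ('a, nat set \<Rightarrow> ('b \<times> nat) set) graded_module" where
  "cech_term R M g \<epsilon> p =
    prod_module {I. I \<subseteq> {..<length g} \<and> int (card I) = p} (cech_loc R M g \<epsilon>)"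

text \<open>
  The canonical map from the localization at \<open>\<sigma>\<close> to the one at \<open>\<sigma> \<cdot> h\<close>, where \<open>\<tau> = \<sigma> \<cdot> h\<close>.
\<close>

definition loc_map :: "('a, 'x) ring_scheme \<Rightarrow> ('a, 'b) graded_module \<Rightarrow> 'a \<Rightarrow> 'a
    \<Rightarrow> ('b \<times> nat) set \<Rightarrow> ('b \<times> nat) set" where
  "loc_map R M h \<tau> X = (\<Union>(m, k)\<in>X. mfrac R M \<tau> ((h [^]\<^bsub>R\<^esub> k) \<odot>\<^bsub>M\<^esub> m) k)"

definition alt_sign :: "('a, 'x) ring_scheme \<Rightarrow> nat set \<Rightarrow> nat \<Rightarrow> 'a \<Rightarrow> 'a" where
  "alt_sign M J k x = (if even (card {k' \<in> J. k' < k}) then x else \<ominus>\<^bsub>M\<^esub> x)"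

definition cech_diff :: "('a, 'x) ring_scheme \<Rightarrow> ('a, 'b) graded_module \<Rightarrow> 'a list \<Rightarrow> (nat \<Rightarrow> mdegree)
    \<Rightarrow> int \<Rightarrow> (nat set \<Rightarrow> ('b \<times> nat) set) \<Rightarrow> nat set \<Rightarrow> ('b \<times> nat) set" where
  "cech_diff R M g \<epsilon> p x =
    (\<lambda>J\<in>{J. J \<subseteq> {..<length g} \<and> int (card J) = p + 1}.
      \<Oplus>\<^bsub>cech_loc R M g \<epsilon> J\<^esub>k\<in>J. alt_sign (cech_loc R M g \<epsilon> J) J k
        (loc_map R M (g ! k) (\<Otimes>\<^bsub>R\<^esub>k'\<in>J. g ! k') (x (J - {k}))))"

definition cech_cohomology :: "('a, 'x) ring_scheme \<Rightarrow> ('a, 'b) graded_module \<Rightarrow> 'a list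
    \<Rightarrow> (nat \<Rightarrow> mdegree) \<Rightarrow> int \<Rightarrow> ('a, (nat set \<Rightarrow> ('b \<times> nat) set) set) graded_module" where
  "cech_cohomology R M g \<epsilon> = cohomology (cech_term R M g \<epsilon>) (cech_diff R M g \<epsilon>)"

section \<open>Graded Koszul complex\<close>

text \<open>
  The complex of \<open>f 1, \<dots>, f r\<close> over the graded ring \<open>C\<close> (a graded module over itself), with
  \<open>d i\<close> the degree of \<open>f i\<close>.  An element of the \<open>l\<close>-th exterior power is the family of its
  coordinates in the basis of the \<open>e\<^bsub>i\<^sub>1\<^esub> \<and> \<dots> \<and> e\<^bsub>i\<^sub>l\<^esub>\<close>, and \<open>koszul_diff\<close> is the map sending
  this basis vector to \<open>\<Sum>\<^sub>k (-1)\<^bsup>k-1\<^esup> f\<^bsub>i\<^sub>k\<^esub> e\<^bsub>i\<^sub>1\<^esub> \<and> \<dots> \<and> e\<^bsub>i\<^sub>l\<^esub>\<close> with the \<open>k\<close>-th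
  factor omitted.
\<close>

definition koszul_term :: "('a, 'a) graded_module \<Rightarrow> nat \<Rightarrow> (nat \<Rightarrow> mdegree) \<Rightarrow> int
    \<Rightarrow> ('a, nat set \<Rightarrow> 'a) graded_module" where
  "koszul_term C r d p =
    prod_module {I. I \<subseteq> {1..r} \<and> int (card I) = - p}
      (\<lambda>I. shift_module C (\<lambda>j. - (\<Sum>i\<in>I. d i j)))"

definition koszul_diff :: "('a, 'a) graded_module \<Rightarrow> nat \<Rightarrow> (nat \<Rightarrow> 'a) \<Rightarrow> int
    \<Rightarrow> (nat set \<Rightarrow> 'a) \<Rightarrow> nat set \<Rightarrow> 'a" where
  "koszul_diff C r f p x =
    (\<lambda>J\<in>{J. J \<subseteq> {1..r} \<and> int (card J) = - (p + 1)}.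
      \<Oplus>\<^bsub>C\<^esub>i\<in>{1..r} - J. alt_sign C J i (f i \<otimes>\<^bsub>C\<^esub> x (insert i J)))"

definition koszul_cohomology :: "('a, 'a) graded_module \<Rightarrow> nat \<Rightarrow> (nat \<Rightarrow> mdegree) \<Rightarrow> (nat \<Rightarrow> 'a)
    \<Rightarrow> int \<Rightarrow> ('a, (nat set \<Rightarrow> 'a) set) graded_module" where
  "koszul_cohomology C r d f = cohomology (koszul_term C r d) (koszul_diff C r f)"

section \<open>Modules over the ring of degree zero elements\<close>

text \<open>
  The homogeneous part \<open>M\<^sub>\<nu>\<close> as a module over a ring that maps by \<open>\<phi>\<close> into the degree-zero
  part of the ring over which \<open>M\<close> is graded.
\<close>

definition hpart_module :: "('c \<Rightarrow> 'a) \<Rightarrow> ('a, 'b) graded_module \<Rightarrow> mdegree \<Rightarrow> ('c, 'b) module" where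
  "hpart_module \<phi> M \<nu> =
    \<lparr>carrier = hpart M \<nu>, mult = undefined, one = undefined, zero = \<zero>\<^bsub>M\<^esub>, add = add M,
     smult = (\<lambda>a. smult M (\<phi> a))\<rparr>"

definition self_module :: "('a, 'x) ring_scheme \<Rightarrow> ('a, 'a) module" where
  "self_module R =
    \<lparr>carrier = carrier R, mult = mult R, one = \<one>\<^bsub>R\<^esub>, zero = \<zero>\<^bsub>R\<^esub>, add = add R,
     smult = mult R\<rparr>"

definition zero_module :: "('a, 'b) module \<Rightarrow> bool" where
  "zero_module M \<longleftrightarrow> carrier M = {\<zero>\<^bsub>M\<^esub>}"

definition module_iso :: "('a, 'x) ring_scheme \<Rightarrow> ('a, 'b) module \<Rightarrow> ('a, 'c) module \<Rightarrow> bool" where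
  "module_iso R M N \<longleftrightarrow>
    (\<exists>h. bij_betw h (carrier M) (carrier N) \<and>
      (\<forall>x\<in>carrier M. \<forall>y\<in>carrier M. h (x \<oplus>\<^bsub>M\<^esub> y) = h x \<oplus>\<^bsub>N\<^esub> h y) \<and>
      (\<forall>a\<in>carrier R. \<forall>x\<in>carrier M. h (a \<odot>\<^bsub>M\<^esub> x) = a \<odot>\<^bsub>N\<^esub> h x))"

definition free_of_rank :: "('a, 'x) ring_scheme \<Rightarrow> ('a, 'b) module \<Rightarrow> nat \<Rightarrow> bool" where
  "free_of_rank R M k \<longleftrightarrow>
    (\<exists>B \<subseteq> carrier M. finite B \<and> card B = k \<and>
      (\<forall>x\<in>carrier M. \<exists>!c. c \<in> B \<rightarrow>\<^sub>E carrier R \<and> x = (\<Oplus>\<^bsub>M\<^esub>b\<in>B. c b \<odot>\<^bsub>M\<^esub> b)))"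

section \<open>Polynomial rings\<close>

text \<open>
  \<open>mpoly_ring R V\<close> is \<open>R[V]\<close>, for a subring \<open>R\<close> of the ambient type and a set \<open>V\<close> of
  indeterminates.
\<close>

definition mpoly_ring :: "'a::comm_ring_1 set \<Rightarrow> 'v set \<Rightarrow> (('v \<Rightarrow>\<^sub>0 nat) \<Rightarrow>\<^sub>0 'a) ring" where
  "mpoly_ring R V =
    \<lparr>carrier = {p. (\<forall>m. Poly_Mapping.lookup p m \<in> R) \<and>
       (\<forall>m\<in>Poly_Mapping.keys p. Poly_Mapping.keys m \<subseteq> V)},
     mult = (*), one = 1, zero = 0, add = (+)\<rparr>"

definition mpoly_var :: "'v \<Rightarrow> ('v \<Rightarrow>\<^sub>0 nat) \<Rightarrow>\<^sub>0 'a::comm_ring_1" where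
  "mpoly_var v = Poly_Mapping.single (Poly_Mapping.single v 1) 1"

definition mpoly_const :: "'a::comm_ring_1 \<Rightarrow> ('v \<Rightarrow>\<^sub>0 nat) \<Rightarrow>\<^sub>0 'a" where
  "mpoly_const a = Poly_Mapping.single 0 a"

lemma carrier_mpoly_ring_mult:
  assumes R: "0 \<in> R" "\<And>a b. a \<in> R \<Longrightarrow> b \<in> R \<Longrightarrow> a + b \<in> R" "\<And>a b. a \<in> R \<Longrightarrow> b \<in> R \<Longrightarrow> a * b \<in> R"
    and p: "p \<in> carrier (mpoly_ring R V)" and q: "q \<in> carrier (mpoly_ring R V)"
  shows "p * q \<in> carrier (mpoly_ring R V)"
proof -
  have sumR: "sum f S \<in> R" if "\<And>x. x \<in> S \<Longrightarrow> f x \<in> R" for f :: "'c \<Rightarrow> 'a" and S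
    using that by (induction S rule: infinite_finite_induct) (auto simp: R)
  have "Poly_Mapping.lookup (p * q) m \<in> R" for m
    unfolding lookup_mult Sum_any.expand_set
    using p q by (intro sumR R(3)) (auto simp: mpoly_ring_def when_def R)
  moreover have "\<forall>m\<in>Poly_Mapping.keys (p * q). Poly_Mapping.keys m \<subseteq> V"
  proof
    fix m assume "m \<in> Poly_Mapping.keys (p * q)"
    then obtain a b where "a \<in> Poly_Mapping.keys p" "b \<in> Poly_Mapping.keys q" "m = a + b"
      using keys_mult[of p q] by blast
    then show "Poly_Mapping.keys m \<subseteq> V"
      using p q Poly_Mapping.keys_add[of a b] unfolding mpoly_ring_def by fastforce
  qed
  ultimately show ?thesis by (simp add: mpoly_ring_def)
qed

lemma cring_mpoly_ring:
  assumes R: "0 \<in> R" "1 \<in> R" "\<And>a b. a \<in> R \<Longrightarrow> b \<in> R \<Longrightarrow> a + b \<in> R"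
    "\<And>a b. a \<in> R \<Longrightarrow> b \<in> R \<Longrightarrow> a * b \<in> R" "\<And>a. a \<in> R \<Longrightarrow> - a \<in> R"
  shows "cring (mpoly_ring R V)"
proof (rule cringI)
  have add: "p + q \<in> carrier (mpoly_ring R V)"
    if "p \<in> carrier (mpoly_ring R V)" "q \<in> carrier (mpoly_ring R V)" for p q
    using that Poly_Mapping.keys_add[of p q] by (auto simp: mpoly_ring_def lookup_add R) blast+
  have neg: "- p \<in> carrier (mpoly_ring R V)" if "p \<in> carrier (mpoly_ring R V)" for p
    using that by (auto simp: mpoly_ring_def R in_keys_iff)
  have zero: "0 \<in> carrier (mpoly_ring R V)"
    by (simp add: mpoly_ring_def R)
  have one: "1 \<in> carrier (mpoly_ring R V)"
    by (auto simp: mpoly_ring_def R lookup_one when_def)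
  have ops: "\<zero>\<^bsub>mpoly_ring R V\<^esub> = 0" "\<one>\<^bsub>mpoly_ring R V\<^esub> = 1"
    "x \<oplus>\<^bsub>mpoly_ring R V\<^esub> y = x + y" "x \<otimes>\<^bsub>mpoly_ring R V\<^esub> y = x * y" for x y
    by (simp_all add: mpoly_ring_def)
  show "abelian_group (mpoly_ring R V)"
  proof (rule abelian_groupI, unfold ops)
    fix p assume "p \<in> carrier (mpoly_ring R V)"
    then show "\<exists>q \<in> carrier (mpoly_ring R V). q + p = 0"
      by (intro bexI[of _ "- p"] neg) simp_all
  qed (fact add zero | rule add.assoc add.commute add_0)+
  show "comm_monoid (mpoly_ring R V)"
  proof (rule comm_monoidI, unfold ops)
    show "p * q \<in> carrier (mpoly_ring R V)"
      if "p \<in> carrier (mpoly_ring R V)" "q \<in> carrier (mpoly_ring R V)" for p q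
      by (rule carrier_mpoly_ring_mult[OF R(1,3,4) that])
  qed (fact one | rule mult.assoc mult.commute mult_1)+
  show "(x \<oplus>\<^bsub>mpoly_ring R V\<^esub> y) \<otimes>\<^bsub>mpoly_ring R V\<^esub> z =
      x \<otimes>\<^bsub>mpoly_ring R V\<^esub> z \<oplus>\<^bsub>mpoly_ring R V\<^esub> y \<otimes>\<^bsub>mpoly_ring R V\<^esub> z" for x y z
    unfolding ops by (rule distrib_right)
qed

section \<open>Generic multihomogeneous polynomials\<close>

text \<open>
  \<open>X\<^sub>j\<^sub>,\<^sub>l\<close> is the indeterminate \<open>(j, l)\<close>.  A tuple \<open>(\<alpha>\<^sub>1, \<dots>, \<alpha>\<^sub>s)\<close> of exponents is a finitely
  supported function on these pairs, and the indeterminate \<open>U\<^sub>i\<^sub>,\<^sub>\<alpha>\<close> is the pair \<open>(i, \<alpha>)\<close>.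
\<close>

type_synonym xexp = "(nat \<times> nat) \<Rightarrow>\<^sub>0 nat"
type_synonym 'k apoly = "((nat \<times> xexp) \<Rightarrow>\<^sub>0 nat) \<Rightarrow>\<^sub>0 'k"
type_synonym 'k cpoly = "xexp \<Rightarrow>\<^sub>0 'k apoly"

definition xvars :: "nat \<Rightarrow> (nat \<Rightarrow> nat) \<Rightarrow> (nat \<times> nat) set" where
  "xvars s n = (SIGMA j:{1..s}. {1..n j + 1})"

definition xdeg :: "(nat \<Rightarrow> nat) \<Rightarrow> xexp \<Rightarrow> nat \<Rightarrow> nat" where
  "xdeg n \<alpha> j = (\<Sum>l = 1..n j + 1. Poly_Mapping.lookup \<alpha> (j, l))"

definition exps :: "nat \<Rightarrow> (nat \<Rightarrow> nat) \<Rightarrow> (nat \<Rightarrow> nat) \<Rightarrow> xexp set" where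
  "exps s n e = {\<alpha>. Poly_Mapping.keys \<alpha> \<subseteq> xvars s n \<and> (\<forall>j\<in>{1..s}. xdeg n \<alpha> j = e j)}"

definition uvars :: "nat \<Rightarrow> nat \<Rightarrow> (nat \<Rightarrow> nat) \<Rightarrow> (nat \<Rightarrow> nat \<Rightarrow> nat) \<Rightarrow> (nat \<times> xexp) set" where
  "uvars s r n d = (SIGMA i:{1..r}. exps s n (d i))"

definition ring_A :: "nat \<Rightarrow> nat \<Rightarrow> (nat \<Rightarrow> nat) \<Rightarrow> (nat \<Rightarrow> nat \<Rightarrow> nat) \<Rightarrow> 'k::idom apoly ring" where
  "ring_A s r n d = mpoly_ring UNIV (uvars s r n d)"

definition ring_C :: "nat \<Rightarrow> nat \<Rightarrow> (nat \<Rightarrow> nat) \<Rightarrow> (nat \<Rightarrow> nat \<Rightarrow> nat) \<Rightarrow> 'k::idom cpoly ring" where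
  "ring_C s r n d = mpoly_ring (carrier (ring_A s r n d)) (xvars s n)"

definition gr_C :: "nat \<Rightarrow> nat \<Rightarrow> (nat \<Rightarrow> nat) \<Rightarrow> (nat \<Rightarrow> nat \<Rightarrow> nat)
    \<Rightarrow> ('k::idom cpoly, 'k cpoly) graded_module" where
  "gr_C s r n d =
    module.extend (self_module (ring_C s r n d))
      \<lparr>hpart = (\<lambda>\<nu>. {p \<in> carrier (ring_C s r n d).
        \<forall>\<alpha>\<in>Poly_Mapping.keys p. \<forall>j\<in>{1..s}. int (xdeg n \<alpha> j) = \<nu> j})\<rparr>"

definition gen_f :: "nat \<Rightarrow> (nat \<Rightarrow> nat) \<Rightarrow> (nat \<Rightarrow> nat \<Rightarrow> nat) \<Rightarrow> nat \<Rightarrow> 'k::idom cpoly" where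
  "gen_f s n d i = (\<Sum>\<alpha>\<in>exps s n (d i). Poly_Mapping.single \<alpha> (mpoly_var (i, \<alpha>)))"

lemma finite_xvars: "finite (xvars s n)"
  by (simp add: xvars_def)

lemma finite_exps: "finite (exps s n e)"
proof (rule finite_imageD)
  let ?F = "{f :: nat \<times> nat \<Rightarrow> nat. \<forall>v. (v \<in> xvars s n \<longrightarrow> f v \<in> {..Max (e ` {1..s})}) \<and> (v \<notin> xvars s n \<longrightarrow> f v = 0)}"
  have "Poly_Mapping.lookup ` exps s n e \<subseteq> ?F"
  proof safe
    fix \<alpha> j l assume a: "\<alpha> \<in> exps s n e" and v: "(j, l) \<in> xvars s n"
    then have "Poly_Mapping.lookup \<alpha> (j, l) \<le> xdeg n \<alpha> j"
      unfolding xdeg_def xvars_def by (intro member_le_sum) auto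
    also have "\<dots> = e j" using a v by (auto simp: exps_def xvars_def)
    also have "\<dots> \<le> Max (e ` {1..s})" using v by (intro Max_ge) (auto simp: xvars_def)
    finally show "Poly_Mapping.lookup \<alpha> (j, l) \<le> Max (e ` {1..s})" .
  next
    fix \<alpha> j l assume "\<alpha> \<in> exps s n e" "(j, l) \<notin> xvars s n"
    then show "Poly_Mapping.lookup \<alpha> (j, l) = 0" by (auto simp: exps_def in_keys_iff)
  qed
  moreover have "finite ?F"
    by (rule finite_set_of_finite_funs) (auto simp: finite_xvars)
  ultimately show "finite (Poly_Mapping.lookup ` exps s n e)"
    by (rule finite_subset)
  show "inj_on Poly_Mapping.lookup (exps s n e)" by (simp add: inj_on_def poly_mapping_eqI)
qed

lemma cring_ring_A: "cring (ring_A s r n d)"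
  unfolding ring_A_def by (rule cring_mpoly_ring) simp_all

lemma cring_ring_C: "cring (ring_C s r n d)"
proof -
  interpret A: cring "ring_A s r n d" by (rule cring_ring_A)
  have *: "zero (ring_A s r n d) = 0" "one (ring_A s r n d) = 1" "add (ring_A s r n d) = (+)"
    "mult (ring_A s r n d) = (*)"
    by (simp_all add: ring_A_def mpoly_ring_def)
  show ?thesis
    unfolding ring_C_def
  proof (rule cring_mpoly_ring)
    fix a assume a: "a \<in> carrier (ring_A s r n d)"
    then show "- a \<in> carrier (ring_A s r n d)"
      by (auto simp: ring_A_def mpoly_ring_def)
  qed (use A.zero_closed A.one_closed A.a_closed A.m_closed in \<open>simp_all add: *\<close>)
qed

lemma module_gr_C: "module (ring_C s r n d) (gr_C s r n d)"
proof -
  interpret C: cring "ring_C s r n d" by (rule cring_ring_C)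
  have *: "carrier (gr_C s r n d) = carrier (ring_C s r n d)" "add (gr_C s r n d) = add (ring_C s r n d)"
    "zero (gr_C s r n d) = zero (ring_C s r n d)" "smult (gr_C s r n d) = mult (ring_C s r n d)"
    by (simp_all add: gr_C_def self_module_def module.defs)
  have "abelian_group (gr_C s r n d)"
    by (rule abelian_groupI) (simp_all add: * C.a_ac C.add.l_inv_ex)
  then show ?thesis
    by (intro moduleI) (simp_all add: * C.l_distr C.r_distr C.m_assoc cring_ring_C)
qed

lemma gen_f_in_hpart:
  assumes "i \<in> {1..r}"
  shows "gen_f s n d i \<in> hpart (gr_C s r n d) (\<lambda>j. int (d i j))"
proof -
  have lk: "Poly_Mapping.lookup (gen_f s n d i) \<alpha> =
      (if \<alpha> \<in> exps s n (d i) then mpoly_var (i, \<alpha>) else 0)" for \<alpha>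
    by (simp add: gen_f_def lookup_sum lookup_single when_def finite_exps)
  have A: "0 \<in> carrier (ring_A s r n d)"
    by (simp add: ring_A_def mpoly_ring_def)
  have "mpoly_var (i, \<alpha>) \<in> carrier (ring_A s r n d)" if "\<alpha> \<in> exps s n (d i)" for \<alpha>
    using that assms by (auto simp: ring_A_def mpoly_ring_def mpoly_var_def uvars_def)
  moreover have "Poly_Mapping.keys (gen_f s n d i) \<subseteq> exps s n (d i)"
    by (auto simp: lk in_keys_iff split: if_splits)
  ultimately show ?thesis
    using A by (fastforce simp: gr_C_def self_module_def module.defs ring_C_def mpoly_ring_def lk
      exps_def)
qed

definition gr_B :: "nat \<Rightarrow> nat \<Rightarrow> (nat \<Rightarrow> nat) \<Rightarrow> (nat \<Rightarrow> nat \<Rightarrow> nat)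
    \<Rightarrow> ('k::idom cpoly, 'k cpoly set) graded_module" where
  "gr_B s r n d = quot_module (gr_C s r n d) (Idl\<^bsub>ring_C s r n d\<^esub> (gen_f s n d ` {1..r}))"

definition sigmas :: "nat \<Rightarrow> (nat \<Rightarrow> nat) \<Rightarrow> 'k::idom cpoly set" where
  "sigmas s n = (\<lambda>\<iota>. \<Prod>j = 1..s. mpoly_var (j, \<iota> j)) ` (\<Pi>\<^sub>E j\<in>{1..s}. {1..n j + 1})"

definition bigN :: "nat \<Rightarrow> (nat \<Rightarrow> nat) \<Rightarrow> nat" where
  "bigN s n = 1 + (\<Sum>j = 1..s. n j)"

definition delta :: "nat \<Rightarrow> (nat \<Rightarrow> nat) \<Rightarrow> (nat \<Rightarrow> nat \<Rightarrow> nat) \<Rightarrow> mdegree" where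
  "delta r n d j = (\<Sum>i = 1..r. int (d i j)) - int (n j) - 1"

text \<open>\<open>(H\<^sup>i(K\<^sup>\<bullet>))\<^sub>\<nu>\<close> as a module over \<open>A\<close>.\<close>

definition HK :: "nat \<Rightarrow> nat \<Rightarrow> (nat \<Rightarrow> nat) \<Rightarrow> (nat \<Rightarrow> nat \<Rightarrow> nat) \<Rightarrow> int \<Rightarrow> mdegree
    \<Rightarrow> ('k::idom apoly, (nat set \<Rightarrow> 'k cpoly) set) module" where
  "HK s r n d i =
    hpart_module mpoly_const
      (koszul_cohomology (gr_C s r n d) r (\<lambda>i j. int (d i j)) (gen_f s n d) i)"

text \<open>
  \<open>(H\<^sup>i(B))\<^sub>\<nu>\<close> as a module over \<open>A\<close>, with respect to the list \<open>g\<close> of the monomials in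
  \<^const>\<open>sigmas\<close>, each of which has degree \<open>(1, \<dots>, 1)\<close>.
\<close>

definition HMB :: "'k::idom cpoly list \<Rightarrow> nat \<Rightarrow> nat \<Rightarrow> (nat \<Rightarrow> nat) \<Rightarrow> (nat \<Rightarrow> nat \<Rightarrow> nat) \<Rightarrow> int
    \<Rightarrow> mdegree
    \<Rightarrow> ('k apoly, (nat set \<Rightarrow> ('k cpoly set \<times> nat) set) set) module" where
  "HMB g s r n d i =
    hpart_module mpoly_const
      (cech_cohomology (ring_C s r n d) (gr_B s r n d) g (\<lambda>_ _. 1) i)"

end

theory Submission
  imports Complex_Main "HOL-Library.Function_Algebras" Defs
begin

text \<open>
  Write \<open>L\<^bsub>J\<^esub>\<close> for the localization of \<open>C\<close> at the product of the monomials \<open>\<sigma>\<close> in \<open>J\<close>.  Let \<open>X p q\<close>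
  consist of the families of elements of \<open>L\<^bsub>J\<^esub>\<close> indexed by the pairs \<open>(J, I)\<close> with \<open>|J| = p\<close> and
  \<open>|I| = q\<close>, where the component at \<open>(J, I)\<close> has degree \<open>\<delta> - d\<^bsub>I\<^esub>\<close> for \<open>d\<^bsub>I\<^esub> = \<Sum>\<^bsub>i\<in>I\<^esub> d\<^sub>i\<close>.  This is
  the double complex of the Cech complex and the Koszul complex in degree \<open>\<delta>\<close>, and the theorem
  compares its two ways of being almost exact.

  \<^item> Koszul direction.  If \<open>J\<close> is not empty, a monomial of \<open>f\<^sub>i\<close> is invertible in \<open>L\<^bsub>J\<^esub>\<close>, and up to this
    unit \<open>f\<^sub>i\<close> is \<open>u\<^sub>i + h\<^sub>i\<close> with \<open>u\<^sub>i\<close> one of the indeterminates \<open>U\<close> and with no \<open>u\<^sub>k\<close> in \<open>h\<^sub>i\<close>.  The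
    quotient of division by \<open>f\<^sub>i\<close> with respect to \<open>u\<^sub>i\<close> is additive, inverts multiplication by \<open>f\<^sub>i\<close>
    and commutes with multiplication by the other \<open>f\<^sub>k\<close>.  This gives homotopies which show that the
    complex is exact for \<open>q > 0\<close> (\<open>quotient_by_F\<close>, \<open>kos_exact\<close>).  At \<open>q = 0\<close> its cokernel is the
    localization of \<open>B\<close>.

  \<^item> Cech direction.  Fix a Laurent monomial and let \<open>P\<close> be the set of variables with negative
    exponent.  The complex becomes that of the functions on the sets \<open>J\<close> whose monomials together
    involve all of \<open>P\<close>.  It is exact when \<open>P\<close> is empty or when \<open>P\<close> meets a packet of variables
    without containing it (\<open>acyc_exchange\<close>).  Since \<open>d\<^bsub>i,j\<^esub> \<ge> 1\<close>, the degree \<open>\<delta> - d\<^bsub>I\<^esub>\<close> excludes that \<open>P\<close>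
    contains a packet, unless \<open>I\<close> is everything.  In that case only the monomial with all exponents
    \<open>-1\<close> remains, and it contributes one free generator, in Cech degree \<open>N\<close> (\<open>fundamental_class\<close>).

  A cocycle of the Koszul complex of \<open>C\<close>, or of the Cech complex of \<open>B\<close>, extends to a cocycle of the
  total complex by a zigzag that increases \<open>p\<close> and \<open>q\<close> together and ends at \<open>q = r\<close>.  Each step of
  the zigzag is an isomorphism on cohomology (locale \<open>double_complex\<close>).  Hence the cohomology of both
  complexes vanishes unless the zigzag ends at \<open>p = N\<close>, in total degree \<open>N - r\<close>, and there it is
  isomorphic to \<open>A\<close>.  In negative total degree this concerns the Koszul complex, in nonnegative degree
  the local cohomology of \<open>B\<close>.

  All computations take place in a type of Laurent polynomials.  The modules of the statement, which
  are iterated quotients, are reached from there by surjections with known kernel (locales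
  \<open>represented\<close> and \<open>represented_complex\<close>).
\<close>

section \<open>Signed coboundaries on families of subsets\<close>


definition sg :: "nat set \<Rightarrow> nat \<Rightarrow> 'a::ab_group_add \<Rightarrow> 'a" where
  "sg J k x = (if even (card {l \<in> J. l < k}) then x else - x)"

lemma sg_simps [simp]:
  "sg J k 0 = 0" "sg J k (- x) = - sg J k x" "sg J k (sg J k x) = x"
  "sg J k (x + y) = sg J k x + sg J k y" "sg J k (x - y) = sg J k x - sg J k y"
  by (simp_all add: sg_def)

lemma sg_eq_0_iff [simp]: "sg J k x = 0 \<longleftrightarrow> x = 0"
  by (simp add: sg_def)

lemma sg_commute: "sg J k (sg I l x) = sg I l (sg J k x)"
  by (simp add: sg_def)

lemma sg_mult: "sg J k (a * x) = a * sg J k (x::'a::comm_ring_1)"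
  by (simp add: sg_def)

lemma sg_additive: "additive h \<Longrightarrow> h (sg J k x) = sg J k (h x)"
  by (simp add: sg_def additive.minus)

lemma additive_sg: "additive (sg J k)"
  by unfold_locales simp

lemma sg_insert:
  assumes "finite J" "a \<notin> J"
  shows "sg (insert a J) b x = (if a < b then - sg J b x else sg J b x)"
proof -
  have "{l \<in> insert a J. l < b} = (if a < b then insert a {l \<in> J. l < b} else {l \<in> J. l < b})"
    by auto
  then show ?thesis
    using assms by (simp add: sg_def)
qed

lemma sg_remove:
  assumes "finite J" "a \<in> J"
  shows "sg (J - {a}) b x = (if a < b then - sg J b x else sg J b x)"
  using sg_insert[of "J - {a}" a b x] assms by (simp add: insert_absorb split: if_splits)

lemma sg_below: "(\<And>l. l \<in> J \<Longrightarrow> k \<le> l) \<Longrightarrow> sg J k x = x"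
proof -
  assume "\<And>l. l \<in> J \<Longrightarrow> k \<le> l"
  then have "{l \<in> J. l < k} = {}" by fastforce
  then show ?thesis by (simp only: sg_def card.empty) simp
qed

lemma sum_antisymmetric:
  fixes F :: "'i::linorder \<Rightarrow> 'i \<Rightarrow> 'a::ab_group_add"
  assumes S: "finite S" and F: "\<And>a b. a \<in> S \<Longrightarrow> b \<in> S \<Longrightarrow> a < b \<Longrightarrow> F a b = - F b a"
  shows "(\<Sum>a\<in>S. \<Sum>b\<in>S - {a}. F a b) = 0"
proof -
  have "(\<Sum>a\<in>S. \<Sum>b\<in>S - {a}. F a b) = (\<Sum>a\<in>S. (\<Sum>b | b \<in> S \<and> a < b. F a b) + (\<Sum>b | b \<in> S \<and> b < a. F a b))"
    by (rule sum.cong[OF refl], subst sum.union_disjoint[symmetric])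
       (use S in \<open>auto intro!: sum.cong\<close>)
  also have "\<dots> = (\<Sum>a\<in>S. \<Sum>b | b \<in> S \<and> a < b. F a b) + (\<Sum>a\<in>S. \<Sum>b | b \<in> S \<and> b < a. F a b)"
    by (rule sum.distrib)
  also have "(\<Sum>a\<in>S. \<Sum>b | b \<in> S \<and> b < a. F a b) = (\<Sum>b\<in>S. \<Sum>a | a \<in> S \<and> b < a. F a b)"
    by (rule sum.swap_restrict[OF S S])
  also have "\<dots> = - (\<Sum>b\<in>S. \<Sum>a | a \<in> S \<and> b < a. F b a)"
    unfolding sum_negf[symmetric] by (intro sum.cong refl) (simp add: F)
  finally show ?thesis by simp
qed

definition cob :: "nat set \<Rightarrow> (nat set \<Rightarrow> 'a::ab_group_add) \<Rightarrow> nat set \<Rightarrow> 'a" where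
  "cob K c J = (if J \<subseteq> K then \<Sum>k\<in>J. sg J k (c (J - {k})) else 0)"

lemma additive_cob: "additive (cob K)"
  by unfold_locales (auto simp: cob_def fun_eq_iff sum.distrib)

lemmas cob_diff = additive.diff[OF additive_cob]
  and cob_zero [simp] = additive.zero[OF additive_cob]

lemma cob_map: "additive h \<Longrightarrow> h (cob K c J) = cob K (\<lambda>J. h (c J)) J"
  by (simp add: cob_def additive.sum sg_additive additive.zero)

lemma cob_cob:
  assumes "finite K"
  shows "cob K (cob K c) = 0"
proof
  fix J
  show "cob K (cob K c) J = 0 J"
  proof (cases "J \<subseteq> K")
    case True
    then have J: "finite J" using assms by (rule finite_subset)
    have "cob K (cob K c) J = (\<Sum>a\<in>J. sg J a (cob K c (J - {a})))"
      using True by (simp add: cob_def)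
    also have "\<dots> = (\<Sum>a\<in>J. \<Sum>b\<in>J - {a}. sg J a (sg (J - {a}) b (c (J - {a} - {b}))))"
    proof (rule sum.cong[OF refl])
      fix a assume "a \<in> J"
      have "J - {a} \<subseteq> K" using True by blast
      then have "cob K c (J - {a}) = (\<Sum>b\<in>J - {a}. sg (J - {a}) b (c (J - {a} - {b})))"
        by (simp only: cob_def if_True)
      then show "sg J a (cob K c (J - {a})) = (\<Sum>b\<in>J - {a}. sg J a (sg (J - {a}) b (c (J - {a} - {b}))))"
        by (simp only: additive.sum[OF additive_sg])
    qed
    also have "\<dots> = 0"
    proof (rule sum_antisymmetric[OF J])
      fix a b assume ab: "a \<in> J" "b \<in> J" "a < b"
      have "J - {b} - {a} = J - {a} - {b}" by blast
      with ab show "sg J a (sg (J - {a}) b (c (J - {a} - {b}))) =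
          - sg J b (sg (J - {b}) a (c (J - {b} - {a})))"
        by (simp add: sg_remove[OF J] sg_commute)
    qed
    finally show ?thesis by simp
  qed (simp add: cob_def)
qed

section \<open>Cochains on the sets that cover P\<close>

text \<open>
  If \<open>supp k\<close> is the set of variables in the \<open>k\<close>-th generator and \<open>P\<close> the set of variables with a
  negative exponent in some Laurent monomial, then this monomial lies in the localization at the
  generators in \<open>J\<close> iff the sets \<open>supp k\<close> with \<open>k \<in> J\<close> cover \<open>P\<close>.  So these are the Cech cochains in
  one multidegree, with coefficients in \<open>A\<close>.  They are not graded by \<open>card J\<close>; the homogeneous parts
  are split off where they are needed.
\<close>
definition cochains :: "'a::ab_group_add set \<Rightarrow> (nat \<Rightarrow> 'v set) \<Rightarrow> nat set \<Rightarrow> 'v set \<Rightarrow> (nat set \<Rightarrow> 'a) set"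
  where "cochains A supp K P =
    {c. \<forall>J. c J \<in> A \<and> (c J \<noteq> 0 \<longrightarrow> J \<subseteq> K \<and> P \<subseteq> (\<Union>k\<in>J. supp k))}"

definition acyc :: "'a::ab_group_add set \<Rightarrow> (nat \<Rightarrow> 'v set) \<Rightarrow> nat set \<Rightarrow> 'v set \<Rightarrow> bool" where
  "acyc A supp K P \<longleftrightarrow>
    (\<forall>c\<in>cochains A supp K P. cob K c = 0 \<longrightarrow> (\<exists>b\<in>cochains A supp K P. c = cob K b))"

locale subgroup_set =
  fixes A :: "'a::ab_group_add set"
  assumes zero_mem: "0 \<in> A" and diff_mem: "x \<in> A \<Longrightarrow> y \<in> A \<Longrightarrow> x - y \<in> A"
begin

lemma uminus_mem: "x \<in> A \<Longrightarrow> - x \<in> A"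
  using diff_mem[OF zero_mem] by simp

lemma add_mem: "x \<in> A \<Longrightarrow> y \<in> A \<Longrightarrow> x + y \<in> A"
  using diff_mem[of x "- y"] uminus_mem by simp

lemma sum_mem: "(\<And>i. i \<in> S \<Longrightarrow> f i \<in> A) \<Longrightarrow> sum f S \<in> A"
  by (induction S rule: infinite_finite_induct) (simp_all add: zero_mem add_mem)

lemma sg_mem: "x \<in> A \<Longrightarrow> sg J k x \<in> A"
  by (simp add: sg_def uminus_mem)

lemma cob_mem: "(\<And>J. c J \<in> A) \<Longrightarrow> cob K c J \<in> A"
  by (auto simp: cob_def intro!: sum_mem sg_mem zero_mem)

lemma cob_cochains:
  assumes "c \<in> cochains A supp K P"
  shows "cob K c \<in> cochains A supp K P"
proof -
  have "P \<subseteq> (\<Union>k\<in>J. supp k)" if "cob K c J \<noteq> 0" for J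
  proof -
    from that have "(\<Sum>k\<in>J. sg J k (c (J - {k}))) \<noteq> 0"
      by (simp add: cob_def split: if_splits)
    then obtain k where "k \<in> J" "sg J k (c (J - {k})) \<noteq> 0"
      by (rule sum.not_neutral_contains_not_neutral)
    then have "k \<in> J" "c (J - {k}) \<noteq> 0" by simp_all
    with assms show ?thesis unfolding cochains_def by blast
  qed
  moreover have "J \<subseteq> K" if "cob K c J \<noteq> 0" for J
    using that by (auto simp: cob_def split: if_splits)
  ultimately show ?thesis
    using assms by (auto simp: cochains_def intro!: cob_mem)
qed

lemma cochains_diff:
  assumes b: "b \<in> cochains A supp K P" and c: "c \<in> cochains A supp K P"
  shows "b - c \<in> cochains A supp K P"
proof -
  have "(b - c) J \<in> A \<and> ((b - c) J \<noteq> 0 \<longrightarrow> J \<subseteq> K \<and> P \<subseteq> (\<Union>k\<in>J. supp k))" for J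
  proof -
    have "b J \<in> A" "c J \<in> A" "b J \<noteq> 0 \<Longrightarrow> J \<subseteq> K \<and> P \<subseteq> (\<Union>k\<in>J. supp k)"
      "c J \<noteq> 0 \<Longrightarrow> J \<subseteq> K \<and> P \<subseteq> (\<Union>k\<in>J. supp k)"
      using b c unfolding cochains_def by blast+
    then show ?thesis by (cases "b J = 0"; cases "c J = 0") (auto simp: diff_mem uminus_mem)
  qed
  then show ?thesis unfolding cochains_def by blast
qed

lemma cochains_restrict:
  assumes b: "b \<in> cochains A supp K (P - {v})"
  shows "(\<lambda>J. if J \<subseteq> {k \<in> K. v \<notin> supp k} then b J else 0) \<in> cochains A supp {k \<in> K. v \<notin> supp k} (P - {v})"
  using b unfolding cochains_def by (simp add: zero_mem)

lemma cochains_extend: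
  assumes "b \<in> cochains A supp {k \<in> K. v \<notin> supp k} P"
  shows "b \<in> cochains A supp K P"
  using assms unfolding cochains_def by blast

lemma cob_restrict:
  assumes "J \<subseteq> K'" "K' \<subseteq> K"
  shows "cob K' (\<lambda>J. if J \<subseteq> K' then b J else 0) J = cob K b J"
proof -
  have "J - {k} \<subseteq> K'" for k using assms by blast
  then show ?thesis using assms by (simp add: cob_def)
qed

lemma cochains_mono_cover:
  assumes "b \<in> cochains A supp K (P - {v})" "\<And>J. J \<subseteq> {k \<in> K. v \<notin> supp k} \<Longrightarrow> b J = 0"
  shows "b \<in> cochains A supp K P"
proof -
  have "P \<subseteq> (\<Union>k\<in>J. supp k)" if "b J \<noteq> 0" for J
  proof -
    have J: "J \<subseteq> K" "P - {v} \<subseteq> (\<Union>k\<in>J. supp k)"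
      using assms(1) that unfolding cochains_def by blast+
    have "\<not> J \<subseteq> {k \<in> K. v \<notin> supp k}" using assms(2) that by blast
    with J show ?thesis by blast
  qed
  then show ?thesis using assms(1) unfolding cochains_def by blast
qed

lemma cochains_antimono: "b \<in> cochains A supp K P \<Longrightarrow> Q \<subseteq> P \<Longrightarrow> b \<in> cochains A supp K Q"
  unfolding cochains_def by blast

lemma cochains_vanish:
  "b \<in> cochains A supp K P \<Longrightarrow> v \<in> P \<Longrightarrow> J \<subseteq> {k \<in> K. v \<notin> supp k} \<Longrightarrow> b J = 0"
  unfolding cochains_def by blast

text \<open>
  Cochains for \<open>P\<close> form a subcomplex of those for \<open>P - {v}\<close>, and the quotient consists of the functions
  on sets \<open>J\<close> whose supports all avoid \<open>v\<close>.  The claim is the corresponding part of the long exact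
  sequence.
\<close>
lemma acyc_step:
  assumes K: "finite K" and v: "v \<in> P"
    and 1: "acyc A supp K (P - {v})" and 2: "acyc A supp {k \<in> K. v \<notin> supp k} (P - {v})"
  shows "acyc A supp K P"
  unfolding acyc_def
proof (intro ballI impI)
  fix c assume c: "c \<in> cochains A supp K P" and cc: "cob K c = 0"
  define K' where "K' = {k \<in> K. v \<notin> supp k}"
  have K': "K' \<subseteq> K" by (auto simp: K'_def)
  from 1 c cc obtain b where b: "b \<in> cochains A supp K (P - {v})" "c = cob K b"
    unfolding acyc_def by (meson cochains_antimono Diff_subset)
  define b' where "b' = (\<lambda>J. if J \<subseteq> K' then b J else 0)"
  have b': "b' \<in> cochains A supp K' (P - {v})"
    using cochains_restrict[OF b(1)] by (simp add: b'_def K'_def)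
  have "cob K' b' J = 0" for J
  proof (cases "J \<subseteq> K'")
    case True
    then have "cob K' b' J = c J" unfolding b'_def b(2) by (rule cob_restrict) (rule K')
    also have "c J = 0" using cochains_vanish[OF c v] True by (simp add: K'_def)
    finally show ?thesis .
  qed (simp add: cob_def)
  then have "cob K' b' = 0" by auto
  with 2 b' obtain e where e: "e \<in> cochains A supp K' (P - {v})" "b' = cob K' e"
    unfolding acyc_def K'_def by blast
  have e': "e \<in> cochains A supp K (P - {v})"
    using e(1) unfolding K'_def by (rule cochains_extend)
  have "b - cob K e \<in> cochains A supp K (P - {v})"
    by (intro cochains_diff cob_cochains b e')
  moreover have "(b - cob K e) J = 0" if J: "J \<subseteq> {k \<in> K. v \<notin> supp k}" for J
  proof -
    have J': "J \<subseteq> K'" using J by (simp add: K'_def)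
    have "cob K' e J = cob K e J"
    proof -
      have "e = (\<lambda>J. if J \<subseteq> K' then e J else 0)"
        using e(1) by (auto simp: cochains_def fun_eq_iff)
      then show ?thesis using cob_restrict[OF J' K', of e] by simp
    qed
    moreover have "b' J = b J" using J' by (simp add: b'_def)
    ultimately show ?thesis by (simp add: e(2))
  qed
  ultimately have "b - cob K e \<in> cochains A supp K P"
    by (rule cochains_mono_cover)
  moreover have "c = cob K (b - cob K e)"
    by (simp add: b(2) cob_diff cob_cob[OF K])
  ultimately show "\<exists>b\<in>cochains A supp K P. c = cob K b" by blast
qed

text \<open>
  Without a covering condition the complex is a cone: a contraction is given by inserting a fixed
  vertex.  The smallest one is used because inserting it in front changes every other sign.
\<close>
lemma acyc_cone:
  assumes K: "finite K" "K \<noteq> {}"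
  shows "acyc A supp K {}"
  unfolding acyc_def
proof (intro ballI impI)
  fix c assume c: "c \<in> cochains A supp K {}" and cc: "cob K c = 0"
  define a where "a = Min K"
  have a: "a \<in> K" "\<And>k. k \<in> K \<Longrightarrow> a \<le> k" using K by (auto simp: a_def)
  define b where "b = (\<lambda>J. if a \<notin> J then c (insert a J) else 0)"
  have "b \<in> cochains A supp K {}"
    using c unfolding cochains_def b_def by (auto simp: zero_mem)
  moreover have "c J = cob K b J" for J
  proof (cases "J \<subseteq> K")
    case False
    then show ?thesis using c by (auto simp: cochains_def cob_def)
  next
    case J: True
    then have fJ: "finite J" using K by (meson finite_subset)
    have le: "a \<le> l" if "l \<in> J" for l using a(2) J that by blast
    show ?thesis
    proof (cases "a \<in> J")
      case True
      have "cob K b J = (\<Sum>k\<in>J. if k = a then c J else 0)"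
        unfolding cob_def using J True a
        by (auto simp: b_def insert_absorb intro!: sum.cong sg_below le)
      then show ?thesis using True fJ by simp
    next
      case False
      have aJ: "sg (insert a J) a x = x" for x :: 'a
        by (rule sg_below) (auto intro: le)
      have "0 = cob K c (insert a J)" using cc by simp
      also have "\<dots> = sg (insert a J) a (c J) + (\<Sum>k\<in>J. sg (insert a J) k (c (insert a J - {k})))"
        unfolding cob_def using J a False fJ by simp
      also have "(\<Sum>k\<in>J. sg (insert a J) k (c (insert a J - {k}))) = - (\<Sum>k\<in>J. sg J k (b (J - {k})))"
        unfolding sum_negf[symmetric]
      proof (rule sum.cong[OF refl])
        fix k assume k: "k \<in> J"
        then have "a < k" using a J False by (metis order_less_le subsetD)
        moreover have "insert a J - {k} = insert a (J - {k})" using k False by auto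
        ultimately show "sg (insert a J) k (c (insert a J - {k})) = - sg J k (b (J - {k}))"
          using False by (simp add: sg_insert[OF fJ False] b_def)
      qed
      also have "(\<Sum>k\<in>J. sg J k (b (J - {k}))) = cob K b J" using J by (simp add: cob_def)
      finally show ?thesis by (simp add: aJ)
    qed
  qed
  ultimately show "\<exists>b\<in>cochains A supp K {}. c = cob K b" by blast
qed

text \<open>
  Removing elements of \<open>P\<close> other than \<open>v\<close> by the long exact sequence reduces this to \<open>P = {v}\<close>.  There,
  if \<open>K\<close> is not empty, the sequence involves the full complexes on \<open>K\<close> and on the indices avoiding \<open>v\<close>;
  by exchange the second set is not empty either, so both are cones.
\<close>
lemma acyc_exchange:
  assumes "finite P" "finite K" "v \<in> P" "v' \<notin> P"
    and "\<And>k. k \<in> K \<Longrightarrow> v \<in> supp k \<Longrightarrow> \<exists>k'\<in>K. v \<notin> supp k' \<and> supp k' \<subseteq> insert v' (supp k)"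
  shows "acyc A supp K P"
  using assms
proof (induction "card P" arbitrary: P K)
  case 0
  then have "P = {}" by simp
  then show ?case using "0.prems"(3) by simp
next
  case (Suc t)
  show ?case
  proof (cases "P = {v}")
    case True
    show ?thesis
    proof (cases "K = {}")
      case True
      have "c = 0" if "c \<in> cochains A supp K P" for c
      proof
        fix J
        have "c J \<noteq> 0 \<Longrightarrow> J \<subseteq> {} \<and> v \<in> (\<Union>k\<in>J. supp k)"
          using that Suc.prems(3) True unfolding cochains_def by blast
        then show "c J = 0 J" by auto
      qed
      moreover have "0 \<in> cochains A supp K P" by (simp add: cochains_def zero_mem)
      ultimately show ?thesis unfolding acyc_def by (metis cob_zero)
    next
      case False
      then obtain k where k: "k \<in> K" by blast
      have "\<exists>k'\<in>K. v \<notin> supp k'"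
        using Suc.prems(5)[OF k] k by (cases "v \<in> supp k") auto
      then have "{k \<in> K. v \<notin> supp k} \<noteq> {}" by auto
      then show ?thesis
        using False Suc.prems(2,3) \<open>P = {v}\<close> by (subst acyc_step[of K v]) (simp_all add: acyc_cone)
    qed
  next
    case False
    then obtain u where u: "u \<in> P" "u \<noteq> v" using Suc.prems(3) by blast
    have t: "t = card (P - {u})" using Suc.hyps(2) u Suc.prems(1) by simp
    have "acyc A supp K (P - {u})"
    proof (rule Suc.hyps(1)[OF t])
      show "\<exists>k'\<in>K. v \<notin> supp k' \<and> supp k' \<subseteq> insert v' (supp k)"
        if "k \<in> K" "v \<in> supp k" for k
        using that by (rule Suc.prems(5))
    qed (use Suc.prems(1-4) u in simp_all)
    moreover have "acyc A supp {k \<in> K. u \<notin> supp k} (P - {u})"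
    proof (rule Suc.hyps(1)[OF t])
      fix k assume "k \<in> {k \<in> K. u \<notin> supp k}" "v \<in> supp k"
      then obtain k' where k': "k' \<in> K" "v \<notin> supp k'" "supp k' \<subseteq> insert v' (supp k)"
        using Suc.prems(5)[of k] by auto
      moreover have "u \<notin> supp k'"
        using k'(3) \<open>k \<in> _\<close> u Suc.prems(4) by auto
      ultimately show "\<exists>k'\<in>{k \<in> K. u \<notin> supp k}. v \<notin> supp k' \<and> supp k' \<subseteq> insert v' (supp k)"
        by auto
    qed (use Suc.prems(1-4) u in simp_all)
    ultimately show ?thesis
      using acyc_step[OF Suc.prems(2) u(1)] by blast
  qed
qed

end


locale subring_set = subgroup_set A for A :: "'a::comm_ring_1 set" +
  assumes one_mem: "1 \<in> A" and mult_mem: "x \<in> A \<Longrightarrow> y \<in> A \<Longrightarrow> x * y \<in> A"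

lemma additive_times: "additive ((*) (a::'a::comm_ring_1))"
  by unfold_locales (simp add: distrib_left)

lemma cob_scale: "cob K (\<lambda>J. a * c J) J = a * cob K c J" for a :: "'a::comm_ring_1"
  by (rule cob_map[OF additive_times, symmetric])

text \<open>
  The cohomology in all degrees together is free on the class of \<open>c\<close>, which lives in degree \<open>N\<close>.
\<close>
definition generates :: "'a::comm_ring_1 set \<Rightarrow> (nat \<Rightarrow> 'v set) \<Rightarrow> nat set \<Rightarrow> 'v set \<Rightarrow> nat
    \<Rightarrow> (nat set \<Rightarrow> 'a) \<Rightarrow> bool" where
  "generates A supp K P N c \<longleftrightarrow> c \<in> cochains A supp K P \<and> cob K c = 0 \<and>
    (\<forall>J. c J \<noteq> 0 \<longrightarrow> card J = N) \<and>
    (\<forall>w\<in>cochains A supp K P. cob K w = 0 \<longrightarrow>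
      (\<exists>!a. a \<in> A \<and> (\<exists>b\<in>cochains A supp K P. w - (\<lambda>J. a * c J) = cob K b)))"

section \<open>Transversal families\<close>

text \<open>
  The supports of the monomials \<open>X\<^bsub>1,i\<^sub>1\<^esub> \<cdots> X\<^bsub>s,i\<^sub>s\<^esub>\<close>: each contains one variable from each packet, and
  every such choice occurs exactly once.
\<close>
locale transversal_family =
  fixes K :: "nat set" and supp :: "nat \<Rightarrow> (nat \<times> nat) set" and S :: "nat set"
    and U :: "(nat \<times> nat) set"
  assumes fin: "finite K" "finite U" "finite S" and S_ne: "S \<noteq> {}"
    and U_rows: "U \<subseteq> S \<times> UNIV"
    and supp_sub: "k \<in> K \<Longrightarrow> supp k \<subseteq> U"
    and transversal: "k \<in> K \<Longrightarrow> j \<in> S \<Longrightarrow> \<exists>!l. (j, l) \<in> supp k"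
    and all_transversals: "Q \<subseteq> U \<Longrightarrow> \<forall>j\<in>S. \<exists>!l. (j, l) \<in> Q \<Longrightarrow> \<exists>k\<in>K. supp k = Q"
    and inj_supp: "inj_on supp K"
begin

lemma exchange:
  assumes k: "k \<in> K" and v: "(j, l) \<in> supp k" and v': "(j, l') \<in> U" "l \<noteq> l'"
  shows "\<exists>k'\<in>K. supp k' = insert (j, l') (supp k - {(j, l)})"
proof (rule all_transversals)
  show "insert (j, l') (supp k - {(j, l)}) \<subseteq> U"
    using supp_sub[OF k] v' by blast
  have j: "j \<in> S" using v'(1) U_rows by blast
  show "\<forall>i\<in>S. \<exists>!x. (i, x) \<in> insert (j, l') (supp k - {(j, l)})"
  proof
    fix i assume "i \<in> S"
    then show "\<exists>!x. (i, x) \<in> insert (j, l') (supp k - {(j, l)})"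
      using transversal[OF k, of i] v by (cases "i = j") auto
  qed
qed

lemma acyc_partial_row:
  assumes A: "subgroup_set A" and P: "P \<subseteq> U" "(j, l) \<in> P" "(j, l') \<notin> P"
    and Q: "Q \<subseteq> U" "P \<subseteq> Q" "(j, l') \<in> Q"
  shows "acyc A supp {k \<in> K. supp k \<subseteq> Q} P"
proof (rule subgroup_set.acyc_exchange[OF A _ _ P(2,3)])
  show "finite P" using P fin finite_subset by blast
  show "finite {k \<in> K. supp k \<subseteq> Q}" using fin by simp
  fix k assume "k \<in> {k \<in> K. supp k \<subseteq> Q}" "(j, l) \<in> supp k"
  then have k: "k \<in> K" "supp k \<subseteq> Q" "(j, l) \<in> supp k" by auto
  have ll: "l \<noteq> l'" using P by blast
  have "(j, l') \<in> U" using Q by blast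
  from exchange[OF k(1,3) this ll] obtain k' where
    "k' \<in> K" "supp k' = insert (j, l') (supp k - {(j, l)})" by blast
  then show "\<exists>k'\<in>{k \<in> K. supp k \<subseteq> Q}. (j, l) \<notin> supp k' \<and> supp k' \<subseteq> insert (j, l') (supp k)"
    using k Q ll by (intro bexI[of _ k']) auto
qed

text \<open>
  Induction on \<open>card P\<close>.  If \<open>P\<close> has one element in each row, then only one set covers it.  Otherwise some
  row contains two elements of \<open>P\<close>.  Removing one of them, \<open>v\<close>, leaves a partial row, so the complex for
  \<open>P - {v}\<close> is exact by \<open>acyc_partial_row\<close>.  By the long exact sequence of \<open>acyc_step\<close> the
  cohomology is then that of the transversals avoiding \<open>v\<close>, shifted by one.  Topologically, up to
  a shift, this is the cohomology of a sphere, the join of boundaries of simplices.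
\<close>
lemma fundamental_class:
  assumes A: "subring_set A" and P: "P \<subseteq> U" "\<forall>j\<in>S. \<exists>l. (j, l) \<in> P"
  shows "\<exists>c. generates A supp {k \<in> K. supp k \<subseteq> P} P (Suc (card P) - card S) c"
  using P
proof (induction "card P" arbitrary: P rule: less_induct)
  case less
  interpret subring_set A by (rule A)
  have finP: "finite P" using less.prems fin finite_subset by blast
  define KP where "KP = {k \<in> K. supp k \<subseteq> P}"
  have finKP: "finite KP" using fin by (simp add: KP_def)
  show ?case unfolding KP_def[symmetric]
  proof (cases "\<forall>j\<in>S. \<exists>!l. (j, l) \<in> P")
    case True
    then obtain t where t: "t \<in> K" "supp t = P" using all_transversals less.prems by blast
    have KP: "KP = {t}"
    proof (intro equalityI subsetI)
      fix k assume "k \<in> KP"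
      then have k: "k \<in> K" "supp k \<subseteq> P" by (auto simp: KP_def)
      have "P \<subseteq> supp k"
      proof
        fix v assume v: "v \<in> P"
        obtain j l where jl: "v = (j, l)" by (cases v)
        have j: "j \<in> S" using v jl less.prems(1) U_rows by blast
        obtain l' where l': "(j, l') \<in> supp k" using transversal[OF k(1) j] by blast
        have "l' = l" using True j l' v jl k(2) by blast
        then show "v \<in> supp k" using l' jl by simp
      qed
      then have "supp k = supp t" using k t by blast
      then show "k \<in> {t}" using inj_supp k(1) t(1) by (simp add: inj_on_def)
    qed (use t in \<open>auto simp: KP_def\<close>)
    obtain j0 where j0: "j0 \<in> S" using S_ne by blast
    then have Pne: "P \<noteq> {}" using True by blast
    have only_t: "J = {t}" if "b \<in> cochains A supp KP P" "b J \<noteq> 0" for b J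
      using that Pne unfolding cochains_def KP by blast
    have cob0: "cob KP b = 0" if b: "b \<in> cochains A supp KP P" for b
    proof
      fix J show "cob KP b J = 0 J"
      proof (cases "J = {t}")
        case True
        have "b {} = 0" using only_t[OF b, of "{}"] by blast
        then show ?thesis by (simp add: cob_def True)
      next
        case False
        then show ?thesis
          using only_t[OF cob_cochains[OF b], of J] by fastforce
      qed
    qed
    define c where "c J = (if J = {t} then 1 else 0 :: 'a)" for J
    have c: "c \<in> cochains A supp KP P"
      using t by (auto simp: c_def cochains_def KP zero_mem one_mem)
    have card: "card P = card S"
    proof -
      have "bij_betw fst P S"
        unfolding bij_betw_def
      proof
        show "inj_on fst P"
          using True less.prems(1) U_rows by (fastforce simp: inj_on_def)
        show "fst ` P = S"
          using True less.prems(1) U_rows by (auto simp: image_iff) (metis fst_conv)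
      qed
      then show ?thesis by (rule bij_betw_same_card)
    qed
    have uni: "\<exists>!a. a \<in> A \<and> (\<exists>b\<in>cochains A supp KP P. w - (\<lambda>J. a * c J) = cob KP b)"
      if w: "w \<in> cochains A supp KP P" for w
    proof (rule ex1I[of _ "w {t}"])
      have "w - (\<lambda>J. w {t} * c J) = cob KP 0"
        using only_t[OF w] by (auto simp: c_def fun_eq_iff)
      moreover have "0 \<in> cochains A supp KP P" by (simp add: cochains_def zero_mem)
      ultimately show "w {t} \<in> A \<and> (\<exists>b\<in>cochains A supp KP P. w - (\<lambda>J. w {t} * c J) = cob KP b)"
        using w unfolding cochains_def by blast
    next
      fix a assume "a \<in> A \<and> (\<exists>b\<in>cochains A supp KP P. w - (\<lambda>J. a * c J) = cob KP b)"
      then have "w - (\<lambda>J. a * c J) = 0" using cob0 by auto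
      then have "(w - (\<lambda>J. a * c J)) {t} = 0" by simp
      then show "a = w {t}" by (simp add: c_def)
    qed
    show "\<exists>c. generates A supp KP P (Suc (card P) - card S) c"
    proof (intro exI[of _ c], unfold generates_def, intro conjI allI impI ballI c cob0 uni)
      show "card J = Suc (card P) - card S" if "c J \<noteq> 0" for J
        using that by (auto simp: c_def card split: if_splits)
    qed
  next
    case False
    then obtain j l l' where jl: "j \<in> S" "(j, l) \<in> P" "(j, l') \<in> P" "l \<noteq> l'"
      using less.prems(2) by blast
    define v where "v = (j, l)"
    have v: "v \<in> P" using jl by (simp add: v_def)
    have Kv: "{k \<in> K. supp k \<subseteq> P - {v}} = {k \<in> KP. v \<notin> supp k}"
      by (auto simp: KP_def)
    define K' where "K' = {k \<in> KP. v \<notin> supp k}"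
    have K': "K' \<subseteq> KP" by (auto simp: K'_def)
    have acy: "acyc A supp KP (P - {v})"
      unfolding KP_def
      by (rule acyc_partial_row[OF subgroup_set_axioms, of _ j l' l])
        (use jl less.prems(1) in \<open>auto simp: v_def\<close>)
    have "card (P - {v}) < card P" using v finP by (meson card_Diff1_less)
    moreover have rows: "\<forall>i\<in>S. \<exists>x. (i, x) \<in> P - {v}"
    proof
      fix i assume "i \<in> S"
      then obtain x where "(i, x) \<in> P" using less.prems(2) by blast
      then show "\<exists>x. (i, x) \<in> P - {v}" using jl by (cases "i = j") (auto simp: v_def)
    qed
    ultimately obtain c' where gen: "generates A supp K' (P - {v}) (Suc (card (P - {v})) - card S) c'"
      using less.hyps[of "P - {v}"] less.prems(1) unfolding Kv K'_def[symmetric] by blast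
    have c': "c' \<in> cochains A supp K' (P - {v})" "cob K' c' = 0"
      "\<And>J. c' J \<noteq> 0 \<Longrightarrow> card J = Suc (card (P - {v})) - card S"
      using gen by (simp_all add: generates_def)
    have uniq: "\<exists>!a. a \<in> A \<and> (\<exists>b\<in>cochains A supp K' (P - {v}). w - (\<lambda>J. a * c' J) = cob K' b)"
      if "w \<in> cochains A supp K' (P - {v})" "cob K' w = 0" for w
      using gen that unfolding generates_def by blast
    have "S \<subseteq> fst ` (P - {v})" using rows by force
    then have "card S \<le> card (fst ` (P - {v}))" by (intro card_mono) (use finP in auto)
    also have "\<dots> \<le> card (P - {v})" using finP by (intro card_image_le) simp
    finally have cardS: "card S \<le> card (P - {v})" .
    have ext: "b \<in> cochains A supp KP (P - {v})" if "b \<in> cochains A supp K' (P - {v})" for b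
      using that unfolding K'_def by (rule cochains_extend)
    have same: "cob K' b J = cob KP b J" if "b \<in> cochains A supp K' (P - {v})" "J \<subseteq> K'" for b J
    proof -
      have "b = (\<lambda>J. if J \<subseteq> K' then b J else 0)"
        using that(1) by (auto simp: cochains_def fun_eq_iff)
      then show ?thesis using cob_restrict[OF that(2) K', of b] by simp
    qed
    \<comment> \<open>the connecting homomorphism, applied to the generator for the transversals avoiding \<open>v\<close>\<close>
    define c where "c = cob KP c'"
    have c: "c \<in> cochains A supp KP P"
    proof (rule cochains_mono_cover)
      show "c \<in> cochains A supp KP (P - {v})" unfolding c_def by (intro cob_cochains ext c')
      show "c J = 0" if "J \<subseteq> {k \<in> KP. v \<notin> supp k}" for J
        using same[OF c'(1), of J] that c'(2) unfolding c_def K'_def by simp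
    qed
    have cobc: "cob KP c = 0" unfolding c_def by (rule cob_cob[OF finKP])
    have cardc: "card J = Suc (card P) - card S" if "c J \<noteq> 0" for J
    proof -
      from that have J: "J \<subseteq> KP" by (simp add: c_def cob_def split: if_splits)
      from that have "(\<Sum>k\<in>J. sg J k (c' (J - {k}))) \<noteq> 0"
        by (simp add: c_def cob_def split: if_splits)
      then obtain k where "k \<in> J" "sg J k (c' (J - {k})) \<noteq> 0"
        by (rule sum.not_neutral_contains_not_neutral)
      then have "card (J - {k}) = Suc (card (P - {v})) - card S" using c'(3) by simp
      moreover have "finite J" using J finKP finite_subset by blast
      moreover have "card P = Suc (card (P - {v}))" using v finP by (metis card_Suc_Diff1)
      moreover have "card J = Suc (card (J - {k}))"
        using \<open>k \<in> J\<close> \<open>finite J\<close> by (metis card_Suc_Diff1)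
      ultimately show ?thesis using cardS by linarith
    qed
    have scale_c: "(\<lambda>J. a * c J) = cob KP (\<lambda>J. a * c' J)" for a
      by (simp add: c_def cob_scale fun_eq_iff)
    have scale_mem: "(\<lambda>J. a * c' J) \<in> cochains A supp K' (P - {v})" if "a \<in> A" for a
      unfolding cochains_def
    proof (intro CollectI allI conjI impI)
      fix J
      have J: "c' J \<in> A" "c' J \<noteq> 0 \<Longrightarrow> J \<subseteq> K' \<and> P - {v} \<subseteq> (\<Union>k\<in>J. supp k)"
        using c'(1) unfolding cochains_def by blast+
      show "a * c' J \<in> A" using J(1) that by (rule mult_mem[rotated])
      assume "a * c' J \<noteq> 0"
      then have "c' J \<noteq> 0" by auto
      then show "J \<subseteq> K'" "P - {v} \<subseteq> (\<Union>k\<in>J. supp k)" using J(2) by blast+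
    qed
    show "\<exists>c. generates A supp KP P (Suc (card P) - card S) c"
    proof (intro exI[of _ c], unfold generates_def, intro conjI allI impI ballI c cobc cardc)
      fix w assume w: "w \<in> cochains A supp KP P" "cob KP w = 0"
      obtain u where u: "u \<in> cochains A supp KP (P - {v})" "w = cob KP u"
        using acy w unfolding acyc_def by (meson cochains_antimono Diff_subset)
      define u' where "u' = (\<lambda>J. if J \<subseteq> K' then u J else 0)"
      have u': "u' \<in> cochains A supp K' (P - {v})"
        using cochains_restrict[OF u(1)] by (simp add: u'_def K'_def)
      have "cob K' u' = 0"
      proof
        fix J show "cob K' u' J = 0 J"
        proof (cases "J \<subseteq> K'")
          case True
          then have "cob K' u' J = w J" unfolding u'_def u(2) by (rule cob_restrict) (rule K')
          also have "w J = 0" using cochains_vanish[OF w(1) v] True by (simp add: K'_def)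
          finally show ?thesis by simp
        qed (simp add: cob_def)
      qed
      from uniq[OF u' this] obtain a where a: "a \<in> A"
        "\<exists>b\<in>cochains A supp K' (P - {v}). u' - (\<lambda>J. a * c' J) = cob K' b"
        and a_uniq: "\<And>a'. a' \<in> A \<Longrightarrow>
          \<exists>b\<in>cochains A supp K' (P - {v}). u' - (\<lambda>J. a' * c' J) = cob K' b \<Longrightarrow> a' = a"
        by blast
      then obtain b where b: "b \<in> cochains A supp K' (P - {v})" "u' - (\<lambda>J. a * c' J) = cob K' b"
        by blast
      let ?x = "u - (\<lambda>J. a * c' J) - cob KP b"
      have x: "?x \<in> cochains A supp KP P"
      proof (rule cochains_mono_cover)
        show "?x \<in> cochains A supp KP (P - {v})"
          by (intro cochains_diff cob_cochains ext u scale_mem a b)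
        fix J assume "J \<subseteq> {k \<in> KP. v \<notin> supp k}"
        then have J: "J \<subseteq> K'" by (simp add: K'_def)
        have "?x J = (u' - (\<lambda>J. a * c' J)) J - cob K' b J"
          using J same[OF b(1) J] by (simp add: u'_def)
        then show "?x J = 0" by (simp add: b(2))
      qed
      have eq: "w - (\<lambda>J. a * c J) = cob KP ?x"
        by (simp add: cob_diff u(2) scale_c cob_cob[OF finKP])
      show "\<exists>!a. a \<in> A \<and> (\<exists>b\<in>cochains A supp KP P. w - (\<lambda>J. a * c J) = cob KP b)"
      proof (rule ex1I[of _ a])
        show "a \<in> A \<and> (\<exists>b\<in>cochains A supp KP P. w - (\<lambda>J. a * c J) = cob KP b)"
          using a(1) x eq by blast
        fix a' assume "a' \<in> A \<and> (\<exists>b\<in>cochains A supp KP P. w - (\<lambda>J. a' * c J) = cob KP b)"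
        then obtain y where a': "a' \<in> A" and y: "y \<in> cochains A supp KP P" "w - (\<lambda>J. a' * c J) = cob KP y"
          by blast
        have "cob KP (u - (\<lambda>J. a' * c' J) - y) = 0"
          using y(2) by (simp add: cob_diff u(2) scale_c)
        moreover have "u - (\<lambda>J. a' * c' J) - y \<in> cochains A supp KP (P - {v})"
          by (intro cochains_diff u(1) ext[OF scale_mem[OF a']] cochains_antimono[OF y(1)]) blast
        ultimately obtain z where z: "z \<in> cochains A supp KP (P - {v})"
          "u - (\<lambda>J. a' * c' J) - y = cob KP z"
          using acy unfolding acyc_def by blast
        define z' where "z' = (\<lambda>J. if J \<subseteq> K' then z J else 0)"
        have z': "z' \<in> cochains A supp K' (P - {v})"
          using cochains_restrict[OF z(1)] by (simp add: z'_def K'_def)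
        have "(u' - (\<lambda>J. a' * c' J)) J = cob K' z' J" for J
        proof (cases "J \<subseteq> K'")
          case True
          have "cob K' z' J = cob KP z J"
            unfolding z'_def by (rule cob_restrict[OF True K'])
          also have "\<dots> = (u - (\<lambda>J. a' * c' J) - y) J" by (simp add: z(2))
          also have "y J = 0" using cochains_vanish[OF y(1) v] True by (simp add: K'_def)
          then have "(u - (\<lambda>J. a' * c' J) - y) J = (u' - (\<lambda>J. a' * c' J)) J"
            using True by (simp add: u'_def)
          finally show ?thesis by simp
        next
          case False
          then have "c' J = 0" using c'(1) unfolding cochains_def by blast
          then show ?thesis using False by (simp add: u'_def cob_def)
        qed
        then have "u' - (\<lambda>J. a' * c' J) = cob K' z'" by blast
        with z' show "a' = a" by (intro a_uniq[OF a']) blast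
      qed
    qed
  qed
qed

end

section \<open>Double complexes with one exceptional column\<close>


definition free_quotient :: "'s set \<Rightarrow> ('s \<Rightarrow> 'x \<Rightarrow> 'x) \<Rightarrow> 'x::ab_group_add set \<Rightarrow> 'x set \<Rightarrow> bool" where
  "free_quotient A act Y Y0 \<longleftrightarrow> (\<exists>y0\<in>Y. \<forall>y\<in>Y. \<exists>!a. a \<in> A \<and> y - act a y0 \<in> Y0)"

text \<open>
  The rows (fixed \<open>p\<close>) with \<open>0 < p\<close> are exact for \<open>dK\<close> at \<open>0 < q\<close>, the columns (fixed \<open>q\<close>) with \<open>q < r\<close>
  are exact for \<open>dC\<close>, and the column \<open>q = r\<close> has a single nonzero cohomology group, free of rank one, at \<open>p = N\<close>.  The two
  differentials commute; no signs are introduced, as only zigzags are considered.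
\<close>
locale double_complex =
  fixes A :: "'s set" and act :: "'s \<Rightarrow> 'x \<Rightarrow> 'x::ab_group_add"
    and X :: "int \<Rightarrow> int \<Rightarrow> 'x set" and dC dK :: "'x \<Rightarrow> 'x" and r N :: int
  assumes X_subgroup: "subgroup_set (X p q)"
    and additive_dC: "additive dC" and additive_dK: "additive dK"
    and dC_mem: "x \<in> X p q \<Longrightarrow> dC x \<in> X (p + 1) q" and dK_mem: "x \<in> X p q \<Longrightarrow> dK x \<in> X p (q - 1)"
    and dC_dC: "dC (dC x) = 0" and dK_dK: "x \<in> X p q \<Longrightarrow> dK (dK x) = 0" and dC_dK: "dC (dK x) = dK (dC x)"
    and act_mem: "a \<in> A \<Longrightarrow> x \<in> X p q \<Longrightarrow> act a x \<in> X p q"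
    and dC_act: "dC (act a x) = act a (dC x)" and dK_act: "dK (act a x) = act a (dK x)"
    and X_top: "r < q \<Longrightarrow> X p q = {0}"
    and exact_dK: "0 < p \<Longrightarrow> 0 < q \<Longrightarrow> x \<in> X p q \<Longrightarrow> dK x = 0 \<Longrightarrow> \<exists>y\<in>X p (q + 1). x = dK y"
    and exact_dC: "q < r \<Longrightarrow> x \<in> X p q \<Longrightarrow> dC x = 0 \<Longrightarrow> \<exists>y\<in>X (p - 1) q. x = dC y"
    and exact_last: "p \<noteq> N \<Longrightarrow> x \<in> X p r \<Longrightarrow> dC x = 0 \<Longrightarrow> \<exists>y\<in>X (p - 1) r. x = dC y"
    and free_last: "free_quotient A act {x \<in> X N r. dC x = 0} (dC ` X (N - 1) r)"
begin

lemmas dC_diff = additive.diff[OF additive_dC] and dK_diff = additive.diff[OF additive_dK]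
  and dC_add = additive.add[OF additive_dC] and dK_add = additive.add[OF additive_dK]
  and dC_0 [simp] = additive.zero[OF additive_dC] and dK_0 [simp] = additive.zero[OF additive_dK]
  and X_diff = subgroup_set.diff_mem[OF X_subgroup]
  and X_zero = subgroup_set.zero_mem[OF X_subgroup]

text \<open>
  \<open>Z p q\<close> consists of the possible starting points of a zigzag \<open>y = y\<^sub>0, y\<^sub>1, \<dots>\<close> with
  \<open>dC y\<^sub>k = dK y\<^sub>k\<^sub>+\<^sub>1\<close>, that is of a total cocycle.  The quotients of \<open>Z p q\<close> by \<open>B p q\<close> do not change
  along a zigzag: \<open>Z_up\<close> and \<open>Z_down\<close> give the correspondence of elements, \<open>B_up\<close> and \<open>B_down\<close> show
  that it is well defined and injective modulo \<open>B\<close>.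
\<close>
definition Z :: "int \<Rightarrow> int \<Rightarrow> 'x set" where
  "Z p q = {y \<in> X p q. \<exists>w\<in>X (p + 1) (q + 1). dC y = dK w}"

definition B :: "int \<Rightarrow> int \<Rightarrow> 'x set" where
  "B p q = {dC u + dK v | u v. u \<in> X (p - 1) q \<and> v \<in> X p (q + 1)}"

lemma Z_up:
  assumes "0 \<le> p" "0 \<le> q" "y \<in> Z p q"
  obtains w where "w \<in> Z (p + 1) (q + 1)" "dC y = dK w"
proof -
  from assms obtain w where w: "w \<in> X (p + 1) (q + 1)" "dC y = dK w"
    by (auto simp: Z_def)
  have "dK (dC w) = 0" by (metis w(2) dC_dK dC_dC)
  with exact_dK[OF _ _ dC_mem[OF w(1)]] assms have "w \<in> Z (p + 1) (q + 1)"
    using w(1) by (auto simp: Z_def)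
  with w(2) that show thesis by blast
qed

lemma Z_down:
  assumes "q < r" "w \<in> Z (p + 1) (q + 1)"
  obtains y where "y \<in> Z p q" "dC y = dK w"
proof -
  from assms obtain w' where w: "w \<in> X (p + 1) (q + 1)" "w' \<in> X (p + 1 + 1) (q + 1 + 1)" "dC w = dK w'"
    by (auto simp: Z_def)
  have "dC (dK w) = 0" using dK_dK[OF w(2)] by (simp add: dC_dK w)
  moreover have "dK w \<in> X (p + 1) q" using dK_mem[OF w(1)] by simp
  ultimately obtain y where "y \<in> X p q" "dK w = dC y"
    using exact_dC[OF assms(1)] by fastforce
  moreover from this have "y \<in> Z p q" using w(1) by (simp add: Z_def) metis
  ultimately show thesis using that by simp
qed

lemma B_down:
  assumes q: "q < r" and y: "y \<in> X p q" and w: "dC y = dK w" "w \<in> B (p + 1) (q + 1)"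
  shows "y \<in> B p q"
proof -
  from w(2) obtain u v where u: "u \<in> X p (q + 1)" and v: "v \<in> X (p + 1) (q + 1 + 1)"
    and w_eq: "w = dC u + dK v" by (auto simp: B_def)
  have "dC (y - dK u) = 0"
    using dK_dK[OF v] by (simp add: dC_diff w(1) w_eq dK_add dC_dK)
  moreover have "y - dK u \<in> X p q" using dK_mem[OF u] y by (simp add: X_diff)
  ultimately obtain u' where u': "u' \<in> X (p - 1) q" "y - dK u = dC u'"
    using exact_dC[OF q] by blast
  then have "y = dC u' + dK u" by (simp add: algebra_simps)
  then show ?thesis using u u' by (auto simp: B_def)
qed

lemma B_up:
  assumes pq: "0 \<le> p" "0 \<le> q" and w: "w \<in> X (p + 1) (q + 1)" "dC y = dK w" and y: "y \<in> B p q"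
  shows "w \<in> B (p + 1) (q + 1)"
proof -
  from y obtain u v where v: "v \<in> X p (q + 1)" and y_eq: "y = dC u + dK v"
    by (auto simp: B_def)
  have "dK (w - dC v) = 0"
    using w(2) by (simp add: dK_diff y_eq dC_add dC_dC dC_dK)
  moreover have "w - dC v \<in> X (p + 1) (q + 1)" using dC_mem[OF v] w(1) by (simp add: X_diff)
  ultimately obtain v' where v': "v' \<in> X (p + 1) (q + 1 + 1)" "w - dC v = dK v'"
    using exact_dK[of "p + 1" "q + 1"] pq by auto
  then have "w = dC v + dK v'" by (simp add: algebra_simps)
  then show ?thesis using v v' by (auto simp: B_def)
qed

lemma Z_top: "Z p r = {x \<in> X p r. dC x = 0}" and B_top: "B p r = dC ` X (p - 1) r"
  using X_top[of "r + 1"] by (auto simp: Z_def B_def)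

lemma Z_subset_B:
  assumes "0 \<le> p" "0 \<le> q" "q \<le> r" "p + r - q \<noteq> N"
  shows "Z p q \<subseteq> B p q"
  using assms
proof (induction "nat (r - q)" arbitrary: p q)
  case 0
  then have "q = r" by simp
  then show ?case using exact_last[of p] 0 by (auto simp: Z_top B_top)
next
  case (Suc t)
  have q: "q < r" using Suc.hyps(2) by linarith
  have IH: "Z (p + 1) (q + 1) \<subseteq> B (p + 1) (q + 1)"
    by (rule Suc.hyps(1)) (use Suc in auto)
  show ?case
  proof
    fix y assume y: "y \<in> Z p q"
    then obtain w where "w \<in> Z (p + 1) (q + 1)" "dC y = dK w"
      using Z_up Suc.prems by blast
    moreover have "y \<in> X p q" using y by (simp add: Z_def)
    ultimately show "y \<in> B p q" using B_down[OF q] IH by blast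
  qed
qed

lemma free_quotient_Z_B:
  assumes "0 \<le> p" "0 \<le> q" "q \<le> r" "p + r - q = N"
  shows "free_quotient A act (Z p q) (B p q)"
  using assms
proof (induction "nat (r - q)" arbitrary: p q)
  case 0
  then have "q = r" "p = N" by simp_all
  then show ?case using free_last by (simp add: Z_top B_top)
next
  case (Suc t)
  have q: "q < r" using Suc.hyps(2) by linarith
  have "free_quotient A act (Z (p + 1) (q + 1)) (B (p + 1) (q + 1))"
    by (rule Suc.hyps(1)) (use Suc in auto)
  then obtain w0 where w0: "w0 \<in> Z (p + 1) (q + 1)"
    and uniq: "\<And>w. w \<in> Z (p + 1) (q + 1) \<Longrightarrow> \<exists>!a. a \<in> A \<and> w - act a w0 \<in> B (p + 1) (q + 1)"
    unfolding free_quotient_def by blast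
  from Z_down[OF q w0] obtain y0 where y0: "y0 \<in> Z p q" "dC y0 = dK w0" by blast
  have "\<exists>!a. a \<in> A \<and> y - act a y0 \<in> B p q" if y: "y \<in> Z p q" for y
  proof -
    from Z_up[OF Suc.prems(1,2) y] obtain w where w: "w \<in> Z (p + 1) (q + 1)" "dC y = dK w" by blast
    have "y - act a y0 \<in> B p q \<longleftrightarrow> w - act a w0 \<in> B (p + 1) (q + 1)" if "a \<in> A" for a
    proof -
      have d: "dC (y - act a y0) = dK (w - act a w0)"
        by (simp add: dC_diff dK_diff dC_act dK_act w(2) y0(2))
      have "y - act a y0 \<in> X p q" "w - act a w0 \<in> X (p + 1) (q + 1)"
        using y y0 w w0 that by (auto simp: Z_def X_diff act_mem)
      then show ?thesis using B_up[OF Suc.prems(1,2) _ d] B_down[OF q _ d] by blast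
    qed
    with uniq[OF w(1)] show ?thesis by metis
  qed
  with y0 show ?case unfolding free_quotient_def by blast
qed

text \<open>
  In the row \<open>p = 0\<close> a cocycle for \<open>dK\<close> starts a zigzag because the row \<open>p = 1\<close> is exact at \<open>q > 0\<close>;
  conversely \<open>dC\<close> is injective on the row \<open>p = 0\<close> at the place \<open>q - 1 < r\<close>.
\<close>
lemma Z_at_0:
  assumes "0 < q" "q \<le> r" and neg: "X (- 1) (q - 1) = {0}"
  shows "Z 0 q = {y \<in> X 0 q. dK y = 0}"
proof (intro equalityI subsetI)
  fix y assume "y \<in> Z 0 q"
  then obtain w where y: "y \<in> X 0 q" and w: "w \<in> X 1 (q + 1)" "dC y = dK w" by (auto simp: Z_def)
  have "dC (dK y) = 0" using dK_dK[OF w(1)] by (simp add: dC_dK w(2))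
  with exact_dC[of "q - 1" "dK y" 0] dK_mem[OF y] assms have "dK y = 0" by auto
  then show "y \<in> {y \<in> X 0 q. dK y = 0}" using y by simp
next
  fix y assume y: "y \<in> {y \<in> X 0 q. dK y = 0}"
  then have "dC y \<in> X 1 q" "dK (dC y) = 0" using dC_mem[of y 0 q] by (auto simp: dC_dK[symmetric])
  then obtain w where "w \<in> X 1 (q + 1)" "dC y = dK w" using exact_dK[of 1 q "dC y"] assms by auto
  then show "y \<in> Z 0 q" using y by (auto simp: Z_def)
qed

lemma B_at_0: "X (- 1) q = {0} \<Longrightarrow> B 0 q = dK ` X 0 (q + 1)"
  by (auto simp: B_def)

end

section \<open>Modules presented as quotients of additive groups\<close>


text \<open>
  \<open>\<theta>\<close> presents the additive group of \<open>M\<close> as the quotient of \<open>S\<close> by \<open>S0\<close>.  In this form products,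
  localizations, quotients and cohomology can be computed in an additive group of a type class,
  although the elements of the record \<open>M\<close> may be cosets of cosets.
\<close>
locale represented = subgroup_set S for S :: "'x::ab_group_add set" +
  fixes \<theta> :: "'x \<Rightarrow> 'b" and S0 :: "'x set" and M :: "('b, 'z) ring_scheme"
  assumes carrier_eq: "carrier M = \<theta> ` S" and zero_eq: "\<zero>\<^bsub>M\<^esub> = \<theta> 0"
    and add_eq: "x \<in> S \<Longrightarrow> y \<in> S \<Longrightarrow> \<theta> x \<oplus>\<^bsub>M\<^esub> \<theta> y = \<theta> (x + y)"
    and eq_zero_iff: "x \<in> S \<Longrightarrow> \<theta> x = \<theta> 0 \<longleftrightarrow> x \<in> S0"
begin

lemma eq_iff:
  assumes "x \<in> S" "y \<in> S"
  shows "\<theta> x = \<theta> y \<longleftrightarrow> x - y \<in> S0"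
proof
  assume "\<theta> x = \<theta> y"
  then have "\<theta> (x + - y) = \<theta> (y + - y)"
    using assms by (simp only: add_eq[symmetric] uminus_mem)
  then show "x - y \<in> S0" using assms by (simp add: eq_zero_iff diff_mem)
next
  assume "x - y \<in> S0"
  then have "\<theta> (x - y) \<oplus>\<^bsub>M\<^esub> \<theta> y = \<theta> 0 \<oplus>\<^bsub>M\<^esub> \<theta> y"
    using eq_zero_iff[OF diff_mem[OF assms]] by simp
  then show "\<theta> x = \<theta> y" using assms by (simp add: add_eq diff_mem zero_mem)
qed

sublocale abelian_group M
proof (rule abelian_groupI, unfold carrier_eq zero_eq)
  fix x assume "x \<in> \<theta> ` S"
  then obtain a where a: "a \<in> S" "x = \<theta> a" by blast
  then show "\<exists>y\<in>\<theta> ` S. y \<oplus>\<^bsub>M\<^esub> x = \<theta> 0"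
    by (intro bexI[of _ "\<theta> (- a)"] imageI) (simp_all add: add_eq uminus_mem)
qed (auto simp: add_eq add_mem zero_mem ac_simps)

lemma minus_eq: "x \<in> S \<Longrightarrow> \<ominus>\<^bsub>M\<^esub> \<theta> x = \<theta> (- x)"
  by (rule minus_equality) (simp_all add: carrier_eq add_eq zero_eq uminus_mem)

lemma finsum_eq:
  assumes "finite K" "\<And>k. k \<in> K \<Longrightarrow> f k \<in> S"
  shows "(\<Oplus>\<^bsub>M\<^esub>k\<in>K. \<theta> (f k)) = \<theta> (\<Sum>k\<in>K. f k)"
  using assms
proof (induction K rule: finite_induct)
  case (insert k K)
  then have "(\<lambda>k. \<theta> (f k)) \<in> K \<rightarrow> carrier M" by (auto simp: carrier_eq)
  with insert show ?case by (simp add: carrier_eq add_eq sum_mem)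
qed (simp add: zero_eq)

lemma alt_sign_eq: "x \<in> S \<Longrightarrow> alt_sign M J k (\<theta> x) = \<theta> (sg J k x)"
  by (simp add: alt_sign_def sg_def minus_eq)

end

lemma zero_module_represented:
  assumes "represented S \<theta> S0 M"
  shows "zero_module M \<longleftrightarrow> S \<subseteq> S0"
proof -
  interpret represented S \<theta> S0 M by (rule assms)
  have "carrier M = {\<zero>\<^bsub>M\<^esub>} \<longleftrightarrow> (\<forall>x\<in>S. \<theta> x = \<theta> 0)"
    unfolding carrier_eq zero_eq using zero_mem by auto
  also have "\<dots> \<longleftrightarrow> S \<subseteq> S0" using eq_zero_iff by blast
  finally show ?thesis by (simp add: zero_module_def)
qed

lemma PiE_image:
  assumes get: "\<And>i w. i \<in> I \<Longrightarrow> w \<in> W \<Longrightarrow> get i w \<in> S i"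
    and surj: "\<And>x. (\<And>i. i \<in> I \<Longrightarrow> x i \<in> S i) \<Longrightarrow> \<exists>w\<in>W. \<forall>i\<in>I. get i w = x i"
  shows "(\<Pi>\<^sub>E i\<in>I. \<theta> i ` S i) = (\<lambda>w. \<lambda>i\<in>I. \<theta> i (get i w)) ` W"
proof (intro equalityI subsetI)
  fix f assume f: "f \<in> (\<Pi>\<^sub>E i\<in>I. \<theta> i ` S i)"
  have "\<exists>x\<in>S i. f i = \<theta> i x" if "i \<in> I" for i
    using f that by (auto simp: PiE_iff)
  then obtain x where x: "\<And>i. i \<in> I \<Longrightarrow> x i \<in> S i \<and> f i = \<theta> i (x i)" by metis
  then obtain w where w: "w \<in> W" "\<forall>i\<in>I. get i w = x i" using surj[of x] by blast
  have "f \<in> extensional I" using f by (simp add: PiE_iff)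
  then have "f = (\<lambda>i\<in>I. \<theta> i (get i w))"
    by (rule extensionalityI[OF _ restrict_extensional]) (simp add: x w)
  with w(1) show "f \<in> (\<lambda>w. \<lambda>i\<in>I. \<theta> i (get i w)) ` W" by blast
qed (use get in auto)

lemma represented_prod_module:
  assumes W: "subgroup_set W"
    and M: "\<And>i. i \<in> I \<Longrightarrow> represented (S i) (\<theta> i) (S0 i) (M i)"
    and get: "\<And>i. additive (get i)" "\<And>i w. i \<in> I \<Longrightarrow> w \<in> W \<Longrightarrow> get i w \<in> S i"
    and surj: "\<And>x. (\<And>i. i \<in> I \<Longrightarrow> x i \<in> S i) \<Longrightarrow> \<exists>w\<in>W. \<forall>i\<in>I. get i w = x i"
  shows "represented W (\<lambda>w. \<lambda>i\<in>I. \<theta> i (get i w)) {w \<in> W. \<forall>i\<in>I. get i w \<in> S0 i} (prod_module I M)"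
proof -
  interpret W: subgroup_set W by (rule W)
  show ?thesis
  proof
    show "carrier (prod_module I M) = (\<lambda>w. \<lambda>i\<in>I. \<theta> i (get i w)) ` W"
    proof -
      have "carrier (prod_module I M) = (\<Pi>\<^sub>E i\<in>I. \<theta> i ` S i)"
        unfolding prod_module_def by (auto intro!: PiE_cong simp: represented.carrier_eq[OF M])
      also have "\<dots> = (\<lambda>w. \<lambda>i\<in>I. \<theta> i (get i w)) ` W" by (rule PiE_image[OF get(2) surj])
      finally show ?thesis .
    qed
    show "\<zero>\<^bsub>prod_module I M\<^esub> = (\<lambda>i\<in>I. \<theta> i (get i 0))"
      by (auto simp: prod_module_def represented.zero_eq[OF M] additive.zero[OF get(1)] intro!: restrict_ext)
    show "(\<lambda>i\<in>I. \<theta> i (get i x)) \<oplus>\<^bsub>prod_module I M\<^esub> (\<lambda>i\<in>I. \<theta> i (get i y)) = (\<lambda>i\<in>I. \<theta> i (get i (x + y)))"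
      if "x \<in> W" "y \<in> W" for x y
      using that get(2)
      by (auto simp: prod_module_def represented.add_eq[OF M] additive.add[OF get(1)] intro!: restrict_ext)
    show "(\<lambda>i\<in>I. \<theta> i (get i x)) = (\<lambda>i\<in>I. \<theta> i (get i 0)) \<longleftrightarrow> x \<in> {w \<in> W. \<forall>i\<in>I. get i w \<in> S0 i}"
      if x: "x \<in> W" for x
    proof -
      have "(\<lambda>i\<in>I. \<theta> i (get i x)) = (\<lambda>i\<in>I. \<theta> i (get i 0)) \<longleftrightarrow> (\<forall>i\<in>I. \<theta> i (get i x) = \<theta> i 0)"
        by (auto simp: additive.zero[OF get(1)] fun_eq_iff restrict_def)
      also have "\<dots> \<longleftrightarrow> (\<forall>i\<in>I. get i x \<in> S0 i)"
        using x get(2) by (simp add: represented.eq_zero_iff[OF M])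
      finally show ?thesis using x by simp
    qed
  qed
qed

text \<open>
  A presentation of every term of a complex by additive groups on which the differential is
  induced by one map \<open>del\<close>.  The degree \<open>\<nu>\<close> part of the \<open>i\<close>-th term is the image of \<open>H\<close>.
\<close>
locale represented_complex =
  fixes M :: "int \<Rightarrow> ('a, 'b) graded_module" and d :: "int \<Rightarrow> 'b \<Rightarrow> 'b" and i :: int
    and S S0 :: "int \<Rightarrow> 'x::ab_group_add set" and \<theta> :: "int \<Rightarrow> 'x \<Rightarrow> 'b" and del :: "'x \<Rightarrow> 'x"
    and H :: "'x set" and \<nu> :: mdegree
  assumes terms: "represented (S k) (\<theta> k) (S0 k) (M k)"
    and additive_del: "additive del" and del_mem: "x \<in> S k \<Longrightarrow> del x \<in> S (k + 1)"
    and d_eq: "x \<in> S k \<Longrightarrow> d k (\<theta> k x) = \<theta> (k + 1) (del x)"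
    and H: "subgroup_set H" "H \<subseteq> S i" "hpart (M i) \<nu> = \<theta> i ` H"
    and S0_subgroup: "subgroup_set (S0 k)"
begin

text \<open>
  The coset of \<open>\<theta> y\<close> modulo the boundaries; see \<open>coset_eq\<close>.
\<close>
definition cls :: "'x \<Rightarrow> 'b set" where
  "cls y = {\<theta> i (del u + y) | u. u \<in> S (i - 1)}"

definition cyc :: "'x set" where "cyc = {y \<in> H. del y \<in> S0 (i + 1)}"

text \<open>
  Here \<open>u\<close> need not be homogeneous, because the cohomology is divided by all boundaries.
\<close>
definition bnd :: "'x set" where "bnd = {y \<in> cyc. \<exists>u\<in>S (i - 1). y - del u \<in> S0 i}"

lemma del_mem_i: "u \<in> S (i - 1) \<Longrightarrow> del u \<in> S i"
  using del_mem[of u "i - 1"] by simp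

lemmas del_add = additive.add[OF additive_del]
  and del_diff = additive.diff[OF additive_del] and del_zero = additive.zero[OF additive_del]
  and add_mem' = subgroup_set.add_mem[OF represented.axioms(1)[OF terms]]
  and zero_mem' = subgroup_set.zero_mem[OF represented.axioms(1)[OF terms]]
  and diff_mem' = subgroup_set.diff_mem[OF represented.axioms(1)[OF terms]]

lemma image_d: "d (i - 1) ` carrier (M (i - 1)) = {\<theta> i (del u) | u. u \<in> S (i - 1)}"
proof -
  have "d (i - 1) (\<theta> (i - 1) u) = \<theta> i (del u)" if "u \<in> S (i - 1)" for u
    using d_eq[OF that] by simp
  then show ?thesis unfolding represented.carrier_eq[OF terms] by (auto simp: image_iff)
qed

lemma coset_eq:
  assumes y: "y \<in> S i"
  shows "d (i - 1) ` carrier (M (i - 1)) +>\<^bsub>cocycles M d i\<^esub> \<theta> i y = cls y"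
proof -
  have "\<theta> i (del u) \<oplus>\<^bsub>M i\<^esub> \<theta> i y = \<theta> i (del u + y)" if "u \<in> S (i - 1)" for u
    by (rule represented.add_eq[OF terms del_mem_i[OF that] y])
  then show ?thesis
    unfolding a_r_coset_def' image_d cls_def cocycles_def Let_def by auto
qed

lemma cls_add:
  assumes x: "x \<in> S i" and y: "y \<in> S i"
  shows "set_add (cocycles M d i) (cls x) (cls y) = cls (x + y)"
proof -
  have add: "\<theta> i (del u + x) \<oplus>\<^bsub>M i\<^esub> \<theta> i (del v + y) = \<theta> i (del (u + v) + (x + y))"
    if "u \<in> S (i - 1)" "v \<in> S (i - 1)" for u v
    using that x y by (simp add: represented.add_eq[OF terms] add_mem' del_mem_i del_add algebra_simps)
  show ?thesis
  proof (intro equalityI subsetI)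
    fix z assume "z \<in> set_add (cocycles M d i) (cls x) (cls y)"
    then obtain u v where "u \<in> S (i - 1)" "v \<in> S (i - 1)"
      "z = \<theta> i (del u + x) \<oplus>\<^bsub>M i\<^esub> \<theta> i (del v + y)"
      by (auto simp: set_add_def' cls_def cocycles_def Let_def)
    then show "z \<in> cls (x + y)" using add unfolding cls_def by (auto intro: add_mem')
  next
    fix z assume "z \<in> cls (x + y)"
    then obtain u where u: "u \<in> S (i - 1)" "z = \<theta> i (del u + (x + y))" by (auto simp: cls_def)
    then have "z = \<theta> i (del u + x) \<oplus>\<^bsub>M i\<^esub> \<theta> i (del 0 + y)"
      by (simp add: add[OF u(1) zero_mem'])
    moreover have "\<theta> i (del u + x) \<in> cls x" "\<theta> i (del 0 + y) \<in> cls y"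
      using u(1) zero_mem' unfolding cls_def by blast+
    ultimately show "z \<in> set_add (cocycles M d i) (cls x) (cls y)"
      by (auto simp: set_add_def' cocycles_def Let_def)
  qed
qed

lemma cls_subset:
  assumes x: "x \<in> S i" "u \<in> S (i - 1)" "x - del u \<in> S0 i" and y: "y \<in> S i"
  shows "cls (x + y) \<subseteq> cls y" "cls y \<subseteq> cls (x + y)"
proof -
  have eq: "\<theta> i (del v + (x + y)) = \<theta> i (del (v + u) + y)" if "v \<in> S (i - 1)" for v
    using that x y
    by (subst represented.eq_iff[OF terms]) (simp_all add: add_mem' del_mem_i del_add algebra_simps)
  show "cls (x + y) \<subseteq> cls y"
    using eq x(2) by (auto simp: cls_def intro!: add_mem')
  show "cls y \<subseteq> cls (x + y)"
  proof
    fix z assume "z \<in> cls y"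
    then obtain v where v: "v \<in> S (i - 1)" "z = \<theta> i (del v + y)" by (auto simp: cls_def)
    then have "z = \<theta> i (del (v - u) + (x + y))"
      using eq[of "v - u"] x(2) by (simp add: diff_mem')
    then show "z \<in> cls (x + y)" using v(1) x(2) unfolding cls_def by (blast intro: diff_mem')
  qed
qed

lemma cls_eq_zero_iff:
  assumes y: "y \<in> S i"
  shows "cls y = cls 0 \<longleftrightarrow> (\<exists>u\<in>S (i - 1). y - del u \<in> S0 i)"
proof
  assume "cls y = cls 0"
  moreover have "\<theta> i (del 0 + y) \<in> cls y" using zero_mem' unfolding cls_def by blast
  ultimately obtain u where u: "u \<in> S (i - 1)" "\<theta> i y = \<theta> i (del u)"
    by (auto simp: cls_def del_zero)
  then have "y - del u \<in> S0 i"
    using y represented.eq_iff[OF terms] del_mem_i by blast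
  with u(1) show "\<exists>u\<in>S (i - 1). y - del u \<in> S0 i" by blast
next
  assume "\<exists>u\<in>S (i - 1). y - del u \<in> S0 i"
  then show "cls y = cls 0"
    using cls_subset[OF y _ _ zero_mem'] by fastforce
qed

lemma represented_cohomology:
  "represented cyc cls bnd (hpart_module \<phi> (cohomology M d i) \<nu>)"
proof -
  interpret H: subgroup_set H by (rule H)
  have cycH: "y \<in> cyc \<Longrightarrow> y \<in> S i" for y using H(2) by (auto simp: cyc_def)
  show ?thesis
  proof
    show "0 \<in> cyc"
      by (simp add: cyc_def H.zero_mem del_zero subgroup_set.zero_mem[OF S0_subgroup])
    show "x \<in> cyc \<Longrightarrow> y \<in> cyc \<Longrightarrow> x - y \<in> cyc" for x y
      by (simp add: cyc_def H.diff_mem del_diff subgroup_set.diff_mem[OF S0_subgroup])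
    have Z: "{x \<in> carrier (M i). d i x = \<zero>\<^bsub>M (i + 1)\<^esub>} \<inter> hpart (M i) \<nu> = \<theta> i ` cyc"
    proof -
      have "d i (\<theta> i y) = \<zero>\<^bsub>M (i + 1)\<^esub> \<longleftrightarrow> del y \<in> S0 (i + 1)" if "y \<in> S i" for y
        using d_eq[OF that] represented.eq_zero_iff[OF terms del_mem[OF that]]
          represented.zero_eq[OF terms, of "i + 1"] by simp
      then show ?thesis
        unfolding H(3) represented.carrier_eq[OF terms] using H(2) by (auto simp: cyc_def)
    qed
    have "hpart (cohomology M d i) \<nu> =
      (\<lambda>x. d (i - 1) ` carrier (M (i - 1)) +>\<^bsub>cocycles M d i\<^esub> x) ` \<theta> i ` cyc"
      unfolding cohomology_def quot_module_def by (simp add: cocycles_def Let_def Z)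
    also have "\<dots> = cls ` cyc" unfolding image_image using coset_eq cycH by (intro image_cong) auto
    finally show "carrier (hpart_module \<phi> (cohomology M d i) \<nu>) = cls ` cyc"
      by (simp add: hpart_module_def)
    show "\<zero>\<^bsub>hpart_module \<phi> (cohomology M d i) \<nu>\<^esub> = cls 0"
      unfolding hpart_module_def cohomology_def quot_module_def by (simp add: cls_def image_d)
    show "cls x \<oplus>\<^bsub>hpart_module \<phi> (cohomology M d i) \<nu>\<^esub> cls y = cls (x + y)"
      if "x \<in> cyc" "y \<in> cyc" for x y
      using cls_add[of x y] cycH that unfolding hpart_module_def cohomology_def quot_module_def by simp
    show "cls x = cls 0 \<longleftrightarrow> x \<in> bnd" if "x \<in> cyc" for x
      using cls_eq_zero_iff[of x] cycH that by (auto simp: bnd_def)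
  qed
qed

lemma smult_cls:
  assumes act: "additive act" "\<And>x. del (act x) = act (del x)" "\<And>k x. x \<in> S k \<Longrightarrow> act x \<in> S k"
    and smult: "\<And>x. x \<in> S i \<Longrightarrow> \<phi> a \<odot>\<^bsub>M i\<^esub> \<theta> i x = \<theta> i (act x)"
    and y: "y \<in> S i"
  shows "a \<odot>\<^bsub>hpart_module \<phi> (cohomology M d i) \<nu>\<^esub> cls y = cls (act y)"
proof -
  have coset: "d (i - 1) ` carrier (M (i - 1)) +>\<^bsub>cocycles M d i\<^esub> (\<phi> a \<odot>\<^bsub>cocycles M d i\<^esub> \<theta> i (del u + y)) = cls (act y)"
    if u: "u \<in> S (i - 1)" for u
  proof -
    have "\<phi> a \<odot>\<^bsub>cocycles M d i\<^esub> \<theta> i (del u + y) = \<theta> i (del (act u) + act y)"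
      using smult[of "del u + y"] u y
      by (simp add: cocycles_def Let_def add_mem' del_mem_i additive.add[OF act(1)] act(2))
    moreover have "del (act u) + act y \<in> S i"
      using u y by (simp add: add_mem' del_mem_i act(3))
    moreover have "cls (del (act u) + act y) = cls (act y)"
      using cls_subset[of "del (act u)" "act u" "act y"] u y
      by (simp add: del_mem_i act(3) subgroup_set.zero_mem[OF S0_subgroup])
    ultimately show ?thesis by (simp add: coset_eq)
  qed
  have ne: "cls y \<noteq> {}" using zero_mem' by (auto simp: cls_def)
  have "(\<Union>x\<in>cls y. d (i - 1) ` carrier (M (i - 1)) +>\<^bsub>cocycles M d i\<^esub>
      (\<phi> a \<odot>\<^bsub>cocycles M d i\<^esub> x)) = cls (act y)"
    (is "(\<Union>x\<in>_. ?F x) = _")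
  proof -
    have "?F x = cls (act y)" if "x \<in> cls y" for x
    proof -
      from that obtain u where "u \<in> S (i - 1)" "x = \<theta> i (del u + y)" by (auto simp: cls_def)
      then show ?thesis using coset by simp
    qed
    then have "(\<Union>x\<in>cls y. ?F x) = (\<Union>x\<in>cls y. cls (act y))" by (rule SUP_cong[OF refl])
    then show ?thesis using ne by simp
  qed
  moreover have "a \<odot>\<^bsub>hpart_module \<phi> (cohomology M d i) \<nu>\<^esub> X =
      (\<Union>x\<in>X. d (i - 1) ` carrier (M (i - 1)) +>\<^bsub>cocycles M d i\<^esub> (\<phi> a \<odot>\<^bsub>cocycles M d i\<^esub> x))" for X
    by (simp only: hpart_module_def cohomology_def quot_module_def module.simps graded_module.simps)
  ultimately show ?thesis by (simp only:)
qed

end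

lemma free_represented:
  fixes M :: "('a::comm_ring_1, 'b) module" and R :: "'a ring"
  assumes M: "represented S \<theta> S0 M"
    and free: "free_quotient (carrier R) act S S0"
    and act_mem: "\<And>a x. a \<in> carrier R \<Longrightarrow> x \<in> S \<Longrightarrow> act a x \<in> S"
    and smult: "\<And>a x. a \<in> carrier R \<Longrightarrow> x \<in> S \<Longrightarrow> a \<odot>\<^bsub>M\<^esub> \<theta> x = \<theta> (act a x)"
    and act: "\<And>a b x. act (a + b) x = act a x + act b x" "\<And>a b x. act (a * b) x = act a (act b x)"
    and R: "\<And>x y. x \<in> carrier R \<Longrightarrow> y \<in> carrier R \<Longrightarrow> x + y \<in> carrier R"
      "\<And>x y. x \<in> carrier R \<Longrightarrow> y \<in> carrier R \<Longrightarrow> x * y \<in> carrier R" "add R = (+)" "mult R = (*)"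
  shows "free_of_rank R M 1" and "module_iso R M (self_module R)"
proof -
  interpret represented S \<theta> S0 M by (rule M)
  from free obtain y0 where y0: "y0 \<in> S" and ex1: "\<And>y. y \<in> S \<Longrightarrow> \<exists>!a. a \<in> carrier R \<and> y - act a y0 \<in> S0"
    unfolding free_quotient_def by blast
  have ex1': "\<exists>!a. a \<in> carrier R \<and> x = \<theta> (act a y0)" if "x \<in> carrier M" for x
  proof -
    from that obtain y where y: "y \<in> S" "x = \<theta> y" by (auto simp: carrier_eq)
    have "a \<in> carrier R \<and> x = \<theta> (act a y0) \<longleftrightarrow> a \<in> carrier R \<and> y - act a y0 \<in> S0" for a
      unfolding y(2) by (intro conj_cong refl eq_iff[OF y(1) act_mem[OF _ y0]])
    with ex1[OF y(1)] show ?thesis by simp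
  qed
  have mem: "\<theta> (act a y0) \<in> carrier M" if "a \<in> carrier R" for a
    using act_mem[OF that y0] by (simp add: carrier_eq)
  define h where "h x = (THE a. a \<in> carrier R \<and> x = \<theta> (act a y0))" for x
  have h: "h x \<in> carrier R" "\<theta> (act (h x) y0) = x" if "x \<in> carrier M" for x
    using theI'[OF ex1'[OF that]] by (auto simp: h_def)
  have h_unique: "h (\<theta> (act a y0)) = a" if "a \<in> carrier R" for a
    unfolding h_def using that by (intro the1_equality[OF ex1'[OF mem[OF that]]]) simp
  show "module_iso R M (self_module R)"
    unfolding module_iso_def self_module_def
  proof (intro exI[of _ h] conjI ballI; simp)
    show "bij_betw h (carrier M) (carrier R)"
      by (rule bij_betw_byWitness[of _ "\<lambda>a. \<theta> (act a y0)"]) (auto simp: h h_unique mem)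
    fix x y assume x: "x \<in> carrier M" and y: "y \<in> carrier M"
    have "x \<oplus>\<^bsub>M\<^esub> y = \<theta> (act (h x) y0) \<oplus>\<^bsub>M\<^esub> \<theta> (act (h y) y0)" using x y by (simp add: h)
    also have "\<dots> = \<theta> (act (h x + h y) y0)"
      using x y by (subst add_eq) (simp_all add: act_mem h(1) y0 act)
    finally show "h (x \<oplus>\<^bsub>M\<^esub> y) = h x \<oplus>\<^bsub>R\<^esub> h y"
      using x y by (simp add: h_unique h R)
  next
    fix a x assume a: "a \<in> carrier R" and x: "x \<in> carrier M"
    have "a \<odot>\<^bsub>M\<^esub> x = a \<odot>\<^bsub>M\<^esub> \<theta> (act (h x) y0)" using x by (simp add: h)
    also have "\<dots> = \<theta> (act (a * h x) y0)" using a x by (subst smult) (simp_all add: act_mem h(1) y0 act)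
    finally show "h (a \<odot>\<^bsub>M\<^esub> x) = a \<otimes>\<^bsub>R\<^esub> h x"
      using a x by (simp add: h_unique h R)
  qed
  show "free_of_rank R M 1"
    unfolding free_of_rank_def
  proof (intro exI[of _ "{\<theta> y0}"] conjI ballI)
    show "{\<theta> y0} \<subseteq> carrier M" using y0 by (simp add: carrier_eq)
    fix x assume x: "x \<in> carrier M"
    have sum: "(\<Oplus>\<^bsub>M\<^esub>b\<in>{\<theta> y0}. c b \<odot>\<^bsub>M\<^esub> b) = \<theta> (act (c (\<theta> y0)) y0)" if "c (\<theta> y0) \<in> carrier R" for c
    proof -
      have "c (\<theta> y0) \<odot>\<^bsub>M\<^esub> \<theta> y0 = \<theta> (act (c (\<theta> y0)) y0)" using that y0 by (rule smult)
      then show ?thesis using mem[OF that] by simp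
    qed
    show "\<exists>!c. c \<in> {\<theta> y0} \<rightarrow>\<^sub>E carrier R \<and> x = (\<Oplus>\<^bsub>M\<^esub>b\<in>{\<theta> y0}. c b \<odot>\<^bsub>M\<^esub> b)"
    proof (rule ex1I[of _ "\<lambda>b\<in>{\<theta> y0}. h x"])
      show "(\<lambda>b\<in>{\<theta> y0}. h x) \<in> {\<theta> y0} \<rightarrow>\<^sub>E carrier R \<and>
          x = (\<Oplus>\<^bsub>M\<^esub>b\<in>{\<theta> y0}. (\<lambda>b\<in>{\<theta> y0}. h x) b \<odot>\<^bsub>M\<^esub> b)"
        using h[OF x] by (subst sum) simp_all
    next
      fix c assume c: "c \<in> {\<theta> y0} \<rightarrow>\<^sub>E carrier R \<and> x = (\<Oplus>\<^bsub>M\<^esub>b\<in>{\<theta> y0}. c b \<odot>\<^bsub>M\<^esub> b)"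
      then have c0: "c (\<theta> y0) \<in> carrier R" by auto
      then have "h x = c (\<theta> y0)" using c sum[of c] by (simp add: h_unique)
      then show "c = (\<lambda>b\<in>{\<theta> y0}. h x)"
        using c by (intro extensionalityI[of _ "{\<theta> y0}"]) (auto simp: PiE_iff)
    qed
  qed simp_all
qed

section \<open>Koszul complexes\<close>


definition kos :: "nat \<Rightarrow> (nat \<Rightarrow> 'a::comm_ring_1) \<Rightarrow> (nat set \<Rightarrow> 'a) \<Rightarrow> nat set \<Rightarrow> 'a" where
  "kos r f w I = (if I \<subseteq> {1..r} then \<Sum>i\<in>{1..r} - I. sg I i (f i * w (insert i I)) else 0)"

lemma additive_kos: "additive (kos r f)"
  by unfold_locales (auto simp: kos_def fun_eq_iff distrib_left sum.distrib)

lemma kos_map: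
  assumes h: "additive h" and hf: "\<And>i x. i \<in> {1..r} \<Longrightarrow> h (f i * x) = f i * h x"
  shows "h (kos r f w I) = kos r f (\<lambda>I. h (w I)) I"
  using h by (auto simp: kos_def additive.sum sg_additive hf additive.zero intro!: sum.cong)

lemma kos_kos: "kos r f (kos r f w) = 0"
proof
  fix I
  show "kos r f (kos r f w) I = 0 I"
  proof (cases "I \<subseteq> {1..r}")
    case True
    then have I: "finite I" by (rule finite_subset) simp
    have "kos r f (kos r f w) I = (\<Sum>a\<in>{1..r} - I. \<Sum>b\<in>{1..r} - I - {a}.
        sg I a (sg (insert a I) b (f a * (f b * w (insert b (insert a I))))))"
      unfolding kos_def[of r f _ I] using True
    proof (simp only: if_True, intro sum.cong refl)
      fix a assume a: "a \<in> {1..r} - I"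
      then have "insert a I \<subseteq> {1..r}" "{1..r} - insert a I = {1..r} - I - {a}" using True by auto
      then have "kos r f w (insert a I) = (\<Sum>b\<in>{1..r} - I - {a}. sg (insert a I) b (f b * w (insert b (insert a I))))"
        by (simp only: kos_def if_True)
      then show "sg I a (f a * kos r f w (insert a I)) = (\<Sum>b\<in>{1..r} - I - {a}.
          sg I a (sg (insert a I) b (f a * (f b * w (insert b (insert a I))))))"
        by (simp add: sum_distrib_left additive.sum[OF additive_sg] sg_mult)
    qed
    also have "\<dots> = 0"
    proof (rule sum_antisymmetric)
      fix a b assume "a \<in> {1..r} - I" "b \<in> {1..r} - I" "a < b"
      then show "sg I a (sg (insert a I) b (f a * (f b * w (insert b (insert a I))))) =
          - sg I b (sg (insert b I) a (f b * (f a * w (insert a (insert b I)))))"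
        using I by (simp add: sg_insert sg_commute[of I a I b] insert_commute mult.left_commute)
    qed simp
    finally show ?thesis by simp
  qed (simp add: kos_def)
qed

text \<open>
  Let \<open>q\<close> be a left inverse of multiplication by \<open>f i\<close> that is linear over the other \<open>f k\<close>.  Then
  \<open>w \<mapsto> e\<^sub>i \<and> q w\<close> is a homotopy from the identity to a map whose image has no components involving \<open>i\<close>.
  Assuming that the components of \<open>w\<close> do not involve indices below \<open>i\<close>, the index \<open>i\<close> comes first in all
  relevant sets and carries the sign \<open>+\<close>.
\<close>
lemma kos_exact_step:
  fixes f :: "nat \<Rightarrow> 'a::comm_ring_1"
  assumes i: "i \<in> {1..r}" and q: "additive q" "\<And>x. q (f i * x) = x"
    "\<And>k x. k \<in> {1..r} \<Longrightarrow> k \<noteq> i \<Longrightarrow> q (f k * x) = f k * q x"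
    and w: "\<And>I. w I \<noteq> 0 \<Longrightarrow> I \<subseteq> {1..r} \<and> I \<inter> {1..<i} = {}" "kos r f w = 0"
  defines "v \<equiv> \<lambda>I. if i \<in> I then q (w (I - {i})) else 0"
  shows "v I \<noteq> 0 \<Longrightarrow> I \<subseteq> {1..r}" and "w I \<noteq> kos r f v I \<Longrightarrow> I \<subseteq> {1..r} \<and> I \<inter> {1..i} = {}"
proof -
  have q0: "q 0 = 0" by (rule additive.zero[OF q(1)])
  show "I \<subseteq> {1..r}" if "v I \<noteq> 0" for I
  proof -
    have "w (I - {i}) \<noteq> 0" using that q0 by (auto simp: v_def split: if_splits)
    then show ?thesis using w(1)[of "I - {i}"] i by auto
  qed
  show "I \<subseteq> {1..r} \<and> I \<inter> {1..i} = {}" if ne: "w I \<noteq> kos r f v I"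
  proof (rule ccontr)
    assume neg: "\<not> (I \<subseteq> {1..r} \<and> I \<inter> {1..i} = {})"
    have "w I = kos r f v I"
    proof (cases "I \<subseteq> {1..r}")
      case False
      then show ?thesis using w(1)[of I] by (auto simp: kos_def)
    next
      case I: True
      then have fin: "finite I" by (rule finite_subset) simp
      show ?thesis
      proof (cases "I \<inter> {1..<i} = {}")
        case False
        then have wI: "w I = 0" using w(1)[of I] by auto
        from False obtain l where l: "l \<in> I" "l \<in> {1..<i}" by blast
        have "v (insert k I) = 0" for k
        proof -
          have "l \<in> (insert k I - {i}) \<inter> {1..<i}" using l by simp
          then have "w (insert k I - {i}) = 0" using w(1)[of "insert k I - {i}"] by blast
          then show ?thesis by (simp add: v_def q0)
        qed
        then show ?thesis using wI by (simp add: kos_def)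
      next
        case low: True
        then have iI: "i \<in> I" using neg I by (auto simp: less_le)
        have above: "i \<le> l" if "l \<in> I" for l using low that I by (metis IntI atLeastAtMost_iff atLeastLessThan_iff emptyE not_le subsetD)
        have "0 = kos r f w (I - {i})" using w(2) by simp
        also have "\<dots> = (\<Sum>k\<in>{1..r} - (I - {i}). sg (I - {i}) k (f k * w (insert k (I - {i}))))"
          using I by (auto simp: kos_def)
        also have "{1..r} - (I - {i}) = insert i ({1..r} - I)" using i iI by auto
        also have "(\<Sum>k\<in>\<dots>. sg (I - {i}) k (f k * w (insert k (I - {i})))) =
            f i * w I + (\<Sum>k\<in>{1..r} - I. sg (I - {i}) k (f k * w (insert k (I - {i}))))"
          using iI sg_below[of "I - {i}" i] above by (simp add: insert_absorb)
        also have "(\<Sum>k\<in>{1..r} - I. sg (I - {i}) k (f k * w (insert k (I - {i})))) =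
            - (\<Sum>k\<in>{1..r} - I. sg I k (f k * w (insert k (I - {i}))))"
          unfolding sum_negf[symmetric]
        proof (rule sum.cong[OF refl])
          fix k assume k: "k \<in> {1..r} - I"
          show "sg (I - {i}) k (f k * w (insert k (I - {i}))) = - sg I k (f k * w (insert k (I - {i})))"
          proof (cases "i < k")
            case True
            then show ?thesis by (simp add: sg_remove[OF fin iI])
          next
            case False
            moreover have "k \<noteq> i" using k iI by auto
            ultimately have "k \<in> insert k (I - {i}) \<inter> {1..<i}" using k by auto
            then have "w (insert k (I - {i})) = 0" using w(1)[of "insert k (I - {i})"] by blast
            then show ?thesis by simp
          qed
        qed
        finally have "f i * w I = (\<Sum>k\<in>{1..r} - I. sg I k (f k * w (insert k (I - {i}))))" by simp
        then have "w I = q (\<Sum>k\<in>{1..r} - I. sg I k (f k * w (insert k (I - {i}))))"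
          using q(2)[of "w I"] by simp
        also have "\<dots> = (\<Sum>k\<in>{1..r} - I. sg I k (f k * v (insert k I)))"
          unfolding additive.sum[OF q(1)]
        proof (rule sum.cong[OF refl])
          fix k assume k: "k \<in> {1..r} - I"
          have "insert k I - {i} = insert k (I - {i})" using k iI by auto
          then show "q (sg I k (f k * w (insert k (I - {i})))) = sg I k (f k * v (insert k I))"
            using k iI q(3)[of k] by (auto simp: sg_additive[OF q(1)] v_def)
        qed
        finally show ?thesis using I by (simp add: kos_def)
      qed
    qed
    with ne show False by simp
  qed
qed

text \<open>
  Applying \<open>kos_exact_step\<close> to \<open>i = 1, \<dots>, r\<close> in turn, a cocycle is changed by boundaries until no index
  is left, so that only the component at the empty set may remain, and this one is zero by degree.
\<close>
lemma kos_exact: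
  fixes f :: "nat \<Rightarrow> 'a::comm_ring_1"
  assumes R: "subgroup_set R" and fR: "\<And>i x. i \<in> {1..r} \<Longrightarrow> x \<in> R \<Longrightarrow> f i * x \<in> R"
    and q: "\<And>i. i \<in> {1..r} \<Longrightarrow> additive (q i)" "\<And>i x. i \<in> {1..r} \<Longrightarrow> q i (f i * x) = x"
      "\<And>i k x. i \<in> {1..r} \<Longrightarrow> k \<in> {1..r} \<Longrightarrow> k \<noteq> i \<Longrightarrow> q i (f k * x) = f k * q i x"
      "\<And>i x. i \<in> {1..r} \<Longrightarrow> x \<in> R \<Longrightarrow> q i x \<in> R"
    and w: "\<And>I. w I \<in> R" "\<And>I. w I \<noteq> 0 \<Longrightarrow> I \<subseteq> {1..r} \<and> card I = t" "kos r f w = 0" and t: "0 < t"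
  shows "\<exists>v. (\<forall>I. v I \<in> R \<and> (v I \<noteq> 0 \<longrightarrow> I \<subseteq> {1..r} \<and> card I = Suc t)) \<and> w = kos r f v"
proof -
  interpret R: subgroup_set R by (rule R)
  have kosR: "kos r f v I \<in> R" if "\<And>I. v I \<in> R" for v I
    using that by (auto simp: kos_def intro!: R.sum_mem R.sg_mem R.zero_mem fR)
  have "\<exists>v. (\<forall>I. v I \<in> R \<and> (v I \<noteq> 0 \<longrightarrow> I \<subseteq> {1..r})) \<and>
      (\<forall>I. w I \<noteq> kos r f v I \<longrightarrow> I \<subseteq> {1..r} \<and> I \<inter> {1..i} = {})" if "i \<le> r" for i
    using that
  proof (induction i)
    case 0
    show ?case
    proof (intro exI[of _ 0] conjI allI impI)
      fix I assume "w I \<noteq> kos r f 0 I"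
      then have "w I \<noteq> 0" by (simp add: additive.zero[OF additive_kos])
      then show "I \<subseteq> {1..r}" using w(2) by blast
    qed (simp_all add: R.zero_mem)
  next
    case (Suc i)
    then obtain v where v: "\<And>I. v I \<in> R" "\<And>I. v I \<noteq> 0 \<Longrightarrow> I \<subseteq> {1..r}"
      "\<And>I. w I \<noteq> kos r f v I \<Longrightarrow> I \<subseteq> {1..r} \<and> I \<inter> {1..i} = {}" by auto
    define w' where "w' = w - kos r f v"
    have i: "Suc i \<in> {1..r}" using Suc.prems by simp
    have w': "w' I \<noteq> 0 \<Longrightarrow> I \<subseteq> {1..r} \<and> I \<inter> {1..<Suc i} = {}" for I
      using v(3)[of I] by (auto simp: w'_def atLeastLessThanSuc_atLeastAtMost)
    have kw': "kos r f w' = 0"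
      by (simp add: w'_def additive.diff[OF additive_kos] w(3) kos_kos)
    define u where "u = (\<lambda>I. if Suc i \<in> I then q (Suc i) (w' (I - {Suc i})) else 0)"
    note step = kos_exact_step[OF i q(1)[OF i] q(2)[OF i] q(3)[OF i] w' kw', folded u_def]
    have uI: "I \<subseteq> {1..r}" if "u I \<noteq> 0" for I
      using step(1)[of I] that unfolding u_def by blast
    have uR: "u I \<in> R" for I
      by (auto simp: u_def w'_def intro!: q(4)[OF i] R.zero_mem R.diff_mem w kosR v)
    show ?case
    proof (intro exI[of _ "v + u"] conjI allI impI)
      fix I
      show "(v + u) I \<in> R" using v(1) uR by (simp add: R.add_mem)
      show "I \<subseteq> {1..r}" if "(v + u) I \<noteq> 0" using that v(2)[of I] uI[of I] by (cases "u I = 0") simp_all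
      have "kos r f (v + u) I = kos r f v I + kos r f u I" by (simp add: additive.add[OF additive_kos])
      then have "I \<subseteq> {1..r} \<and> I \<inter> {1..Suc i} = {}" if "w I \<noteq> kos r f (v + u) I"
        using step(2)[of I] that by (simp add: w'_def algebra_simps)
      then show "w I \<noteq> kos r f (v + u) I \<Longrightarrow> I \<subseteq> {1..r}" "w I \<noteq> kos r f (v + u) I \<Longrightarrow> I \<inter> {1..Suc i} = {}"
        by auto
    qed
  qed
  from this[of r] obtain v where v: "\<And>I. v I \<in> R" "\<And>I. v I \<noteq> 0 \<Longrightarrow> I \<subseteq> {1..r}"
      "\<And>I. w I \<noteq> kos r f v I \<Longrightarrow> I \<subseteq> {1..r} \<and> I \<inter> {1..r} = {}" by auto
  define v' where "v' I = (if card I = Suc t then v I else 0)" for I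
  have "w I = kos r f v' I" for I
  proof (cases "I \<subseteq> {1..r} \<and> card I = t")
    case True
    then have fin: "finite I" by (meson finite_atLeastAtMost finite_subset)
    have "I \<inter> {1..r} \<noteq> {}" using True t by (metis card.empty inf.absorb1 less_irrefl)
    then have "w I = kos r f v I" using v(3)[of I] by blast
    also have "\<dots> = kos r f v' I"
      using fin True by (auto simp: kos_def v'_def intro!: sum.cong)
    finally show ?thesis .
  next
    case False
    have "kos r f v' I = 0"
    proof (cases "I \<subseteq> {1..r}")
      case True
      then have "finite I" by (meson finite_atLeastAtMost finite_subset)
      then show ?thesis using True False by (auto simp: kos_def v'_def intro!: sum.neutral)
    qed (simp add: kos_def)
    then show ?thesis using w(2)[of I] False by auto
  qed
  then have "w = kos r f v'" by blast
  then show ?thesis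
    using v by (intro exI[of _ v']) (auto simp: v'_def R.zero_mem split: if_splits)
qed

section \<open>Division by a polynomial that is monic in one indeterminate\<close>

abbreviation (input) lookup where "lookup \<equiv> Poly_Mapping.lookup"
abbreviation (input) keys where "keys \<equiv> Poly_Mapping.keys"
abbreviation (input) single where "single \<equiv> Poly_Mapping.single"

lemma sum_singles: "x = (\<Sum>\<beta>\<in>keys x. single \<beta> (lookup x \<beta>))"
  by (rule poly_mapping_eqI) (simp add: lookup_sum lookup_single when_def in_keys_iff)

lemma lookup_mult_sum:
  "lookup (x * y) \<beta> = (\<Sum>a\<in>keys x. \<Sum>b\<in>keys y. if \<beta> = a + b then lookup x a * lookup y b else 0)"
proof -
  have "x * y = (\<Sum>a\<in>keys x. single a (lookup x a)) * (\<Sum>b\<in>keys y. single b (lookup y b))"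
    using sum_singles[of x] sum_singles[of y] by simp
  also have "\<dots> = (\<Sum>a\<in>keys x. \<Sum>b\<in>keys y. single (a + b) (lookup x a * lookup y b))"
    by (simp add: sum_product mult_single)
  finally show ?thesis by (simp add: lookup_sum lookup_single when_def eq_commute[of \<beta>])
qed

lemma lookup_single_mult:
  fixes a b :: "'e::cancel_comm_monoid_add"
  shows "lookup (single a c * y) (a + b) = c * lookup y b"
proof (cases "c = 0")
  case False
  have "lookup (single a c * y) (a + b) = (\<Sum>b'\<in>keys y. if b = b' then c * lookup y b' else 0)"
    unfolding lookup_mult_sum using False by simp
  also have "\<dots> = c * lookup y b" by (simp add: in_keys_iff)
  finally show ?thesis .
qed simp

definition low_deg :: "'u \<Rightarrow> nat \<Rightarrow> ('e \<Rightarrow>\<^sub>0 ('u \<Rightarrow>\<^sub>0 nat) \<Rightarrow>\<^sub>0 'k::zero) set" where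
  "low_deg u t = {x. \<forall>\<beta> \<gamma>. lookup (lookup x \<beta>) \<gamma> \<noteq> 0 \<longrightarrow> lookup \<gamma> u \<le> t}"

lemma low_deg_subgroup:
  "subgroup_set (low_deg u t :: ('e \<Rightarrow>\<^sub>0 ('u \<Rightarrow>\<^sub>0 nat) \<Rightarrow>\<^sub>0 'k::ab_group_add) set)"
proof
  fix x y :: "'e \<Rightarrow>\<^sub>0 ('u \<Rightarrow>\<^sub>0 nat) \<Rightarrow>\<^sub>0 'k"
  assume "x \<in> low_deg u t" "y \<in> low_deg u t"
  then show "x - y \<in> low_deg u t"
    unfolding low_deg_def mem_Collect_eq lookup_minus by (metis diff_zero eq_iff_diff_eq_0)
qed (simp add: low_deg_def)

lemma low_deg_mult:
  fixes x y :: "'e::comm_monoid_add \<Rightarrow>\<^sub>0 ('u \<Rightarrow>\<^sub>0 nat) \<Rightarrow>\<^sub>0 'k::comm_ring_1"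
  assumes x: "x \<in> low_deg u s" and y: "y \<in> low_deg u t"
  shows "x * y \<in> low_deg u (s + t)"
  unfolding low_deg_def
proof (intro CollectI allI impI)
  fix \<beta> \<gamma> assume "lookup (lookup (x * y) \<beta>) \<gamma> \<noteq> 0"
  then have "(\<Sum>a\<in>keys x. \<Sum>b\<in>keys y. lookup (if \<beta> = a + b then lookup x a * lookup y b else 0) \<gamma>) \<noteq> 0"
    by (simp add: lookup_mult_sum[of x y] lookup_sum)
  then obtain a where "(\<Sum>b\<in>keys y. lookup (if \<beta> = a + b then lookup x a * lookup y b else 0) \<gamma>) \<noteq> 0"
    by (rule sum.not_neutral_contains_not_neutral)
  then obtain b where "lookup (if \<beta> = a + b then lookup x a * lookup y b else 0) \<gamma> \<noteq> 0"
    by (rule sum.not_neutral_contains_not_neutral)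
  then have "\<gamma> \<in> keys (lookup x a * lookup y b)" by (auto simp: in_keys_iff split: if_splits)
  then obtain \<gamma>1 \<gamma>2 where "\<gamma>1 \<in> keys (lookup x a)" "\<gamma>2 \<in> keys (lookup y b)" "\<gamma> = \<gamma>1 + \<gamma>2"
    using keys_mult by blast
  with x y show "lookup \<gamma> u \<le> s + t"
    unfolding low_deg_def in_keys_iff by (simp add: lookup_add add_mono)
qed

definition indet :: "'u \<Rightarrow> 'e::zero \<Rightarrow>\<^sub>0 ('u \<Rightarrow>\<^sub>0 nat) \<Rightarrow>\<^sub>0 'k::zero_neq_one" where
  "indet u = single 0 (single (single u 1) 1)"

lemma lookup_indet_mult:
  fixes x :: "'e::cancel_comm_monoid_add \<Rightarrow>\<^sub>0 ('u \<Rightarrow>\<^sub>0 nat) \<Rightarrow>\<^sub>0 'k::comm_ring_1"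
  shows "lookup (lookup (indet u * x) \<beta>) (single u 1 + \<gamma>) = lookup (lookup x \<beta>) \<gamma>"
  using lookup_single_mult[of 0 "single (single u 1) 1" x \<beta>]
    lookup_single_mult[of "single u 1" 1 "lookup x \<beta>" \<gamma>]
  by (simp add: indet_def)

text \<open>
  Division with remainder by \<open>u + h\<close>, where \<open>u\<close> does not occur in \<open>h\<close>; remainders are the elements
  in which \<open>u\<close> does not occur.
\<close>
locale monic_division =
  fixes u :: 'u and h :: "'e::cancel_comm_monoid_add \<Rightarrow>\<^sub>0 ('u \<Rightarrow>\<^sub>0 nat) \<Rightarrow>\<^sub>0 'k::comm_ring_1"
  assumes h: "h \<in> low_deg u 0"
begin

sublocale low: subgroup_set "low_deg u t :: ('e \<Rightarrow>\<^sub>0 ('u \<Rightarrow>\<^sub>0 nat) \<Rightarrow>\<^sub>0 'k) set" for t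
  by (rule low_deg_subgroup)

text \<open>
  The leading coefficient of \<open>(u + h) q\<close> with respect to \<open>u\<close> is that of \<open>q\<close>.
\<close>
lemma mult_low_deg_zero:
  assumes q: "(indet u + h) * q \<in> low_deg u 0"
  shows "q = 0"
proof (rule ccontr)
  assume "q \<noteq> 0"
  define T where "T = (\<lambda>\<gamma>. lookup \<gamma> u) ` (\<Union>\<beta>\<in>keys q. keys (lookup q \<beta>))"
  have T: "finite T" by (simp add: T_def)
  obtain \<beta>0 where "lookup q \<beta>0 \<noteq> 0" using \<open>q \<noteq> 0\<close> by (metis lookup_zero poly_mapping_eqI)
  moreover then obtain \<gamma>0 where "lookup (lookup q \<beta>0) \<gamma>0 \<noteq> 0" by (metis lookup_zero poly_mapping_eqI)
  ultimately have "T \<noteq> {}" unfolding T_def by (auto simp: in_keys_iff)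
  with T have "Max T \<in> T" by simp
  then obtain \<beta> \<gamma> where g: "lookup (lookup q \<beta>) \<gamma> \<noteq> 0" "lookup \<gamma> u = Max T"
    unfolding T_def by (auto simp: in_keys_iff)
  have "q \<in> low_deg u (Max T)"
    unfolding low_deg_def
  proof (intro CollectI allI impI)
    fix \<beta> \<gamma> assume "lookup (lookup q \<beta>) \<gamma> \<noteq> 0"
    then have "\<beta> \<in> keys q" "\<gamma> \<in> keys (lookup q \<beta>)" by (auto simp: in_keys_iff)
    then have "lookup \<gamma> u \<in> T" unfolding T_def by blast
    then show "lookup \<gamma> u \<le> Max T" using T by simp
  qed
  then have hq: "h * q \<in> low_deg u (Max T)" using low_deg_mult[OF h] by simp
  have "(indet u + h) * q - h * q = indet u * q" by (simp add: algebra_simps)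
  moreover have "(indet u + h) * q \<in> low_deg u (Max T)"
    using q unfolding low_deg_def by (auto intro: le_trans)
  ultimately have "indet u * q \<in> low_deg u (Max T)"
    using low.diff_mem[OF _ hq] by metis
  then have "lookup (single u 1 + \<gamma>) u \<le> Max T"
    using g(1) unfolding low_deg_def mem_Collect_eq by (metis lookup_indet_mult)
  then show False using g(2) by (simp add: lookup_add)
qed

text \<open>
  The elements that can be divided are closed under multiplication by \<open>u\<close>: if \<open>y = (u + h) q + \<rho>\<close>, then
  \<open>u y = (u + h) (u q + \<rho>) - h \<rho>\<close>.  The subring \<open>R\<close> is carried along in order to show that the quotient
  of an element with restricted exponents is again such an element.
\<close>
lemma division_exists:
  assumes R: "subring_set R" and hR: "indet u \<in> R" "h \<in> R" and x: "x \<in> R"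
    and mono: "\<And>\<beta> \<gamma>. single \<beta> (single (\<gamma> - single u (lookup \<gamma> u)) (lookup (lookup x \<beta>) \<gamma>)) \<in> R"
  shows "\<exists>q\<in>R. x - (indet u + h) * q \<in> low_deg u 0"
proof -
  interpret R: subring_set R by (rule R)
  define good where "good y \<longleftrightarrow> (\<exists>q\<in>R. y - (indet u + h) * q \<in> R \<inter> low_deg u 0)" for y
  have good_0: "good 0"
    unfolding good_def by (intro bexI[of _ 0]) (simp_all add: R.zero_mem low.zero_mem)
  have good_add: "good (x + y)" if "good x" "good y" for x y
  proof -
    from that obtain p q where "p \<in> R" "q \<in> R" "x - (indet u + h) * p \<in> R \<inter> low_deg u 0"
      "y - (indet u + h) * q \<in> R \<inter> low_deg u 0" by (auto simp: good_def)
    moreover have "(x + y) - (indet u + h) * (p + q) = (x - (indet u + h) * p) + (y - (indet u + h) * q)"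
      by (simp add: algebra_simps)
    ultimately show ?thesis
      unfolding good_def by (intro bexI[of _ "p + q"]) (simp_all only: R.add_mem low.add_mem Int_iff)
  qed
  have good_sum: "good (sum f S)" if "\<And>i. i \<in> S \<Longrightarrow> good (f i)" for f :: "'i \<Rightarrow> _" and S
    using that by (induction S rule: infinite_finite_induct) (simp_all add: good_0 good_add)
  have good_low: "good y" if "y \<in> R" "y \<in> low_deg u 0" for y
    unfolding good_def using that by (intro bexI[of _ 0]) (simp_all add: R.zero_mem)
  have good_indet: "good (indet u * y)" if "good y" for y
  proof -
    from that obtain q where q: "q \<in> R" "y - (indet u + h) * q \<in> R \<inter> low_deg u 0" by (auto simp: good_def)
    let ?\<rho> = "y - (indet u + h) * q"
    have "indet u * y - (indet u + h) * (indet u * q + ?\<rho>) = - (h * ?\<rho>)" by (simp add: algebra_simps)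
    moreover have "h * ?\<rho> \<in> low_deg u 0" using low_deg_mult[OF h, of ?\<rho> 0] q(2) by simp
    moreover have "h * ?\<rho> \<in> R" using q(2) hR by (simp add: R.mult_mem)
    ultimately show ?thesis
      unfolding good_def using q hR
      by (intro bexI[of _ "indet u * q + ?\<rho>"]) (simp_all add: R.uminus_mem low.uminus_mem R.add_mem R.mult_mem)
  qed
  have good_power: "good (indet u ^ t * y)" if "y \<in> R" "y \<in> low_deg u 0" for t y
    by (induction t) (simp_all add: good_low that good_indet mult.assoc)
  have indet_power: "indet u ^ t = (single 0 (single (single u t) 1) :: 'e \<Rightarrow>\<^sub>0 ('u \<Rightarrow>\<^sub>0 nat) \<Rightarrow>\<^sub>0 'k)" for t
  proof (induction t)
    case (Suc t)
    then show ?case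
      by (simp add: indet_def mult_single Poly_Mapping.single_add[symmetric])
  qed simp
  have good_mono: "good (single \<beta> (single \<gamma> (lookup (lookup x \<beta>) \<gamma>)))" for \<beta> \<gamma>
  proof -
    let ?g = "\<gamma> - single u (lookup \<gamma> u)"
    have "single u (lookup \<gamma> u) + ?g = \<gamma>"
      by (rule poly_mapping_eqI) (simp add: lookup_add lookup_minus lookup_single when_def)
    then have "single \<beta> (single \<gamma> (lookup (lookup x \<beta>) \<gamma>)) =
        indet u ^ lookup \<gamma> u * single \<beta> (single ?g (lookup (lookup x \<beta>) \<gamma>))"
      by (simp add: indet_power mult_single)
    moreover have "single \<beta> (single ?g (lookup (lookup x \<beta>) \<gamma>)) \<in> low_deg u 0"
      by (auto simp: low_deg_def lookup_single when_def lookup_minus split: if_splits)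
    ultimately show ?thesis using good_power[OF mono] by simp
  qed
  have "x = (\<Sum>\<beta>\<in>keys x. single \<beta> (\<Sum>\<gamma>\<in>keys (lookup x \<beta>). single \<gamma> (lookup (lookup x \<beta>) \<gamma>)))"
    by (subst sum_singles[symmetric]) (rule sum_singles)
  also have "\<dots> = (\<Sum>\<beta>\<in>keys x. \<Sum>\<gamma>\<in>keys (lookup x \<beta>). single \<beta> (single \<gamma> (lookup (lookup x \<beta>) \<gamma>)))"
  proof -
    have "additive (single \<beta> :: (('u \<Rightarrow>\<^sub>0 nat) \<Rightarrow>\<^sub>0 'k) \<Rightarrow> _)" for \<beta> :: 'e
      by unfold_locales (rule Poly_Mapping.single_add)
    then show ?thesis by (simp add: additive.sum)
  qed
  finally have eq: "x = (\<Sum>\<beta>\<in>keys x. \<Sum>\<gamma>\<in>keys (lookup x \<beta>). single \<beta> (single \<gamma> (lookup (lookup x \<beta>) \<gamma>)))" .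
  have "good x" by (subst eq) (intro good_sum good_mono)
  then show ?thesis by (auto simp: good_def)
qed

definition quo :: "('e \<Rightarrow>\<^sub>0 ('u \<Rightarrow>\<^sub>0 nat) \<Rightarrow>\<^sub>0 'k) \<Rightarrow> ('e \<Rightarrow>\<^sub>0 ('u \<Rightarrow>\<^sub>0 nat) \<Rightarrow>\<^sub>0 'k)" where
  "quo x = (THE q. x - (indet u + h) * q \<in> low_deg u 0)"

lemma quo_eqI:
  assumes q: "x - (indet u + h) * q \<in> low_deg u 0"
  shows "quo x = q"
  unfolding quo_def
proof (rule the_equality, rule q)
  fix p assume p: "x - (indet u + h) * p \<in> low_deg u 0"
  have "(x - (indet u + h) * q) - (x - (indet u + h) * p) = (indet u + h) * (p - q)"
    by (simp add: algebra_simps)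
  then have "(indet u + h) * (p - q) \<in> low_deg u 0" using low.diff_mem[OF q p] by simp
  then show "p = q" using mult_low_deg_zero by fastforce
qed

lemma quo_mem:
  assumes "subring_set R" "indet u \<in> R" "h \<in> R" "x \<in> R"
    "\<And>\<beta> \<gamma>. single \<beta> (single (\<gamma> - single u (lookup \<gamma> u)) (lookup (lookup x \<beta>) \<gamma>)) \<in> R"
  shows "quo x \<in> R"
  using division_exists[OF assms] quo_eqI by metis

lemma quo: "x - (indet u + h) * quo x \<in> low_deg u 0"
proof -
  have "subring_set (UNIV :: ('e \<Rightarrow>\<^sub>0 ('u \<Rightarrow>\<^sub>0 nat) \<Rightarrow>\<^sub>0 'k) set)" by unfold_locales simp_all
  from division_exists[OF this, of x] quo_eqI show ?thesis by (metis UNIV_I)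
qed

lemma additive_quo: "additive quo"
proof
  fix x y
  show "quo (x + y) = quo x + quo y"
    using low.add_mem[OF quo[of x] quo[of y]] by (intro quo_eqI) (simp add: algebra_simps)
qed

lemma quo_mult_left: "quo ((indet u + h) * x) = x"
  by (rule quo_eqI) (simp add: low.zero_mem)

lemma quo_low_mult: "y \<in> low_deg u 0 \<Longrightarrow> quo (y * x) = y * quo x"
  using low_deg_mult[OF _ quo[of x], of y 0] by (intro quo_eqI) (simp add: algebra_simps)

end

section \<open>Laurent polynomials and the generic forms\<close>


type_synonym lexp = "(nat \<times> nat) \<Rightarrow>\<^sub>0 int"
type_synonym 'k lpoly = "lexp \<Rightarrow>\<^sub>0 'k apoly"

definition emb :: "xexp \<Rightarrow> lexp" where
  "emb = Poly_Mapping.map int"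

lemma lookup_emb [simp]: "lookup (emb \<alpha>) v = int (lookup \<alpha> v)"
  by (simp add: emb_def map.rep_eq when_def)

lemma emb_add: "emb (\<alpha> + \<beta>) = emb \<alpha> + emb \<beta>"
  by (rule poly_mapping_eqI) (simp add: lookup_add)

lemma emb_0 [simp]: "emb 0 = 0"
  by (rule poly_mapping_eqI) simp

lemma inj_emb: "inj emb"
proof
  fix \<alpha> \<beta> assume "emb \<alpha> = emb \<beta>"
  then have "lookup (emb \<alpha>) v = lookup (emb \<beta>) v" for v by simp
  then show "\<alpha> = \<beta>" by (intro poly_mapping_eqI) simp
qed

lemma keys_emb [simp]: "keys (emb \<alpha>) = keys \<alpha>"
  by (auto simp: in_keys_iff)

definition ldeg :: "(nat \<Rightarrow> nat) \<Rightarrow> lexp \<Rightarrow> nat \<Rightarrow> int" where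
  "ldeg n \<beta> j = (\<Sum>l = 1..n j + 1. lookup \<beta> (j, l))"

lemma ldeg_add: "ldeg n (\<alpha> + \<beta>) j = ldeg n \<alpha> j + ldeg n \<beta> j"
  by (simp add: ldeg_def lookup_add sum.distrib)

lemma ldeg_uminus: "ldeg n (- \<beta>) j = - ldeg n \<beta> j"
  by (simp add: ldeg_def sum_negf)

lemma ldeg_emb: "ldeg n (emb \<alpha>) j = int (xdeg n \<alpha> j)"
  by (simp add: ldeg_def xdeg_def)

definition homog :: "nat \<Rightarrow> (nat \<Rightarrow> nat) \<Rightarrow> mdegree \<Rightarrow> (lexp \<Rightarrow>\<^sub>0 'a::zero) set" where
  "homog s n \<nu> = {x. \<forall>\<beta>. lookup x \<beta> \<noteq> 0 \<longrightarrow> (\<forall>j\<in>{1..s}. ldeg n \<beta> j = \<nu> j)}"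

definition trunc :: "nat \<Rightarrow> (nat \<Rightarrow> nat) \<Rightarrow> mdegree \<Rightarrow> (lexp \<Rightarrow>\<^sub>0 'a::zero) \<Rightarrow> lexp \<Rightarrow>\<^sub>0 'a" where
  "trunc s n \<nu> x = Poly_Mapping.Abs_poly_mapping (\<lambda>\<beta>. if \<forall>j\<in>{1..s}. ldeg n \<beta> j = \<nu> j then lookup x \<beta> else 0)"

lemma lookup_trunc:
  "lookup (trunc s n \<nu> x) \<beta> = (if \<forall>j\<in>{1..s}. ldeg n \<beta> j = \<nu> j then lookup x \<beta> else 0)"
proof -
  have "finite {\<beta>. (if \<forall>j\<in>{1..s}. ldeg n \<beta> j = \<nu> j then lookup x \<beta> else 0) \<noteq> 0}"
    by (rule finite_subset[OF _ finite_keys[of x]]) (auto simp: in_keys_iff)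
  then show ?thesis by (simp add: trunc_def)
qed

lemma additive_trunc: "additive (trunc s n \<nu> :: (lexp \<Rightarrow>\<^sub>0 'a::ab_group_add) \<Rightarrow> _)"
  by unfold_locales (simp add: poly_mapping_eq_iff fun_eq_iff lookup_trunc lookup_add)

lemma trunc_homog: "trunc s n \<nu> x \<in> homog s n \<nu>"
  by (simp add: homog_def lookup_trunc)

lemma trunc_id: "x \<in> homog s n \<nu> \<Longrightarrow> trunc s n \<nu> x = x"
  by (auto simp: homog_def poly_mapping_eq_iff fun_eq_iff lookup_trunc)

lemma homog_subgroup: "subgroup_set (homog s n \<nu> :: (lexp \<Rightarrow>\<^sub>0 'a::ab_group_add) set)"
proof
  fix x y :: "lexp \<Rightarrow>\<^sub>0 'a"
  assume "x \<in> homog s n \<nu>" "y \<in> homog s n \<nu>"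
  then show "x - y \<in> homog s n \<nu>"
    unfolding homog_def mem_Collect_eq lookup_minus by (metis diff_zero eq_iff_diff_eq_0)
qed (simp add: homog_def)

lemma homog_mult:
  fixes x y :: "lexp \<Rightarrow>\<^sub>0 'a::comm_ring_1"
  assumes "x \<in> homog s n \<mu>" "y \<in> homog s n \<nu>" "\<And>j. j \<in> {1..s} \<Longrightarrow> \<mu> j + \<nu> j = \<kappa> j"
  shows "x * y \<in> homog s n \<kappa>"
  unfolding homog_def
proof (intro CollectI allI impI ballI)
  fix \<beta> j assume "lookup (x * y) \<beta> \<noteq> 0" and j: "j \<in> {1..s}"
  then obtain a b where "a \<in> keys x" "b \<in> keys y" "\<beta> = a + b"
    using keys_mult[of x y] unfolding in_keys_iff[symmetric] by blast
  with assms j show "ldeg n \<beta> j = \<kappa> j"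
    unfolding homog_def in_keys_iff by (simp add: ldeg_add)
qed

lemma trunc_mult:
  fixes x y :: "lexp \<Rightarrow>\<^sub>0 'a::comm_ring_1"
  assumes x: "x \<in> homog s n \<mu>" and \<nu>: "\<And>j. j \<in> {1..s} \<Longrightarrow> \<mu> j + \<nu> j = \<kappa> j"
  shows "trunc s n \<kappa> (x * y) = x * trunc s n \<nu> y"
proof (rule poly_mapping_eqI)
  fix \<beta>
  show "lookup (trunc s n \<kappa> (x * y)) \<beta> = lookup (x * trunc s n \<nu> y) \<beta>"
  proof (cases "\<forall>j\<in>{1..s}. ldeg n \<beta> j = \<kappa> j")
    case True
    have "lookup (x * (y - trunc s n \<nu> y)) \<beta> = 0"
    proof (rule ccontr)
      assume "lookup (x * (y - trunc s n \<nu> y)) \<beta> \<noteq> 0"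
      then obtain a b where ab: "a \<in> keys x" "b \<in> keys (y - trunc s n \<nu> y)" "\<beta> = a + b"
        using keys_mult[of x "y - trunc s n \<nu> y"] unfolding in_keys_iff[symmetric] by blast
      then have "\<forall>j\<in>{1..s}. ldeg n a j = \<mu> j" using x by (auto simp: homog_def in_keys_iff)
      then have "\<forall>j\<in>{1..s}. ldeg n b j = \<nu> j" using True \<nu> ab(3) by (force simp: ldeg_add)
      then show False using ab(2) by (simp add: in_keys_iff lookup_minus lookup_trunc)
    qed
    then show ?thesis using True by (simp add: lookup_trunc right_diff_distrib lookup_minus)
  next
    case False
    have "x * trunc s n \<nu> y \<in> homog s n \<kappa>" by (rule homog_mult[OF x trunc_homog \<nu>])
    then show ?thesis using False by (auto simp: homog_def lookup_trunc)
  qed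
qed

text \<open>
  The exponent of \<open>\<Prod>\<^sub>j X\<^bsub>j,\<iota> j\<^esub>\<^bsup>e j\<^esup>\<close>.
\<close>
definition expo :: "nat \<Rightarrow> (nat \<Rightarrow> nat) \<Rightarrow> (nat \<Rightarrow> nat) \<Rightarrow> xexp" where
  "expo s \<iota> e = (\<Sum>j = 1..s. single (j, \<iota> j) (e j))"

lemma lookup_expo: "lookup (expo s \<iota> e) (j, l) = (if j \<in> {1..s} \<and> \<iota> j = l then e j else 0)"
proof -
  have "lookup (expo s \<iota> e) (j, l) = (\<Sum>i = 1..s. if i = j then (if \<iota> j = l then e j else 0) else 0)"
    unfolding expo_def lookup_sum by (intro sum.cong refl) (simp add: lookup_single when_def)
  then show ?thesis by simp
qed

lemma prod_mpoly_var: "(\<Prod>j = 1..s. mpoly_var (j, \<iota> j)) = single (expo s \<iota> (\<lambda>_. 1)) (1 :: 'a::comm_ring_1)"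
proof -
  have "(\<Prod>j\<in>S. mpoly_var (j, \<iota> j)) = single (\<Sum>j\<in>S. single (j, \<iota> j) 1) (1 :: 'a)" if "finite S" for S
    using that by (induction S) (simp_all add: mpoly_var_def mult_single)
  then show ?thesis by (simp add: expo_def)
qed

locale generic_system =
  fixes s r :: nat and n :: "nat \<Rightarrow> nat" and d :: "nat \<Rightarrow> nat \<Rightarrow> nat" and g :: "'k::idom cpoly list"
  assumes s: "1 \<le> s" and d: "\<And>i j. i \<in> {1..r} \<Longrightarrow> j \<in> {1..s} \<Longrightarrow> 1 \<le> d i j"
    and g: "distinct g" "set g = sigmas s n"
begin

abbreviation K :: "nat set" where "K \<equiv> {..<length g}"

definition A :: "'k apoly set" where "A = carrier (ring_A s r n d)"

lemma A_iff: "a \<in> A \<longleftrightarrow> (\<forall>m. lookup a m \<noteq> 0 \<longrightarrow> keys m \<subseteq> uvars s r n d)"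
  by (auto simp: A_def ring_A_def mpoly_ring_def in_keys_iff)

sublocale A: subring_set A
proof
  fix x y assume x: "x \<in> A" and y: "y \<in> A"
  show "x - y \<in> A"
    using x y unfolding A_iff lookup_minus by (metis diff_zero eq_iff_diff_eq_0)
  show "x * y \<in> A"
    using x y unfolding A_def ring_A_def by (intro carrier_mpoly_ring_mult) simp_all
qed (simp_all add: A_iff lookup_one when_def)

lemma mpoly_var_A: "u \<in> uvars s r n d \<Longrightarrow> mpoly_var u \<in> A"
  by (auto simp: A_iff mpoly_var_def lookup_single when_def)

text \<open>
  The Laurent polynomials over the ring \<open>A\<close> of the theorem with negative exponents at most at the
  variables in \<open>V\<close>: this is the localization of the ring \<open>C\<close> at the product of these variables.
\<close>
definition laur :: "(nat \<times> nat) set \<Rightarrow> 'k lpoly set" where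
  "laur V = {x. \<forall>\<beta>. lookup x \<beta> \<in> A \<and>
    (lookup x \<beta> \<noteq> 0 \<longrightarrow> keys \<beta> \<subseteq> xvars s n \<and> {v. lookup \<beta> v < 0} \<subseteq> V)}"

lemma laur_mono: "V \<subseteq> W \<Longrightarrow> laur V \<subseteq> laur W"
  unfolding laur_def by blast

lemma single_laur:
  "a \<in> A \<Longrightarrow> keys \<beta> \<subseteq> xvars s n \<Longrightarrow> {v. lookup \<beta> v < 0} \<subseteq> V \<Longrightarrow> single \<beta> a \<in> laur V"
  by (auto simp: laur_def lookup_single when_def A.zero_mem)

lemma laur_subring: "subring_set (laur V)"
proof
  fix x y assume x: "x \<in> laur V" and y: "y \<in> laur V"
  show "x - y \<in> laur V"
    unfolding laur_def
  proof (intro CollectI allI)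
    fix \<beta>
    have "lookup x \<beta> \<noteq> 0 \<or> lookup y \<beta> \<noteq> 0" if "lookup (x - y) \<beta> \<noteq> 0"
      using that by (auto simp: lookup_minus)
    then show "lookup (x - y) \<beta> \<in> A \<and> (lookup (x - y) \<beta> \<noteq> 0 \<longrightarrow> keys \<beta> \<subseteq> xvars s n \<and> {v. lookup \<beta> v < 0} \<subseteq> V)"
      using x y unfolding laur_def by (auto simp: lookup_minus intro: A.diff_mem)
  qed
  show "x * y \<in> laur V"
    unfolding laur_def
  proof (intro CollectI allI conjI impI)
    fix \<beta>
    have "lookup x b \<in> A" "lookup y b \<in> A" for b using x y unfolding laur_def by blast+
    then show "lookup (x * y) \<beta> \<in> A"
      unfolding lookup_mult_sum by (auto intro!: A.sum_mem A.mult_mem A.zero_mem)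
    assume "lookup (x * y) \<beta> \<noteq> 0"
    then obtain a b where ab: "a \<in> keys x" "b \<in> keys y" "\<beta> = a + b"
      using keys_mult[of x y] unfolding in_keys_iff[symmetric] by blast
    then have "keys a \<subseteq> xvars s n" "{v. lookup a v < 0} \<subseteq> V" "keys b \<subseteq> xvars s n" "{v. lookup b v < 0} \<subseteq> V"
      using x y unfolding laur_def in_keys_iff by blast+
    moreover have "{v. lookup \<beta> v < 0} \<subseteq> {v. lookup a v < 0} \<union> {v. lookup b v < 0}"
      by (auto simp: ab(3) lookup_add)
    ultimately show "keys \<beta> \<subseteq> xvars s n" "{v. lookup \<beta> v < 0} \<subseteq> V"
      using Poly_Mapping.keys_add[of a b] unfolding ab(3) by blast+
  qed
next
  show "1 \<in> laur V"
    using single_laur[of 1 0 V] by (simp add: A.one_mem)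
qed (simp add: laur_def A.zero_mem)

sublocale laur: subring_set "laur V" for V
  by (rule laur_subring)

definition tup :: "nat \<Rightarrow> nat \<Rightarrow> nat" where
  "tup k = (SOME \<iota>. \<iota> \<in> (\<Pi>\<^sub>E j\<in>{1..s}. {1..n j + 1}) \<and> g ! k = (\<Prod>j = 1..s. mpoly_var (j, \<iota> j)))"

lemma tup:
  assumes "k \<in> K"
  shows "tup k \<in> (\<Pi>\<^sub>E j\<in>{1..s}. {1..n j + 1})" "g ! k = single (expo s (tup k) (\<lambda>_. 1)) 1"
proof -
  have "g ! k \<in> sigmas s n" using assms g(2) by force
  then have "\<exists>\<iota>. \<iota> \<in> (\<Pi>\<^sub>E j\<in>{1..s}. {1..n j + 1}) \<and> g ! k = (\<Prod>j = 1..s. mpoly_var (j, \<iota> j))"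
    by (auto simp: sigmas_def)
  from someI_ex[OF this] have *: "tup k \<in> (\<Pi>\<^sub>E j\<in>{1..s}. {1..n j + 1}) \<and>
      g ! k = (\<Prod>j = 1..s. mpoly_var (j, tup k j))"
    unfolding tup_def[symmetric] .
  then show "tup k \<in> (\<Pi>\<^sub>E j\<in>{1..s}. {1..n j + 1})" "g ! k = single (expo s (tup k) (\<lambda>_. 1)) 1"
    unfolding prod_mpoly_var by blast+
qed

definition supp :: "nat \<Rightarrow> (nat \<times> nat) set" where
  "supp k = (\<lambda>j. (j, tup k j)) ` {1..s}"

lemma supp_iff: "(j, l) \<in> supp k \<longleftrightarrow> j \<in> {1..s} \<and> l = tup k j"
  by (auto simp: supp_def)

sublocale transversal_family K supp "{1..s}" "xvars s n"
proof
  show "finite (xvars s n)" by (rule finite_xvars)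
  show "{1..s} \<noteq> {}" using s by simp
  show "supp k \<subseteq> xvars s n" if "k \<in> K" for k
    using tup(1)[OF that] by (auto simp: supp_def xvars_def PiE_iff)
  show "\<exists>!l. (j, l) \<in> supp k" if "k \<in> K" "j \<in> {1..s}" for k j
    using that by (simp add: supp_iff)
  show "xvars s n \<subseteq> {1..s} \<times> UNIV" by (auto simp: xvars_def)
  show "\<exists>k\<in>K. supp k = Q" if Q: "Q \<subseteq> xvars s n" "\<forall>j\<in>{1..s}. \<exists>!l. (j, l) \<in> Q" for Q
  proof -
    from Q(2) obtain \<iota> where \<iota>: "\<And>j l. j \<in> {1..s} \<Longrightarrow> (j, l) \<in> Q \<longleftrightarrow> l = \<iota> j" by metis
    have "restrict \<iota> {1..s} \<in> (\<Pi>\<^sub>E j\<in>{1..s}. {1..n j + 1})"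
    proof (intro restrict_PiE_iff[THEN iffD2] ballI)
      fix j assume j: "j \<in> {1..s}"
      then have "(j, \<iota> j) \<in> Q" using \<iota> by simp
      then have "(j, \<iota> j) \<in> xvars s n" using Q(1) by (rule subsetD[rotated])
      then show "\<iota> j \<in> {1..n j + 1}" by (simp add: xvars_def)
    qed
    then have "(\<Prod>j = 1..s. mpoly_var (j, restrict \<iota> {1..s} j)) \<in> set g"
      unfolding g(2) sigmas_def by blast
    then obtain k where k: "k \<in> K" "g ! k = (\<Prod>j = 1..s. mpoly_var (j, restrict \<iota> {1..s} j))"
      unfolding in_set_conv_nth by auto
    have "single (expo s (tup k) (\<lambda>_. 1)) (1 :: 'k apoly) = single (expo s (restrict \<iota> {1..s}) (\<lambda>_. 1)) 1"
      using tup(2)[OF k(1)] k(2) unfolding prod_mpoly_var by (rule subst)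
    then have "keys (single (expo s (tup k) (\<lambda>_. 1)) (1 :: 'k apoly)) =
        keys (single (expo s (restrict \<iota> {1..s}) (\<lambda>_. 1)) (1 :: 'k apoly))" by (rule arg_cong)
    then have eq: "expo s (tup k) (\<lambda>_. 1) = expo s (restrict \<iota> {1..s}) (\<lambda>_. 1)" by simp
    have same: "tup k j = \<iota> j" if "j \<in> {1..s}" for j
      using arg_cong[OF eq, of "\<lambda>m. lookup m (j, tup k j)"] that by (auto simp: lookup_expo split: if_splits)
    have "supp k = Q"
    proof (intro equalityI subsetI)
      fix v assume "v \<in> supp k"
      then show "v \<in> Q" using \<iota> same by (auto simp: supp_def)
    next
      fix v assume v: "v \<in> Q"
      obtain j l where jl: "v = (j, l)" by (cases v)
      then have "j \<in> {1..s}" using v Q(1) by (auto simp: xvars_def)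
      then show "v \<in> supp k" using v jl \<iota> same by (simp add: supp_iff)
    qed
    with k(1) show ?thesis by blast
  qed
  show "inj_on supp K"
  proof
    fix k k' assume k: "k \<in> K" "k' \<in> K" and eq: "supp k = supp k'"
    have "tup k j = tup k' j" if "j \<in> {1..s}" for j
      using arg_cong[OF eq, of "\<lambda>S. (j, tup k j) \<in> S"] that by (simp add: supp_iff)
    then have "expo s (tup k) (\<lambda>_. 1) = expo s (tup k') (\<lambda>_. 1)"
      unfolding expo_def by (intro sum.cong) simp_all
    then have "g ! k = g ! k'" using k by (simp add: tup(2))
    then show "k = k'" using k g(1) by (simp add: nth_eq_iff_index_eq)
  qed
qed simp_all

definition V :: "nat set \<Rightarrow> (nat \<times> nat) set" where "V J = (\<Union>k\<in>J. supp k)"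

lemma V_mono: "J \<subseteq> J' \<Longrightarrow> V J \<subseteq> V J'" by (auto simp: V_def)

definition F :: "nat \<Rightarrow> 'k lpoly" where
  "F i = (\<Sum>\<alpha>\<in>exps s n (d i). single (emb \<alpha>) (mpoly_var (i, \<alpha>)))"

lemma F_laur: "i \<in> {1..r} \<Longrightarrow> F i \<in> laur W"
  unfolding F_def by (intro laur.sum_mem single_laur mpoly_var_A) (auto simp: exps_def uvars_def)

lemma F_homog: "F i \<in> homog s n (\<lambda>j. int (d i j))"
  unfolding F_def
  by (intro subgroup_set.sum_mem[OF homog_subgroup])
     (auto simp: homog_def lookup_single when_def exps_def ldeg_emb)

lemma single_mpoly_var_low_deg: "v \<noteq> u \<Longrightarrow> single \<beta> (mpoly_var v) \<in> low_deg u 0"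
  by (auto simp: low_deg_def lookup_single when_def mpoly_var_def)

lemma F_low_deg: "k \<noteq> i \<Longrightarrow> F k \<in> low_deg (i, \<alpha>) 0"
  unfolding F_def
  by (intro subgroup_set.sum_mem[OF low_deg_subgroup] single_mpoly_var_low_deg) simp

text \<open>
  The variables in \<open>supp k\<close> are invertible, hence so is the monomial \<open>X\<^bsup>\<alpha>\<^esup>\<close> of multidegree \<open>d i\<close> in these
  variables.  Up to this unit, \<open>F i\<close> is monic of degree one in the indeterminate \<open>U\<^bsub>i,\<alpha>\<^esub>\<close>, which
  occurs in no other \<open>F k\<close>.
\<close>
lemma quotient_by_F:
  assumes k: "k \<in> K" "supp k \<subseteq> W" and i: "i \<in> {1..r}"
  shows "\<exists>q. additive q \<and> (\<forall>x. q (F i * x) = x) \<and> (\<forall>k x. k \<noteq> i \<longrightarrow> q (F k * x) = F k * q x) \<and>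
    (\<forall>x\<in>laur W. q x \<in> laur W)"
proof -
  define \<alpha> where "\<alpha> = expo s (tup k) (d i)"
  define u where "u = (i, \<alpha>)"
  \<comment> \<open>the inverse of the invertible monomial\<close>
  define E where "E = single (- emb \<alpha>) (1 :: 'k apoly)"
  define h where "h = E * F i - indet u"
  have \<alpha>0: "lookup \<alpha> v = 0" if "v \<notin> supp k" for v
    using that by (cases v) (auto simp: \<alpha>_def lookup_expo supp_iff)
  then have keys\<alpha>: "keys \<alpha> \<subseteq> supp k" by (auto simp: in_keys_iff)
  have "xdeg n \<alpha> j = d i j" if j: "j \<in> {1..s}" for j
  proof -
    have "tup k j \<in> {1..n j + 1}" using tup(1)[OF k(1)] j by (auto simp: PiE_iff)
    then have "(\<Sum>l = 1..n j + 1. if tup k j = l then d i j else 0) = d i j" by simp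
    then show ?thesis using j by (simp add: xdeg_def \<alpha>_def lookup_expo)
  qed
  then have \<alpha>: "\<alpha> \<in> exps s n (d i)" using keys\<alpha> supp_sub[OF k(1)] by (auto simp: exps_def)
  have u: "u \<in> uvars s r n d" using i \<alpha> by (simp add: u_def uvars_def)
  have EF: "E * F i = (\<Sum>\<gamma>\<in>exps s n (d i). single (emb \<gamma> - emb \<alpha>) (mpoly_var (i, \<gamma>)))"
    by (simp add: E_def F_def sum_distrib_left mult_single)
  have "E * F i = indet u + (\<Sum>\<gamma>\<in>exps s n (d i) - {\<alpha>}. single (emb \<gamma> - emb \<alpha>) (mpoly_var (i, \<gamma>)))"
    unfolding EF by (subst sum.remove[OF finite_exps \<alpha>]) (simp add: indet_def u_def mpoly_var_def)
  then have h_eq: "h = (\<Sum>\<gamma>\<in>exps s n (d i) - {\<alpha>}. single (emb \<gamma> - emb \<alpha>) (mpoly_var (i, \<gamma>)))"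
    by (simp add: h_def)
  interpret monic_division u h
  proof
    show "h \<in> low_deg u 0"
      unfolding h_eq
      by (intro subgroup_set.sum_mem[OF low_deg_subgroup] single_mpoly_var_low_deg) (auto simp: u_def)
  qed
  have Eh: "indet u + h = E * F i" by (simp add: h_def)
  have E_laur: "E \<in> laur W"
    unfolding E_def
  proof (rule single_laur)
    show "keys (- emb \<alpha>) \<subseteq> xvars s n" using keys\<alpha> supp_sub[OF k(1)] by simp
    have "{v. lookup (- emb \<alpha>) v < 0} \<subseteq> keys \<alpha>" by (auto simp: in_keys_iff)
    then show "{v. lookup (- emb \<alpha>) v < 0} \<subseteq> W" using keys\<alpha> k(2) by blast
  qed (rule A.one_mem)
  have indet_laur: "indet u \<in> laur W"
  proof -
    have "single 0 (mpoly_var u) \<in> laur W" by (rule single_laur) (simp_all add: mpoly_var_A u)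
    then show ?thesis by (simp add: indet_def mpoly_var_def)
  qed
  have h_laur: "h \<in> laur W"
    unfolding h_def by (intro laur.diff_mem laur.mult_mem E_laur F_laur i indet_laur)
  have quo_laur: "quo y \<in> laur W" if y: "y \<in> laur W" for y
  proof (rule quo_mem[OF laur_subring indet_laur h_laur y])
    fix \<beta> \<gamma>
    show "single \<beta> (single (\<gamma> - single u (lookup \<gamma> u)) (lookup (lookup y \<beta>) \<gamma>)) \<in> laur W"
    proof (cases "lookup (lookup y \<beta>) \<gamma> = 0")
      case False
      then have "lookup y \<beta> \<noteq> 0" by auto
      then have "keys \<beta> \<subseteq> xvars s n" "{v. lookup \<beta> v < 0} \<subseteq> W" "lookup y \<beta> \<in> A"
        using y by (auto simp: laur_def)
      moreover then have "keys \<gamma> \<subseteq> uvars s r n d" using False by (auto simp: A_iff)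
      then have "single (\<gamma> - single u (lookup \<gamma> u)) (lookup (lookup y \<beta>) \<gamma>) \<in> A"
        by (auto simp: A_iff lookup_single when_def in_keys_iff lookup_minus)
      ultimately show ?thesis by (intro single_laur)
    qed (simp add: laur.zero_mem)
  qed
  show ?thesis
  proof (intro exI[of _ "\<lambda>x. quo (E * x)"] conjI allI impI ballI)
    show "additive (\<lambda>x. quo (E * x))"
      by unfold_locales (simp add: distrib_left additive.add[OF additive_quo])
    show "quo (E * (F i * x)) = x" for x
      using quo_mult_left[of x] by (simp add: Eh mult.assoc)
    show "quo (E * (F k' * x)) = F k' * quo (E * x)" if "k' \<noteq> i" for k' x
      using quo_low_mult[of "F k'" "E * x"] F_low_deg[OF that] by (simp add: u_def mult.left_commute)
    show "quo (E * x) \<in> laur W" if "x \<in> laur W" for x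
      by (intro quo_laur laur.mult_mem E_laur that)
  qed
qed

lemma koszul_exact:
  assumes J: "J \<subseteq> K" "J \<noteq> {}"
    and w: "\<And>I. w I \<in> laur (V J)" "\<And>I. w I \<noteq> 0 \<Longrightarrow> I \<subseteq> {1..r} \<and> card I = t" "kos r F w = 0" "0 < t"
  shows "\<exists>v. (\<forall>I. v I \<in> laur (V J) \<and> (v I \<noteq> 0 \<longrightarrow> I \<subseteq> {1..r} \<and> card I = Suc t)) \<and> w = kos r F v"
proof -
  obtain k where k: "k \<in> J" using J(2) by blast
  have "\<forall>i\<in>{1..r}. \<exists>q. additive q \<and> (\<forall>x. q (F i * x) = x) \<and>
    (\<forall>k x. k \<noteq> i \<longrightarrow> q (F k * x) = F k * q x) \<and> (\<forall>x\<in>laur (V J). q x \<in> laur (V J))"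
  proof
    fix i assume i: "i \<in> {1..r}"
    have "k \<in> K" "supp k \<subseteq> V J" using k J(1) by (auto simp: V_def)
    then show "\<exists>q. additive q \<and> (\<forall>x. q (F i * x) = x) \<and>
      (\<forall>k x. k \<noteq> i \<longrightarrow> q (F k * x) = F k * q x) \<and> (\<forall>x\<in>laur (V J). q x \<in> laur (V J))"
      using i by (rule quotient_by_F)
  qed
  then obtain q where q: "\<And>i. i \<in> {1..r} \<Longrightarrow> additive (q i) \<and> (\<forall>x. q i (F i * x) = x) \<and>
    (\<forall>k x. k \<noteq> i \<longrightarrow> q i (F k * x) = F k * q i x) \<and> (\<forall>x\<in>laur (V J). q i x \<in> laur (V J))"
    by metis
  show ?thesis
    by (rule kos_exact[of "laur (V J)" r F q])
       (use q w in \<open>simp_all add: laur.subgroup_set_axioms laur.mult_mem F_laur del: One_nat_def\<close>)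
qed

end

section \<open>The double complex of Cech and Koszul cochains\<close>


lemma additive_apply: "additive (\<lambda>f. f i :: 'b::ab_group_add)"
  by unfold_locales simp

lemma additive_lookup: "additive (\<lambda>x. lookup x \<beta> :: 'b::ab_group_add)"
  by unfold_locales (simp add: lookup_add)

lemma cob_degree:
  assumes K: "finite K"
  shows "cob K (\<lambda>J. if int (card J) = t - 1 then b J else 0) J = (if int (card J) = t then cob K b J else 0)"
proof (cases "J \<subseteq> K")
  case True
  then have "finite J" using K finite_subset by blast
  then have "int (card (J - {k})) = t - 1 \<longleftrightarrow> int (card J) = t" if "k \<in> J" for k
    using that card_Suc_Diff1[of J k] by linarith
  then show ?thesis using True by (auto simp: cob_def intro!: sum.cong sum.neutral)
qed (simp add: cob_def)

context generic_system
begin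

type_synonym 'a bicochain = "nat set \<Rightarrow> nat set \<Rightarrow> 'a lpoly"

definition bicochains :: "(nat set \<Rightarrow> 'k lpoly set) \<Rightarrow> int \<Rightarrow> int \<Rightarrow> 'k bicochain set" where
  "bicochains G p q = {w. \<forall>J I. w J I \<in> laur (V J) \<inter> G I \<and>
    (w J I \<noteq> 0 \<longrightarrow> J \<subseteq> K \<and> I \<subseteq> {1..r} \<and> int (card J) = p \<and> int (card I) = q)}"

definition cech :: "'k bicochain \<Rightarrow> 'k bicochain" where "cech = cob K"

definition koszul :: "'k bicochain \<Rightarrow> 'k bicochain" where "koszul w = (\<lambda>J. kos r F (w J))"

definition scale :: "'k apoly \<Rightarrow> 'k bicochain \<Rightarrow> 'k bicochain" where
  "scale a w = (\<lambda>J I. single 0 a * w J I)"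

text \<open>
  The degree of the component at \<open>I\<close> of a Koszul cochain of degree \<open>\<delta>\<close>.
\<close>
definition deg :: "nat set \<Rightarrow> mdegree" where "deg I = (\<lambda>j. delta r n d j - (\<Sum>i\<in>I. int (d i j)))"

definition Gdeg :: "nat set \<Rightarrow> 'k lpoly set" where "Gdeg I = homog s n (deg I)"

text \<open>
  The conditions on \<open>G\<close> that make \<open>bicochains G\<close> a double complex of \<open>A\<close>-modules.  It is used for the
  homogeneous components of degree \<open>deg I\<close> and for \<open>UNIV\<close>, that is without a condition on degrees.
\<close>
definition is_grading :: "(nat set \<Rightarrow> 'k lpoly set) \<Rightarrow> bool" where
  "is_grading G \<longleftrightarrow> (\<forall>I. subgroup_set (G I)) \<and>
    (\<forall>I i x. I \<subseteq> {1..r} \<longrightarrow> i \<in> {1..r} - I \<longrightarrow> x \<in> G (insert i I) \<longrightarrow> F i * x \<in> G I) \<and>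
    (\<forall>I a. \<forall>x\<in>G I. single 0 a * x \<in> G I)"

lemma is_gradingD:
  assumes "is_grading G"
  shows "subgroup_set (G I)"
    and "I \<subseteq> {1..r} \<Longrightarrow> i \<in> {1..r} - I \<Longrightarrow> x \<in> G (insert i I) \<Longrightarrow> F i * x \<in> G I"
    and "x \<in> G I \<Longrightarrow> single 0 a * x \<in> G I"
  using assms unfolding is_grading_def by blast+

lemma is_grading_UNIV: "is_grading (\<lambda>_. UNIV)"
  by (simp add: is_grading_def subgroup_set_def)

lemma deg_insert: "finite I \<Longrightarrow> i \<notin> I \<Longrightarrow> int (d i j) + deg (insert i I) j = deg I j"
  by (simp add: deg_def)

lemma is_grading_Gdeg: "is_grading Gdeg"
  unfolding is_grading_def Gdeg_def
proof (intro conjI allI impI ballI homog_subgroup)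
  fix I i and x :: "'k lpoly" assume I: "I \<subseteq> {1..r}" and i: "i \<in> {1..r} - I" and x: "x \<in> homog s n (deg (insert i I))"
  have "finite I" using I by (rule finite_subset) simp
  then show "F i * x \<in> homog s n (deg I)"
    using i by (intro homog_mult[OF F_homog x] deg_insert) auto
next
  fix I and a :: "'k apoly" and x :: "'k lpoly" assume x: "x \<in> homog s n (deg I)"
  have a: "single 0 a \<in> homog s n (\<lambda>_. 0)"
    by (auto simp: homog_def lookup_single when_def ldeg_def)
  show "single 0 a * x \<in> homog s n (deg I)" by (rule homog_mult[OF a x]) simp
qed

lemma bicochainsI:
  assumes "\<And>J I. w J I \<in> laur (V J)" "\<And>J I. w J I \<in> G I"
    "\<And>J I. w J I \<noteq> 0 \<Longrightarrow> J \<subseteq> K \<and> I \<subseteq> {1..r} \<and> int (card J) = p \<and> int (card I) = q"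
  shows "w \<in> bicochains G p q"
  using assms unfolding bicochains_def by blast

lemma bicochainsD:
  assumes "w \<in> bicochains G p q"
  shows "w J I \<in> laur (V J)" "w J I \<in> G I"
    "w J I \<noteq> 0 \<Longrightarrow> J \<subseteq> K \<and> I \<subseteq> {1..r} \<and> int (card J) = p \<and> int (card I) = q"
  using assms unfolding bicochains_def by blast+

lemma bicochains_subgroup:
  assumes G: "is_grading G"
  shows "subgroup_set (bicochains G p q)"
proof -
  have Gs: "subgroup_set (G I)" for I using G by (simp add: is_grading_def)
  show ?thesis
  proof
    show "0 \<in> bicochains G p q"
      by (rule bicochainsI) (simp_all add: laur.zero_mem subgroup_set.zero_mem[OF Gs])
    fix x y assume x: "x \<in> bicochains G p q" and y: "y \<in> bicochains G p q"
    show "x - y \<in> bicochains G p q"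
    proof (rule bicochainsI)
      fix J I
      show "(x - y) J I \<in> laur (V J)" "(x - y) J I \<in> G I"
        by (simp_all add: laur.diff_mem subgroup_set.diff_mem[OF Gs] bicochainsD[OF x] bicochainsD[OF y])
      assume "(x - y) J I \<noteq> 0"
      then have "x J I \<noteq> 0 \<or> y J I \<noteq> 0" by auto
      then show "J \<subseteq> K \<and> I \<subseteq> {1..r} \<and> int (card J) = p \<and> int (card I) = q" (is ?P)
      proof
        assume "x J I \<noteq> 0"
        then show ?P by (rule bicochainsD(3)[OF x])
      next
        assume "y J I \<noteq> 0"
        then show ?P by (rule bicochainsD(3)[OF y])
      qed
    qed
  qed
qed

lemma additive_cech: "additive cech" unfolding cech_def by (rule additive_cob)

lemma additive_koszul: "additive koszul"
  by unfold_locales (simp add: koszul_def fun_eq_iff additive.add[OF additive_kos])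

lemma cech_apply: "cech w J I = cob K (\<lambda>J. w J I) J"
  unfolding cech_def by (rule cob_map[OF additive_apply])

lemma cech_cech: "cech (cech w) = 0"
  unfolding cech_def by (rule cob_cob) simp

lemma koszul_koszul: "koszul (koszul w) = 0"
  by (simp add: koszul_def fun_eq_iff kos_kos)

lemma cech_koszul: "cech (koszul w) = koszul (cech w)"
proof
  fix J show "cech (koszul w) J = koszul (cech w) J"
    unfolding koszul_def cech_def by (rule cob_map[OF additive_kos, symmetric])
qed

lemma additive_times_left: "additive (\<lambda>x. a * x :: 'a::comm_ring_1)"
  by unfold_locales (rule distrib_left)

lemma cech_scale: "cech (scale a w) = scale a (cech w)"
  by (simp add: fun_eq_iff cech_apply scale_def cob_scale)

lemma koszul_scale: "koszul (scale a w) = scale a (koszul w)"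
proof (intro ext)
  fix J I
  show "koszul (scale a w) J I = scale a (koszul w) J I"
    unfolding koszul_def scale_def
    by (rule kos_map[OF additive_times_left, symmetric]) (simp add: mult.left_commute)
qed

lemma additive_scale: "additive (scale a)"
  by unfold_locales (simp add: scale_def fun_eq_iff distrib_left)

lemma scale_bicochains:
  assumes "is_grading G" "a \<in> A" "w \<in> bicochains G p q"
  shows "scale a w \<in> bicochains G p q"
proof (rule bicochainsI)
  fix J I
  have "single 0 a \<in> laur (V J)" using assms(2) by (intro single_laur) simp_all
  then show "scale a w J I \<in> laur (V J)"
    using bicochainsD(1)[OF assms(3)] by (simp add: scale_def laur.mult_mem)
  show "scale a w J I \<in> G I"
    unfolding scale_def by (rule is_gradingD(3)[OF assms(1) bicochainsD(2)[OF assms(3)]])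
  assume "scale a w J I \<noteq> 0"
  then have "w J I \<noteq> 0" by (auto simp: scale_def)
  then show "J \<subseteq> K \<and> I \<subseteq> {1..r} \<and> int (card J) = p \<and> int (card I) = q"
    by (rule bicochainsD(3)[OF assms(3)])
qed

lemma cech_bicochains:
  assumes G: "is_grading G" and w: "w \<in> bicochains G p q"
  shows "cech w \<in> bicochains G (p + 1) q"
proof (rule bicochainsI)
  fix J I
  have GI: "subgroup_set (G I)" using G by (simp add: is_grading_def)
  have "w (J - {k}) I \<in> laur (V J)" for k
    using bicochainsD(1)[OF w, of "J - {k}" I] laur_mono[OF V_mono[of "J - {k}" J]] by blast
  then show "cech w J I \<in> laur (V J)"
    unfolding cech_apply cob_def by (simp add: laur.sum_mem laur.sg_mem laur.zero_mem)
  show "cech w J I \<in> G I"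
    unfolding cech_apply by (intro subgroup_set.cob_mem[OF GI] bicochainsD(2)[OF w])
  assume ne: "cech w J I \<noteq> 0"
  then have J: "J \<subseteq> K" by (auto simp: cech_apply cob_def split: if_splits)
  then have "(\<Sum>k\<in>J. sg J k (w (J - {k}) I)) \<noteq> 0" using ne by (simp add: cech_apply cob_def)
  then obtain k where k: "k \<in> J" "sg J k (w (J - {k}) I) \<noteq> 0"
    by (rule sum.not_neutral_contains_not_neutral)
  then have "w (J - {k}) I \<noteq> 0" by simp
  moreover have "finite J" using J by (rule finite_subset) simp
  ultimately show "J \<subseteq> K \<and> I \<subseteq> {1..r} \<and> int (card J) = p + 1 \<and> int (card I) = q"
    using bicochainsD(3)[OF w, of "J - {k}" I] J card_Suc_Diff1[OF _ k(1)] by auto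
qed

lemma koszul_bicochains:
  assumes G: "is_grading G" and w: "w \<in> bicochains G p q"
  shows "koszul w \<in> bicochains G p (q - 1)"
proof (rule bicochainsI)
  fix J I
  have GI: "subgroup_set (G I)" using G by (simp add: is_grading_def)
  have koszul_step: "w J (insert i I) \<in> laur (V J)" for i by (rule bicochainsD(1)[OF w])
  show "koszul w J I \<in> laur (V J)"
  proof -
    have "(\<Sum>i\<in>{1..r} - I. sg I i (F i * w J (insert i I))) \<in> laur (V J)"
      by (rule laur.sum_mem, rule laur.sg_mem, rule laur.mult_mem[OF F_laur koszul_step]) blast
    then show ?thesis by (simp add: koszul_def kos_def laur.zero_mem)
  qed
  have "F i * w J (insert i I) \<in> G I" if "I \<subseteq> {1..r}" "i \<in> {1..r} - I" for i
    by (rule is_gradingD(2)[OF G that bicochainsD(2)[OF w]])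
  then show "koszul w J I \<in> G I"
    unfolding koszul_def kos_def
    by (auto intro!: subgroup_set.sum_mem[OF GI] subgroup_set.sg_mem[OF GI]
      subgroup_set.zero_mem[OF GI])
  assume ne: "koszul w J I \<noteq> 0"
  then have I: "I \<subseteq> {1..r}" by (auto simp: koszul_def kos_def split: if_splits)
  then have "(\<Sum>i\<in>{1..r} - I. sg I i (F i * w J (insert i I))) \<noteq> 0"
    using ne by (simp add: koszul_def kos_def)
  then obtain i where i: "i \<in> {1..r} - I" "sg I i (F i * w J (insert i I)) \<noteq> 0"
    by (rule sum.not_neutral_contains_not_neutral)
  then have "w J (insert i I) \<noteq> 0" by auto
  moreover have "finite I" using I by (rule finite_subset) simp
  ultimately show "J \<subseteq> K \<and> I \<subseteq> {1..r} \<and> int (card J) = p \<and> int (card I) = q - 1"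
    using bicochainsD(3)[OF w, of J "insert i I"] I i(1) by auto
qed

definition pr :: "'k bicochain \<Rightarrow> 'k bicochain" where
  "pr w = (\<lambda>J I. trunc s n (deg I) (w J I))"

lemma additive_pr: "additive pr"
  by unfold_locales (simp add: pr_def fun_eq_iff additive.add[OF additive_trunc])

lemma trunc_laur: "x \<in> laur W \<Longrightarrow> trunc s n \<nu> x \<in> laur W"
  by (auto simp: laur_def lookup_trunc A.zero_mem)

lemma pr_bicochains: "w \<in> bicochains G p q \<Longrightarrow> pr w \<in> bicochains Gdeg p q"
proof (rule bicochainsI)
  fix J I assume w: "w \<in> bicochains G p q"
  show "pr w J I \<in> laur (V J)" using bicochainsD(1)[OF w] by (simp add: pr_def trunc_laur)
  show "pr w J I \<in> Gdeg I" by (simp add: pr_def Gdeg_def trunc_homog)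
  assume "pr w J I \<noteq> 0"
  then have "w J I \<noteq> 0" by (auto simp: pr_def additive.zero[OF additive_trunc])
  then show "J \<subseteq> K \<and> I \<subseteq> {1..r} \<and> int (card J) = p \<and> int (card I) = q"
    by (rule bicochainsD(3)[OF w])
qed

lemma pr_id: "w \<in> bicochains Gdeg p q \<Longrightarrow> pr w = w"
  using bicochainsD(2)[of w Gdeg p q] by (simp add: pr_def Gdeg_def trunc_id)

lemma pr_cech: "pr (cech w) = cech (pr w)"
proof (intro ext)
  fix J I
  show "pr (cech w) J I = cech (pr w) J I"
    unfolding pr_def cech_apply by (rule cob_map[OF additive_trunc])
qed

lemma pr_koszul: "pr (koszul w) = koszul (pr w)"
proof (intro ext)
  fix J I
  show "pr (koszul w) J I = koszul (pr w) J I"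
  proof (cases "I \<subseteq> {1..r}")
    case True
    then have I: "finite I" by (rule finite_subset) simp
    have "trunc s n (deg I) (F i * x) = F i * trunc s n (deg (insert i I)) x" if "i \<in> {1..r} - I" for i x
      using that I by (intro trunc_mult[OF F_homog] deg_insert) auto
    then show ?thesis
      using True by (simp add: pr_def koszul_def kos_def additive.sum[OF additive_trunc] sg_additive[OF additive_trunc])
  qed (simp add: pr_def koszul_def kos_def additive.zero[OF additive_trunc])
qed

lemma bicochains_mono: "(\<And>I. G I \<subseteq> G' I) \<Longrightarrow> bicochains G p q \<subseteq> bicochains G' p q"
  unfolding bicochains_def by blast

abbreviation X :: "int \<Rightarrow> int \<Rightarrow> 'k bicochain set" where "X \<equiv> bicochains Gdeg"

lemma exact_koszul:
  assumes p: "0 < p" "0 < q" and w: "w \<in> X p q" "koszul w = 0"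
  shows "\<exists>v\<in>X p (q + 1). w = koszul v"
proof -
  have ex: "\<exists>v. (\<forall>I. v I \<in> laur (V J) \<and> (v I \<noteq> 0 \<longrightarrow> J \<subseteq> K \<and> I \<subseteq> {1..r} \<and> int (card J) = p \<and> int (card I) = q + 1)) \<and>
      w J = kos r F v" for J
  proof (cases "J \<subseteq> K \<and> int (card J) = p")
    case True
    then have J: "J \<subseteq> K" "J \<noteq> {}" using p(1) by auto
    have "kos r F (w J) = 0" using w(2) by (simp add: koszul_def fun_eq_iff)
    moreover have "w J I \<noteq> 0 \<Longrightarrow> I \<subseteq> {1..r} \<and> card I = nat q" for I
      using bicochainsD(3)[OF w(1), of J I] by auto
    ultimately obtain v where "\<forall>I. v I \<in> laur (V J) \<and> (v I \<noteq> 0 \<longrightarrow> I \<subseteq> {1..r} \<and> card I = Suc (nat q))"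
      "w J = kos r F v"
      using koszul_exact[OF J, of "w J" "nat q"] bicochainsD(1)[OF w(1)] p(2) by auto
    then show ?thesis using True p(2) by (intro exI[of _ v]) auto
  next
    case False
    then have "w J I = 0" for I using bicochainsD(3)[OF w(1), of J I] by blast
    then have "w J = kos r F 0" by (simp add: fun_eq_iff additive.zero[OF additive_kos])
    then show ?thesis by (intro exI[of _ 0]) (simp add: laur.zero_mem)
  qed
  have "\<exists>v. \<forall>J. (\<forall>I. v J I \<in> laur (V J) \<and> (v J I \<noteq> 0 \<longrightarrow> J \<subseteq> K \<and> I \<subseteq> {1..r} \<and> int (card J) = p \<and> int (card I) = q + 1)) \<and>
      w J = kos r F (v J)"
    by (intro choice allI ex)
  then obtain v where vJ:
    "\<forall>J. (\<forall>I. v J I \<in> laur (V J) \<and> (v J I \<noteq> 0 \<longrightarrow> J \<subseteq> K \<and> I \<subseteq> {1..r} \<and> int (card J) = p \<and> int (card I) = q + 1)) \<and>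
      w J = kos r F (v J)"
    by (rule exE)
  then have v: "\<And>J I. v J I \<in> laur (V J) \<and> (v J I \<noteq> 0 \<longrightarrow>
      J \<subseteq> K \<and> I \<subseteq> {1..r} \<and> int (card J) = p \<and> int (card I) = q + 1)" "\<And>J. w J = kos r F (v J)"
    by simp_all
  have vX: "v \<in> bicochains (\<lambda>_. UNIV) p (q + 1)"
    unfolding bicochains_def using v(1) by simp
  have "w = koszul v" using v(2) by (simp add: koszul_def fun_eq_iff)
  then have "w = koszul (pr v)" using pr_id[OF w(1)] pr_koszul by metis
  then show ?thesis using pr_bicochains[OF vX] by blast
qed

section \<open>Exactness in the Cech direction\<close>

definition neg :: "lexp \<Rightarrow> (nat \<times> nat) set" where "neg \<beta> = {v. lookup \<beta> v < 0}"

lemma cochain_coeff: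
  assumes w: "w \<in> bicochains G p q"
  shows "(\<lambda>J. lookup (w J I) \<beta>) \<in> cochains A supp K (neg \<beta>)"
  unfolding cochains_def V_def[symmetric]
proof (intro CollectI allI conjI impI)
  fix J
  show "lookup (w J I) \<beta> \<in> A" using bicochainsD(1)[OF w, of J I] by (simp add: laur_def)
  assume ne: "lookup (w J I) \<beta> \<noteq> 0"
  then have "w J I \<noteq> 0" by auto
  then show "J \<subseteq> K" using bicochainsD(3)[OF w] by blast
  show "neg \<beta> \<subseteq> V J" using bicochainsD(1)[OF w, of J I] ne unfolding laur_def neg_def by blast
qed

lemma cob_coeff: "cob K (\<lambda>J. lookup (w J I) \<beta>) J = lookup (cech w J I) \<beta>"
  unfolding cech_apply by (rule cob_map[OF additive_lookup, symmetric])

text \<open>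
  The Cech differential acts on each coefficient separately.  Primitives of the coefficients can be
  assembled to Laurent polynomials, as only finitely many monomials occur in \<open>w\<close>.
\<close>
lemma cech_assemble:
  assumes w: "w \<in> X p q"
    and ex: "\<And>I \<beta>. \<exists>b\<in>cochains A supp K (neg \<beta>). (\<lambda>J. lookup (w J I) \<beta>) = cob K b"
  shows "\<exists>u\<in>X (p - 1) q. w = cech u"
proof -
  define b where "b I \<beta> = (SOME b. b \<in> cochains A supp K (neg \<beta>) \<and> (\<lambda>J. lookup (w J I) \<beta>) = cob K b)" for I \<beta>
  have "b I \<beta> \<in> cochains A supp K (neg \<beta>) \<and> (\<lambda>J. lookup (w J I) \<beta>) = cob K (b I \<beta>)" for I \<beta>
    unfolding b_def by (rule someI_ex[OF ex[of \<beta> I, unfolded Bex_def]])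
  then have b: "\<And>I \<beta>. b I \<beta> \<in> cochains A supp K (neg \<beta>)"
    "\<And>I \<beta>. (\<lambda>J. lookup (w J I) \<beta>) = cob K (b I \<beta>)" by simp_all
  define T where "T I = (\<Union>J\<in>Pow K. keys (w J I))" for I
  have T_iff: "\<beta> \<in> T I \<longleftrightarrow> (\<exists>J. lookup (w J I) \<beta> \<noteq> 0)" for I \<beta>
  proof
    assume "\<exists>J. lookup (w J I) \<beta> \<noteq> 0"
    then obtain J where J: "lookup (w J I) \<beta> \<noteq> 0" by blast
    then have "w J I \<noteq> 0" by auto
    then have "J \<subseteq> K" using bicochainsD(3)[OF w] by blast
    with J show "\<beta> \<in> T I" by (auto simp: T_def in_keys_iff)
  qed (auto simp: T_def in_keys_iff)
  define b' where "b' I \<beta> J = (if \<beta> \<in> T I then if int (card J) = p - 1 then b I \<beta> J else 0 else 0)" for I \<beta> J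
  define u where "u J I = Poly_Mapping.Abs_poly_mapping (\<lambda>\<beta>. b' I \<beta> J)" for J I
  have lookup_u: "lookup (u J I) \<beta> = b' I \<beta> J" for J I \<beta>
  proof -
    have "finite {\<beta>. b' I \<beta> J \<noteq> 0}"
      by (rule finite_subset[of _ "T I"]) (auto simp: b'_def T_def split: if_splits)
    then show ?thesis by (simp add: u_def)
  qed
  have b'_ne: "\<beta> \<in> T I \<and> int (card J) = p - 1 \<and> b I \<beta> J \<noteq> 0" if "b' I \<beta> J \<noteq> 0" for I \<beta> J
    using that by (simp add: b'_def split: if_splits)
  have "u \<in> X (p - 1) q"
  proof (rule bicochainsI)
    fix J I
    show "u J I \<in> laur (V J)"
      unfolding laur_def mem_Collect_eq lookup_u
    proof (intro allI conjI)
      fix \<beta> :: lexp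
      show "b' I \<beta> J \<in> A" using b(1)[of I \<beta>] by (simp add: b'_def cochains_def A.zero_mem)
      show "b' I \<beta> J \<noteq> 0 \<longrightarrow> keys \<beta> \<subseteq> xvars s n \<and> {v. lookup \<beta> v < 0} \<subseteq> V J"
      proof (intro impI conjI)
        assume ne: "b' I \<beta> J \<noteq> 0"
        then obtain J' where "lookup (w J' I) \<beta> \<noteq> 0" using b'_ne T_iff by blast
        then show "keys \<beta> \<subseteq> xvars s n" using bicochainsD(1)[OF w, of J' I] by (simp add: laur_def)
        show "{v. lookup \<beta> v < 0} \<subseteq> V J"
          using b(1)[of I \<beta>] b'_ne[OF ne] unfolding cochains_def V_def neg_def by blast
      qed
    qed
    show "u J I \<in> Gdeg I"
      unfolding Gdeg_def homog_def mem_Collect_eq lookup_u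
    proof (intro allI impI)
      fix \<beta> assume "b' I \<beta> J \<noteq> 0"
      then obtain J' where "lookup (w J' I) \<beta> \<noteq> 0" using b'_ne T_iff by blast
      then show "\<forall>j\<in>{1..s}. ldeg n \<beta> j = deg I j"
        using bicochainsD(2)[OF w, of J' I] by (simp add: Gdeg_def homog_def)
    qed
    assume "u J I \<noteq> 0"
    then obtain \<beta> where "lookup (u J I) \<beta> \<noteq> 0" by (metis lookup_zero poly_mapping_eqI)
    then have ne: "b' I \<beta> J \<noteq> 0" by (simp add: lookup_u)
    then obtain J' where "lookup (w J' I) \<beta> \<noteq> 0" using b'_ne T_iff by blast
    then have "w J' I \<noteq> 0" by auto
    moreover have "J \<subseteq> K" using b(1)[of I \<beta>] b'_ne[OF ne] unfolding cochains_def by blast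
    ultimately show "J \<subseteq> K \<and> I \<subseteq> {1..r} \<and> int (card J) = p - 1 \<and> int (card I) = q"
      using bicochainsD(3)[OF w] b'_ne[OF ne] by blast
  qed
  moreover have "w J I = cech u J I" for J I
  proof (rule poly_mapping_eqI)
    fix \<beta>
    have "lookup (cech u J I) \<beta> = cob K (b' I \<beta>) J"
      unfolding cob_coeff[symmetric] lookup_u by simp
    also have "\<dots> = lookup (w J I) \<beta>"
    proof (cases "\<beta> \<in> T I")
      case True
      then have "b' I \<beta> = (\<lambda>J. if int (card J) = p - 1 then b I \<beta> J else 0)"
        by (simp add: b'_def fun_eq_iff)
      then have "cob K (b' I \<beta>) J = (if int (card J) = p then cob K (b I \<beta>) J else 0)"
        by (simp add: cob_degree)
      also have "cob K (b I \<beta>) J = lookup (w J I) \<beta>" using fun_cong[OF b(2)] by simp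
      also have "(if int (card J) = p then lookup (w J I) \<beta> else 0) = lookup (w J I) \<beta>"
        using bicochainsD(3)[OF w, of J I] by (cases "w J I = 0") auto
      finally show ?thesis .
    next
      case False
      then have "b' I \<beta> = 0" by (simp add: b'_def fun_eq_iff)
      moreover have "lookup (w J I) \<beta> = 0" using False T_iff by blast
      ultimately show ?thesis by simp
    qed
    finally show "lookup (w J I) \<beta> = lookup (cech u J I) \<beta>" by simp
  qed
  then have "w = cech u" by blast
  ultimately show ?thesis by blast
qed

lemma K_eq: "{k \<in> K. supp k \<subseteq> xvars s n} = K" using supp_sub by auto

lemma K_ne: "K \<noteq> {}"
proof -
  have "\<exists>k\<in>K. supp k = (\<lambda>j. (j, 1)) ` {1..s}"
    by (rule all_transversals) (auto simp: xvars_def)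
  then show ?thesis by blast
qed

lemma acyc_partial:
  assumes \<beta>: "keys \<beta> \<subseteq> xvars s n" and jl: "(j, l) \<in> neg \<beta>" "(j, l') \<in> xvars s n" "(j, l') \<notin> neg \<beta>"
  shows "acyc A supp K (neg \<beta>)"
proof -
  have "neg \<beta> \<subseteq> xvars s n" using \<beta> by (auto simp: neg_def in_keys_iff)
  then have "acyc A supp {k \<in> K. supp k \<subseteq> xvars s n} (neg \<beta>)"
    by (rule acyc_partial_row[OF A.subgroup_set_axioms _ jl(1,3)]) (use jl(2) \<open>neg \<beta> \<subseteq> xvars s n\<close> in simp_all)
  then show ?thesis unfolding K_eq .
qed

lemma full_row_degree:
  assumes "\<And>l. l \<in> {1..n j + 1} \<Longrightarrow> (j, l) \<in> neg \<beta>"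
  shows "ldeg n \<beta> j \<le> - int (n j) - 1"
proof -
  have "ldeg n \<beta> j \<le> (\<Sum>l = 1..n j + 1. - 1)"
    unfolding ldeg_def
  proof (rule sum_mono)
    fix l assume "l \<in> {1..n j + 1}"
    then have "(j, l) \<in> neg \<beta>" by (rule assms)
    then show "lookup \<beta> (j, l) \<le> - 1" by (simp add: neg_def)
  qed
  then show ?thesis by simp
qed

text \<open>
  In these degrees no packet of variables has only negative exponents.
\<close>
lemma acyc_not_full:
  assumes \<beta>: "keys \<beta> \<subseteq> xvars s n" and deg: "\<And>j. j \<in> {1..s} \<Longrightarrow> - int (n j) \<le> ldeg n \<beta> j"
  shows "acyc A supp K (neg \<beta>)"
proof (cases "neg \<beta> = {}")
  case True
  then show ?thesis using A.acyc_cone[of K supp] K_ne by simp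
next
  case False
  then obtain j l where jl: "(j, l) \<in> neg \<beta>" by auto
  then have "(j, l) \<in> keys \<beta>" by (simp add: neg_def in_keys_iff)
  then have "(j, l) \<in> xvars s n" using \<beta> by blast
  then have j: "j \<in> {1..s}" by (simp add: xvars_def)
  have "\<not> (\<forall>l\<in>{1..n j + 1}. (j, l) \<in> neg \<beta>)"
  proof
    assume "\<forall>l\<in>{1..n j + 1}. (j, l) \<in> neg \<beta>"
    then have "ldeg n \<beta> j \<le> - int (n j) - 1" by (intro full_row_degree) blast
    then show False using deg[OF j] by simp
  qed
  then obtain l' where "l' \<in> {1..n j + 1}" "(j, l') \<notin> neg \<beta>" by blast
  then show ?thesis using j by (intro acyc_partial[OF \<beta> jl]) (simp_all add: xvars_def)
qed

lemma deg_not_full: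
  assumes "I \<subset> {1..r}" and j: "j \<in> {1..s}"
  shows "- int (n j) \<le> deg I j"
proof -
  from assms obtain i where i: "i \<in> {1..r} - I" by blast
  have "(\<Sum>i = 1..r. int (d i j)) - (\<Sum>i\<in>I. int (d i j)) = (\<Sum>i\<in>{1..r} - I. int (d i j))"
    using assms(1) by (subst sum_diff[symmetric]) auto
  then have "deg I j = (\<Sum>i\<in>{1..r} - I. int (d i j)) - int (n j) - 1"
    by (simp add: deg_def delta_def)
  moreover have "int (d i j) \<le> (\<Sum>i\<in>{1..r} - I. int (d i j))" by (rule member_le_sum[OF i]) simp_all
  moreover have "1 \<le> d i j" using d[of i j] i j by simp
  ultimately show ?thesis by linarith
qed

lemma deg_full: "deg {1..r} j = - int (n j) - 1"
  by (simp add: deg_def delta_def)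

lemma coeff_support:
  assumes w: "w \<in> X p q" and ne: "lookup (w J I) \<beta> \<noteq> 0"
  shows "keys \<beta> \<subseteq> xvars s n" "\<forall>j\<in>{1..s}. ldeg n \<beta> j = deg I j" "I \<subseteq> {1..r}" "int (card I) = q" "int (card J) = p"
proof -
  have "w J I \<noteq> 0" using ne by auto
  then show "I \<subseteq> {1..r}" "int (card I) = q" "int (card J) = p" using bicochainsD(3)[OF w] by blast+
  show "keys \<beta> \<subseteq> xvars s n" using bicochainsD(1)[OF w, of J I] ne by (simp add: laur_def)
  show "\<forall>j\<in>{1..s}. ldeg n \<beta> j = deg I j"
    using bicochainsD(2)[OF w, of J I] ne by (simp add: Gdeg_def homog_def)
qed

lemma coeff_acyc:
  assumes w: "cech w = 0" "w \<in> X p q" and ac: "(\<exists>J. lookup (w J I) \<beta> \<noteq> 0) \<Longrightarrow> acyc A supp K (neg \<beta>)"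
  shows "\<exists>b\<in>cochains A supp K (neg \<beta>). (\<lambda>J. lookup (w J I) \<beta>) = cob K b"
proof (cases "\<exists>J. lookup (w J I) \<beta> \<noteq> 0")
  case True
  have "cob K (\<lambda>J. lookup (w J I) \<beta>) = 0" by (simp add: fun_eq_iff cob_coeff w(1))
  then show ?thesis using ac[OF True] cochain_coeff[OF w(2)] unfolding acyc_def by blast
next
  case False
  then have "(\<lambda>J. lookup (w J I) \<beta>) = cob K 0" by (simp add: fun_eq_iff)
  moreover have "0 \<in> cochains A supp K (neg \<beta>)" by (simp add: cochains_def A.zero_mem)
  ultimately show ?thesis by blast
qed

lemma exact_cech:
  assumes q: "q < int r" and w: "w \<in> X p q" "cech w = 0"
  shows "\<exists>u\<in>X (p - 1) q. w = cech u"
proof (rule cech_assemble[OF w(1)], rule coeff_acyc[OF w(2,1)])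
  fix I \<beta> assume "\<exists>J. lookup (w J I) \<beta> \<noteq> 0"
  then obtain J where "lookup (w J I) \<beta> \<noteq> 0" by blast
  note supp = coeff_support[OF w(1) this]
  have "I \<noteq> {1..r}" using supp(4) q by auto
  then have "I \<subset> {1..r}" using supp(3) by blast
  then show "acyc A supp K (neg \<beta>)"
    using supp deg_not_full by (intro acyc_not_full) auto
qed

text \<open>
  The exponent with all entries \<open>- 1\<close>, the only one of degree \<open>deg {1..r}\<close> with nonzero cohomology.
\<close>
definition corner :: lexp where "corner = (\<Sum>v\<in>xvars s n. single v (- 1))"

lemma lookup_corner: "lookup corner v = (if v \<in> xvars s n then - 1 else 0)"
  by (simp add: corner_def lookup_sum lookup_single when_def finite_xvars)

lemma neg_corner: "neg corner = xvars s n" and keys_corner: "keys corner = xvars s n"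
  by (auto simp: neg_def lookup_corner in_keys_iff split: if_splits)

lemma ldeg_corner: "j \<in> {1..s} \<Longrightarrow> ldeg n corner j = - int (n j) - 1"
  by (simp add: ldeg_def lookup_corner xvars_def)

text \<open>
  Every row sum is negative, so every row has a negative entry.  If the cohomology does not vanish,
  then by \<open>acyc_partial\<close> all entries are negative, and the row sums force them to be \<open>- 1\<close>.
\<close>
lemma acyc_not_corner:
  assumes \<beta>: "keys \<beta> \<subseteq> xvars s n" and deg: "\<And>j. j \<in> {1..s} \<Longrightarrow> ldeg n \<beta> j = - int (n j) - 1"
    and ne: "\<beta> \<noteq> corner"
  shows "acyc A supp K (neg \<beta>)"
proof (rule ccontr)
  assume nac: "\<not> acyc A supp K (neg \<beta>)"
  have full: "(j, l') \<in> neg \<beta>" if "(j, l) \<in> neg \<beta>" "(j, l') \<in> xvars s n" for j l l'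
    using acyc_partial[OF \<beta> that] nac by blast
  have all: "(j, l) \<in> neg \<beta>" if jl: "(j, l) \<in> xvars s n" for j l
  proof -
    have j: "j \<in> {1..s}" using jl by (simp add: xvars_def)
    have "ldeg n \<beta> j < 0" using deg[OF j] by simp
    then have "\<exists>l'\<in>{1..n j + 1}. lookup \<beta> (j, l') < 0"
      unfolding ldeg_def by (meson linorder_not_le sum_nonneg)
    then obtain l' where "(j, l') \<in> neg \<beta>" by (auto simp: neg_def)
    then show ?thesis using full jl by blast
  qed
  have "lookup \<beta> (j, l) = - 1" if jl: "(j, l) \<in> xvars s n" for j l
  proof (rule ccontr)
    assume "lookup \<beta> (j, l) \<noteq> - 1"
    then have less: "lookup \<beta> (j, l) < - 1" using all[OF jl] by (simp add: neg_def)
    have j: "j \<in> {1..s}" "l \<in> {1..n j + 1}" using jl by (simp_all add: xvars_def)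
    have le: "lookup \<beta> (j, l') \<le> - 1" if "l' \<in> {1..n j + 1}" for l'
      using all[of j l'] that j(1) by (simp add: xvars_def neg_def)
    have "ldeg n \<beta> j < (\<Sum>l = 1..n j + 1. - 1)"
      unfolding ldeg_def by (rule sum_strict_mono_ex1) (use le less j(2) in auto)
    then show False using deg[OF j(1)] by simp
  qed
  then have "\<beta> = corner"
    using \<beta> by (intro poly_mapping_eqI) (auto simp: lookup_corner in_keys_iff)
  with ne show False by blast
qed

lemma full_support:
  assumes w: "w \<in> X p (int r)" and ne: "lookup (w J I) \<beta> \<noteq> 0"
  shows "I = {1..r}"
proof (rule card_subset_eq)
  show "I \<subseteq> {1..r}" "card I = card {1..r}" using coeff_support[OF w ne] by simp_all
qed simp

lemma coeff_acyc_full: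
  assumes w: "w \<in> X p (int r)" "cech w = 0" and "I \<noteq> {1..r} \<or> \<beta> \<noteq> corner"
  shows "\<exists>b\<in>cochains A supp K (neg \<beta>). (\<lambda>J. lookup (w J I) \<beta>) = cob K b"
proof (rule coeff_acyc[OF w(2,1)])
  assume "\<exists>J. lookup (w J I) \<beta> \<noteq> 0"
  then obtain J where J: "lookup (w J I) \<beta> \<noteq> 0" by blast
  then show "acyc A supp K (neg \<beta>)"
    using coeff_support[OF w(1) J] full_support[OF w(1) J] assms(3)
    by (intro acyc_not_corner) (auto simp: deg_full[unfolded One_nat_def])
qed

lemma card_xvars: "Suc (card (xvars s n)) - card {1..s} = bigN s n"
proof -
  have "card (xvars s n) = (\<Sum>j = 1..s. n j + 1)" by (simp add: xvars_def)
  also have "\<dots> = (\<Sum>j = 1..s. n j) + s" by (simp add: sum_Suc)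
  finally show ?thesis by (simp add: bigN_def)
qed

lemma fundamental_cochain: "\<exists>c. generates A supp K (xvars s n) (bigN s n) c"
proof -
  have "\<forall>j\<in>{1..s}. \<exists>l. (j, l) \<in> xvars s n" by (auto simp: xvars_def)
  from fundamental_class[OF A.subring_set_axioms subset_refl this] show ?thesis
    unfolding K_eq card_xvars .
qed

definition fund :: "nat set \<Rightarrow> 'k apoly" where
  "fund = (SOME c. generates A supp K (xvars s n) (bigN s n) c)"

lemma fund: "generates A supp K (xvars s n) (bigN s n) fund"
  unfolding fund_def using fundamental_cochain by (rule someI_ex)

text \<open>
  The generator of the cohomology of the last column.
\<close>
definition w0 :: "'k bicochain" where
  "w0 J I = (if I = {1..r} then single corner (fund J) else 0)"

lemma lookup_w0: "lookup (w0 J I) \<beta> = (if I = {1..r} \<and> \<beta> = corner then fund J else 0)"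
  by (simp add: w0_def lookup_single when_def)

lemma w0: "w0 \<in> X (int (bigN s n)) (int r)" "cech w0 = 0"
proof -
  have fund': "fund J \<in> A" "fund J \<noteq> 0 \<Longrightarrow> J \<subseteq> K \<and> xvars s n \<subseteq> V J" "fund J \<noteq> 0 \<Longrightarrow> card J = bigN s n"
    "cob K fund = 0" for J
    using fund unfolding generates_def cochains_def V_def by blast+
  show "w0 \<in> X (int (bigN s n)) (int r)"
  proof (rule bicochainsI)
    fix J I
    show "w0 J I \<in> laur (V J)"
    proof (cases "fund J = 0")
      case False
      then show ?thesis
        using fund'(1,2)[of J] neg_corner
        by (auto simp: w0_def keys_corner neg_def laur.zero_mem intro!: single_laur)
    qed (simp add: w0_def laur.zero_mem)
    show "w0 J I \<in> Gdeg I"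
      by (auto simp: Gdeg_def homog_def lookup_w0 ldeg_corner deg_full[unfolded One_nat_def] split: if_splits)
    assume "w0 J I \<noteq> 0"
    then have "I = {1..r}" "fund J \<noteq> 0" by (auto simp: w0_def split: if_splits)
    then show "J \<subseteq> K \<and> I \<subseteq> {1..r} \<and> int (card J) = int (bigN s n) \<and> int (card I) = int r"
      using fund'(2,3)[of J] by simp
  qed
  show "cech w0 = 0"
  proof (intro ext, rule poly_mapping_eqI)
    fix J I \<beta>
    have "lookup (cech w0 J I) \<beta> = cob K (\<lambda>J. if I = {1..r} \<and> \<beta> = corner then fund J else 0) J"
      unfolding cob_coeff[symmetric] lookup_w0 ..
    also have "\<dots> = 0"
    proof (cases "I = {1..r} \<and> \<beta> = corner")
      case True
      then show ?thesis using fund'(4) by (simp only: if_True) simp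
    next
      case False
      then show ?thesis by (simp only: if_False cob_def) simp
    qed
    finally show "lookup (cech w0 J I) \<beta> = lookup (0 J I) \<beta>" by simp
  qed
qed

lemma full_uniq:
  assumes w: "w \<in> X p (int r)" "cech w = 0"
  shows "\<exists>!a. a \<in> A \<and> (\<exists>b\<in>cochains A supp K (xvars s n). (\<lambda>J. lookup (w J {1..r}) corner) - (\<lambda>J. a * fund J) = cob K b)"
proof -
  have "cob K (\<lambda>J. lookup (w J {1..r}) corner) = 0" by (simp add: fun_eq_iff cob_coeff w(2))
  moreover have "(\<lambda>J. lookup (w J {1..r}) corner) \<in> cochains A supp K (xvars s n)"
    using cochain_coeff[OF w(1), of _ corner] unfolding neg_corner .
  ultimately show ?thesis using fund unfolding generates_def by blast
qed

lemma exact_cech_full: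
  assumes p: "p \<noteq> int (bigN s n)" and w: "w \<in> X p (int r)" "cech w = 0"
  shows "\<exists>u\<in>X (p - 1) (int r). w = cech u"
proof (rule cech_assemble[OF w(1)])
  fix I \<beta>
  show "\<exists>b\<in>cochains A supp K (neg \<beta>). (\<lambda>J. lookup (w J I) \<beta>) = cob K b"
  proof (cases "I = {1..r} \<and> \<beta> = corner")
    case False
    then show ?thesis using coeff_acyc_full[OF w] by blast
  next
    case True
    from full_uniq[OF w] obtain a b where b: "b \<in> cochains A supp K (xvars s n)"
      "(\<lambda>J. lookup (w J {1..r}) corner) - (\<lambda>J. a * fund J) = cob K b" by blast
    define b' where "b' J = (if int (card J) = p - 1 then b J else 0)" for J
    have "b' \<in> cochains A supp K (xvars s n)"
      using b(1) unfolding cochains_def b'_def by (auto simp: A.zero_mem)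
    moreover have "lookup (w J {1..r}) corner = cob K b' J" for J
    proof -
      have eq: "cob K b' J = (if int (card J) = p then cob K b J else 0)"
        unfolding b'_def by (rule cob_degree) simp
      show ?thesis
      proof (cases "int (card J) = p")
        case True
        have "fund J = 0" using fund True p unfolding generates_def by auto
        then show ?thesis using eq True fun_cong[OF b(2), of J] by simp
      next
        case False
        then show ?thesis using eq coeff_support(5)[OF w(1), of J "{1..r}" corner] by auto
      qed
    qed
    ultimately show ?thesis using True neg_corner by auto
  qed
qed

lemma scale_w0_coboundary_iff:
  assumes w: "w \<in> X (int (bigN s n)) (int r)" "cech w = 0" and a: "a \<in> A"
  shows "w - scale a w0 \<in> cech ` X (int (bigN s n) - 1) (int r) \<longleftrightarrow>
    (\<exists>b\<in>cochains A supp K (xvars s n). (\<lambda>J. lookup (w J {1..r}) corner) - (\<lambda>J. a * fund J) = cob K b)"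
proof -
  let ?v = "w - scale a w0"
  have v: "?v \<in> X (int (bigN s n)) (int r)" "cech ?v = 0"
    using subgroup_set.diff_mem[OF bicochains_subgroup[OF is_grading_Gdeg] w(1)
        scale_bicochains[OF is_grading_Gdeg a w0(1)]]
    by (simp_all add: additive.diff[OF additive_cech] w(2) cech_scale w0(2) additive.zero[OF additive_scale])
  have coeff: "(\<lambda>J. lookup (?v J {1..r}) corner) = (\<lambda>J. lookup (w J {1..r}) corner) - (\<lambda>J. a * fund J)"
  proof
    fix J
    have "lookup (single 0 a * w0 J {1..r}) (0 + corner) = a * lookup (w0 J {1..r}) corner"
      by (rule lookup_single_mult)
    then show "lookup (?v J {1..r}) corner = ((\<lambda>J. lookup (w J {1..r}) corner) - (\<lambda>J. a * fund J)) J"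
      by (simp add: scale_def lookup_minus lookup_w0)
  qed
  show ?thesis
  proof
    assume "?v \<in> cech ` X (int (bigN s n) - 1) (int r)"
    then obtain u where u: "u \<in> X (int (bigN s n) - 1) (int r)" "?v = cech u" by blast
    have "(\<lambda>J. lookup (u J {1..r}) corner) \<in> cochains A supp K (xvars s n)"
      using cochain_coeff[OF u(1), of _ corner] unfolding neg_corner .
    moreover have "(\<lambda>J. lookup (?v J {1..r}) corner) = cob K (\<lambda>J. lookup (u J {1..r}) corner)"
      by (simp only: fun_eq_iff cob_coeff u(2)) simp
    ultimately show "\<exists>b\<in>cochains A supp K (xvars s n).
        (\<lambda>J. lookup (w J {1..r}) corner) - (\<lambda>J. a * fund J) = cob K b"
      unfolding coeff[symmetric] by blast
  next
    assume b: "\<exists>b\<in>cochains A supp K (xvars s n).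
        (\<lambda>J. lookup (w J {1..r}) corner) - (\<lambda>J. a * fund J) = cob K b"
    have "\<exists>u\<in>X (int (bigN s n) - 1) (int r). ?v = cech u"
    proof (rule cech_assemble[OF v(1)])
      fix I \<beta>
      show "\<exists>b\<in>cochains A supp K (neg \<beta>). (\<lambda>J. lookup (?v J I) \<beta>) = cob K b"
        using coeff_acyc_full[OF v, of I \<beta>] b[folded coeff] neg_corner by metis
    qed
    then show "?v \<in> cech ` X (int (bigN s n) - 1) (int r)" by blast
  qed
qed

lemma double_complex: "double_complex A scale X cech koszul (int r) (int (bigN s n))"
proof (rule double_complex.intro)
  show "X p q = {0}" if "int r < q" for p q
  proof -
    have "w = 0" if w: "w \<in> X p q" for w
    proof (intro ext, rule ccontr)
      fix J I assume "w J I \<noteq> 0 J I"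
      then have "I \<subseteq> {1..r}" "int (card I) = q" using bicochainsD(3)[OF w, of J I] by auto
      then show False using card_mono[of "{1..r}" I] \<open>int r < q\<close> by simp
    qed
    then show ?thesis
      using subgroup_set.zero_mem[OF bicochains_subgroup[OF is_grading_Gdeg]] by blast
  qed
  show "free_quotient A scale {x \<in> X (int (bigN s n)) (int r). cech x = 0} (cech ` X (int (bigN s n) - 1) (int r))"
    unfolding free_quotient_def
  proof (intro bexI[of _ w0] ballI)
    fix w assume "w \<in> {x \<in> X (int (bigN s n)) (int r). cech x = 0}"
    then have w: "w \<in> X (int (bigN s n)) (int r)" "cech w = 0" by auto
    from full_uniq[OF w] show "\<exists>!a. a \<in> A \<and> w - scale a w0 \<in> cech ` X (int (bigN s n) - 1) (int r)"
      using scale_w0_coboundary_iff[OF w] by metis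
  qed (use w0 in simp)
qed ((rule bicochains_subgroup[OF is_grading_Gdeg] additive_cech additive_koszul
  cech_bicochains[OF is_grading_Gdeg] koszul_bicochains[OF is_grading_Gdeg]
  cech_cech koszul_koszul cech_koszul scale_bicochains[OF is_grading_Gdeg] cech_scale koszul_scale
  exact_koszul exact_cech_full exact_cech; assumption?)+)

end

section \<open>The rings C and B inside the Laurent polynomials\<close>


definition lift :: "(xexp \<Rightarrow>\<^sub>0 'a::comm_ring_1) \<Rightarrow> lexp \<Rightarrow>\<^sub>0 'a" where
  "lift p = (\<Sum>\<alpha>\<in>keys p. single (emb \<alpha>) (lookup p \<alpha>))"

definition unlift :: "(lexp \<Rightarrow>\<^sub>0 'a::comm_ring_1) \<Rightarrow> xexp \<Rightarrow>\<^sub>0 'a" where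
  "unlift = Poly_Mapping.map_key emb"

lemma lookup_unlift: "lookup (unlift x) \<alpha> = lookup x (emb \<alpha>)"
  by (simp add: unlift_def map_key.rep_eq[OF inj_emb])

lemma lookup_lift: "lookup (lift p) \<beta> = (if \<beta> \<in> range emb then lookup p (the_inv emb \<beta>) else 0)"
proof (cases "\<beta> \<in> range emb")
  case True
  then obtain \<alpha> where \<alpha>: "\<beta> = emb \<alpha>" by blast
  have "lookup (lift p) \<beta> = (\<Sum>\<gamma>\<in>keys p. if \<gamma> = \<alpha> then lookup p \<gamma> else 0)"
    by (simp add: lift_def lookup_sum lookup_single when_def \<alpha> inj_eq[OF inj_emb])
  also have "\<dots> = lookup p \<alpha>" by (simp add: in_keys_iff)
  finally show ?thesis using True by (simp add: \<alpha> the_inv_f_f[OF inj_emb])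
next
  case False
  then show ?thesis by (auto simp: lift_def lookup_sum lookup_single when_def intro!: sum.neutral)
qed

lemma lookup_lift_emb [simp]: "lookup (lift p) (emb \<alpha>) = lookup p \<alpha>"
  by (simp add: lookup_lift the_inv_f_f[OF inj_emb])

lemma unlift_lift [simp]: "unlift (lift p) = p"
  by (rule poly_mapping_eqI) (simp add: lookup_unlift)

lemma additive_lift: "additive lift"
  by unfold_locales (simp add: poly_mapping_eq_iff fun_eq_iff lookup_lift lookup_add)

lemma additive_unlift: "additive unlift"
  by unfold_locales (simp add: poly_mapping_eq_iff fun_eq_iff lookup_unlift lookup_add)

lemma lift_single: "lift (single \<alpha> a) = single (emb \<alpha>) a"
  by (simp add: lift_def)

lemma lift_1 [simp]: "lift 1 = 1"
  using lift_single[of 0 "1 :: 'a"] by simp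

lemma lift_mult: "lift (p * q) = lift p * lift q"
proof -
  have "lift (p * q) = lift ((\<Sum>\<alpha>\<in>keys p. single \<alpha> (lookup p \<alpha>)) * (\<Sum>\<beta>\<in>keys q. single \<beta> (lookup q \<beta>)))"
    using sum_singles[of p] sum_singles[of q] by simp
  also have "\<dots> = lift (\<Sum>\<alpha>\<in>keys p. \<Sum>\<beta>\<in>keys q. single (\<alpha> + \<beta>) (lookup p \<alpha> * lookup q \<beta>))"
    by (simp add: sum_product mult_single)
  also have "\<dots> = (\<Sum>\<alpha>\<in>keys p. \<Sum>\<beta>\<in>keys q. single (emb \<alpha> + emb \<beta>) (lookup p \<alpha> * lookup q \<beta>))"
    by (simp add: additive.sum[OF additive_lift] lift_single emb_add)
  also have "\<dots> = lift p * lift q" by (simp add: lift_def sum_product mult_single)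
  finally show ?thesis .
qed

lemma lift_power: "lift (p ^ k) = lift p ^ k"
  by (induction k) (simp_all add: lift_mult)

lemma lift_eq_iff: "lift p = lift q \<longleftrightarrow> p = q"
  by (metis unlift_lift)

context generic_system
begin

abbreviation C :: "'k cpoly ring" where "C \<equiv> ring_C s r n d"

lemma C_simps [simp]: "mult C = (*)" "\<one>\<^bsub>C\<^esub> = 1" "\<zero>\<^bsub>C\<^esub> = 0" "add C = (+)"
  by (simp_all add: ring_C_def mpoly_ring_def)

sublocale C: cring C by (rule cring_ring_C)

abbreviation grC :: "('k cpoly, 'k cpoly) graded_module" where "grC \<equiv> gr_C s r n d"

lemma grC_simps [simp]: "carrier grC = carrier C" "mult grC = (*)" "add grC = (+)" "\<zero>\<^bsub>grC\<^esub> = 0" "smult grC = (*)"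
  "hpart grC \<nu> = {p \<in> carrier C. \<forall>\<alpha>\<in>keys p. \<forall>j\<in>{1..s}. int (xdeg n \<alpha> j) = \<nu> j}"
  by (simp_all add: gr_C_def self_module_def module.defs)

lemma C_iff: "p \<in> carrier C \<longleftrightarrow> lift p \<in> laur {}"
proof
  assume p: "p \<in> carrier C"
  have "lookup (lift p) \<beta> \<in> A" for \<beta>
    using p by (auto simp: lookup_lift ring_C_def mpoly_ring_def A_def[symmetric] A.zero_mem)
  moreover have "keys \<beta> \<subseteq> xvars s n \<and> {v. lookup \<beta> v < 0} \<subseteq> {}" if "lookup (lift p) \<beta> \<noteq> 0" for \<beta>
  proof -
    have "\<beta> \<in> range emb" using that by (simp add: lookup_lift split: if_splits)
    then obtain \<alpha> where \<alpha>: "\<beta> = emb \<alpha>" by blast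
    then have "lookup p \<alpha> \<noteq> 0" using that by simp
    then show ?thesis using p \<alpha> by (auto simp: ring_C_def mpoly_ring_def in_keys_iff)
  qed
  ultimately show "lift p \<in> laur {}" unfolding laur_def by blast
next
  assume p: "lift p \<in> laur {}"
  have "lookup p \<alpha> \<in> A \<and> (lookup p \<alpha> \<noteq> 0 \<longrightarrow> keys \<alpha> \<subseteq> xvars s n)" for \<alpha>
  proof -
    have "lookup (lift p) (emb \<alpha>) \<in> A \<and> (lookup (lift p) (emb \<alpha>) \<noteq> 0 \<longrightarrow> keys (emb \<alpha>) \<subseteq> xvars s n)"
      using p unfolding laur_def by blast
    then show ?thesis by simp
  qed
  then show "p \<in> carrier C"
    unfolding ring_C_def mpoly_ring_def A_def by (simp add: in_keys_iff)
qed

lemma lift_unlift: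
  assumes x: "x \<in> laur {}"
  shows "lift (unlift x) = x"
proof (rule poly_mapping_eqI)
  fix \<beta>
  show "lookup (lift (unlift x)) \<beta> = lookup x \<beta>"
  proof (cases "\<beta> \<in> range emb")
    case True
    then show ?thesis by (auto simp: lookup_unlift)
  next
    case False
    have "lookup x \<beta> = 0"
    proof (rule ccontr)
      assume "lookup x \<beta> \<noteq> 0"
      then have "\<not> lookup \<beta> v < 0" for v using x unfolding laur_def by blast
      then have "\<beta> = emb (Poly_Mapping.map nat \<beta>)"
        by (intro poly_mapping_eqI) (auto simp: map.rep_eq when_def not_less)
      with False show False by blast
    qed
    then show ?thesis using False by (simp add: lookup_lift)
  qed
qed

lemma unlift_C: "x \<in> laur {} \<Longrightarrow> unlift x \<in> carrier C"
  by (simp add: C_iff lift_unlift)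

lemma C_minus: "p \<in> carrier C \<Longrightarrow> \<ominus>\<^bsub>C\<^esub> p = - p"
  by (rule C.minus_equality) (simp_all add: C_iff additive.minus[OF additive_lift] laur.uminus_mem)

lemma C_closed:
  shows "p \<in> carrier C \<Longrightarrow> q \<in> carrier C \<Longrightarrow> p + q \<in> carrier C"
    "p \<in> carrier C \<Longrightarrow> q \<in> carrier C \<Longrightarrow> p - q \<in> carrier C"
    "p \<in> carrier C \<Longrightarrow> q \<in> carrier C \<Longrightarrow> p * q \<in> carrier C"
    "p \<in> carrier C \<Longrightarrow> p ^ k \<in> carrier C"
proof -
  show "p \<in> carrier C \<Longrightarrow> q \<in> carrier C \<Longrightarrow> p + q \<in> carrier C"
    "p \<in> carrier C \<Longrightarrow> q \<in> carrier C \<Longrightarrow> p - q \<in> carrier C"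
    by (simp_all add: C_iff additive.add[OF additive_lift] additive.diff[OF additive_lift] laur.add_mem laur.diff_mem)
  show *: "p \<in> carrier C \<Longrightarrow> q \<in> carrier C \<Longrightarrow> p * q \<in> carrier C" for p q
    by (simp add: C_iff lift_mult laur.mult_mem)
  show "p \<in> carrier C \<Longrightarrow> p ^ k \<in> carrier C"
    by (induction k) (simp_all add: * C_iff[of 1] laur.one_mem)
qed

lemma C_pow: "x [^]\<^bsub>C\<^esub> (k::nat) = x ^ k"
  by (induction k) (simp_all add: mult.commute)

lemma lift_gen_f: "lift (gen_f s n d i) = F i"
  by (simp add: gen_f_def F_def additive.sum[OF additive_lift] lift_single)

lemma gen_f_C: "i \<in> {1..r} \<Longrightarrow> gen_f s n d i \<in> carrier C"
  by (simp add: C_iff lift_gen_f F_laur del: One_nat_def)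

definition ideal_of :: "(nat \<times> nat) set \<Rightarrow> 'k lpoly set" where
  "ideal_of W = {\<Sum>i\<in>{1..r}. F i * z i | z. \<forall>i\<in>{1..r}. z i \<in> laur W}"

lemma ideal_ofI: "(\<And>i. i \<in> {1..r} \<Longrightarrow> z i \<in> laur W) \<Longrightarrow> (\<Sum>i\<in>{1..r}. F i * z i) \<in> ideal_of W"
  unfolding ideal_of_def by blast

lemma ideal_ofE:
  assumes "x \<in> ideal_of W"
  obtains z where "\<forall>i\<in>{1..r}. z i \<in> laur W" "x = (\<Sum>i\<in>{1..r}. F i * z i)"
  using assms unfolding ideal_of_def by blast

lemma ideal_of_subgroup: "subgroup_set (ideal_of W)"
proof
  show "0 \<in> ideal_of W" using ideal_ofI[of "\<lambda>_. 0" W] by (simp add: laur.zero_mem)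
  fix x y assume x: "x \<in> ideal_of W" and y: "y \<in> ideal_of W"
  from x obtain z where z: "\<forall>i\<in>{1..r}. z i \<in> laur W" "x = (\<Sum>i\<in>{1..r}. F i * z i)"
    by (rule ideal_ofE)
  from y obtain z' where z': "\<forall>i\<in>{1..r}. z' i \<in> laur W" "y = (\<Sum>i\<in>{1..r}. F i * z' i)"
    by (rule ideal_ofE)
  have "x - y = (\<Sum>i\<in>{1..r}. F i * (z i - z' i))"
    by (simp add: z(2) z'(2) right_diff_distrib sum_subtractf)
  moreover have "(\<Sum>i\<in>{1..r}. F i * (z i - z' i)) \<in> ideal_of W"
    using z(1) z'(1) by (intro ideal_ofI laur.diff_mem) blast+
  ultimately show "x - y \<in> ideal_of W" by simp
qed

lemma ideal_of_mult:
  assumes "x \<in> ideal_of W" "y \<in> laur W"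
  shows "y * x \<in> ideal_of W"
proof -
  from assms(1) obtain z where z: "\<forall>i\<in>{1..r}. z i \<in> laur W" "x = (\<Sum>i\<in>{1..r}. F i * z i)"
    by (rule ideal_ofE)
  have "y * x = (\<Sum>i\<in>{1..r}. F i * (y * z i))"
    by (simp add: z(2) sum_distrib_left mult.left_commute)
  moreover have "(\<Sum>i\<in>{1..r}. F i * (y * z i)) \<in> ideal_of W"
    using z(1) assms(2) by (intro ideal_ofI laur.mult_mem) blast+
  ultimately show ?thesis by simp
qed

lemma ideal_of_mono: "W \<subseteq> W' \<Longrightarrow> ideal_of W \<subseteq> ideal_of W'"
  using laur_mono unfolding ideal_of_def by blast

lemma ideal_of_subset: "ideal_of W \<subseteq> laur W"
proof
  fix x assume "x \<in> ideal_of W"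
  then obtain z where z: "\<forall>i\<in>{1..r}. z i \<in> laur W" "x = (\<Sum>i\<in>{1..r}. F i * z i)"
    by (rule ideal_ofE)
  show "x \<in> laur W" unfolding z(2) using z(1) by (intro laur.sum_mem laur.mult_mem F_laur) blast+
qed

definition f_ideal :: "'k cpoly set" where
  "f_ideal = Idl\<^bsub>C\<^esub> (gen_f s n d ` {1..r})"

text \<open>
  The inclusion of \<open>C\<close> in the Laurent polynomials identifies the ideal of the \<open>f\<^sub>i\<close> with \<open>ideal_of {}\<close>.
\<close>
lemma f_ideal_iff: "p \<in> f_ideal \<longleftrightarrow> lift p \<in> ideal_of {}"
proof
  have sub: "gen_f s n d ` {1..r} \<subseteq> carrier C" using gen_f_C by blast
  let ?I = "{p. lift p \<in> ideal_of {}}"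
  have IC: "?I \<subseteq> carrier C" using ideal_of_subset[of "{}"] by (auto simp: C_iff)
  have "ideal ?I C"
  proof (rule idealI)
    show "ring C" by (rule C.ring_axioms)
    show "subgroup ?I (add_monoid C)"
    proof (rule subgroup.intro)
      show "?I \<subseteq> carrier (add_monoid C)" using IC by simp
      show "x \<otimes>\<^bsub>add_monoid C\<^esub> y \<in> ?I" if "x \<in> ?I" "y \<in> ?I" for x y
        using that subgroup_set.add_mem[OF ideal_of_subgroup]
        by (simp add: additive.add[OF additive_lift])
      show "\<one>\<^bsub>add_monoid C\<^esub> \<in> ?I"
        using subgroup_set.zero_mem[OF ideal_of_subgroup] by (simp add: additive.zero[OF additive_lift])
      show "inv\<^bsub>add_monoid C\<^esub> x \<in> ?I" if "x \<in> ?I" for x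
        using that C_minus[of x] IC subgroup_set.uminus_mem[OF ideal_of_subgroup]
        by (auto simp: a_inv_def additive.minus[OF additive_lift])
    qed
    show "x \<otimes>\<^bsub>C\<^esub> a \<in> ?I" "a \<otimes>\<^bsub>C\<^esub> x \<in> ?I" if "a \<in> ?I" "x \<in> carrier C" for a x
      using that ideal_of_mult[of "lift a" "{}" "lift x"] by (simp_all add: lift_mult C_iff mult.commute)
  qed
  moreover have "gen_f s n d ` {1..r} \<subseteq> ?I"
  proof
    fix p :: "'k cpoly" assume "p \<in> gen_f s n d ` {1..r}"
    then obtain i where i: "i \<in> {1..r}" "p = gen_f s n d i" by blast
    have "(\<Sum>k\<in>{1..r}. F k * (if k = i then 1 else 0)) = (\<Sum>k\<in>{1..r}. if k = i then F k else 0)"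
      by (intro sum.cong refl) simp
    also have "\<dots> = lift p" using i by (simp add: lift_gen_f)
    finally show "p \<in> ?I"
      using ideal_ofI[of "\<lambda>k. if k = i then 1 else 0" "{}"] by (simp add: laur.zero_mem laur.one_mem)
  qed
  ultimately have "f_ideal \<subseteq> ?I" unfolding f_ideal_def by (rule C.genideal_minimal)
  then show "p \<in> f_ideal \<Longrightarrow> lift p \<in> ideal_of {}" by blast
  assume "lift p \<in> ideal_of {}"
  then obtain z where z: "\<forall>i\<in>{1..r}. z i \<in> laur {}" "lift p = (\<Sum>i\<in>{1..r}. F i * z i)"
    by (rule ideal_ofE)
  have "lift p = lift (\<Sum>i\<in>{1..r}. gen_f s n d i * unlift (z i))"
    unfolding z(2) additive.sum[OF additive_lift]
    by (intro sum.cong refl) (use z(1) in \<open>simp add: lift_mult lift_gen_f lift_unlift\<close>)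
  then have p: "p = (\<Sum>i\<in>{1..r}. gen_f s n d i * unlift (z i))" by (simp only: lift_eq_iff)
  interpret I: ideal f_ideal C unfolding f_ideal_def by (rule C.genideal_ideal[OF sub])
  have mem: "gen_f s n d i * unlift (z i) \<in> f_ideal" if i: "i \<in> {1..r}" for i
  proof -
    have "gen_f s n d i \<in> f_ideal" unfolding f_ideal_def using C.genideal_self[OF sub] i by blast
    then have "gen_f s n d i \<otimes>\<^bsub>C\<^esub> unlift (z i) \<in> f_ideal" by (rule I.I_r_closed) (rule unlift_C[OF bspec[OF z(1) i]])
    then show ?thesis by simp
  qed
  have "(\<Sum>i\<in>S. gen_f s n d i * unlift (z i)) \<in> f_ideal" if "finite S" "S \<subseteq> {1..r}" for S
    using that
  proof (induction S)
    case empty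
    then show ?case using I.zero_closed by simp
  next
    case (insert i S)
    then have "(gen_f s n d i * unlift (z i)) \<oplus>\<^bsub>C\<^esub> (\<Sum>i\<in>S. gen_f s n d i * unlift (z i)) \<in> f_ideal"
      by (intro I.a_closed mem) auto
    then show ?case using insert by simp
  qed
  then show "p \<in> f_ideal" unfolding p by simp
qed

abbreviation grB :: "('k cpoly, 'k cpoly set) graded_module" where "grB \<equiv> gr_B s r n d"

definition coset :: "'k cpoly \<Rightarrow> 'k cpoly set" where "coset p = (\<lambda>h. h + p) ` f_ideal"

lemma coset_eq_grC: "f_ideal +>\<^bsub>grC\<^esub> p = coset p"
  by (auto simp: a_r_coset_def' coset_def)

lemma f_ideal_subgroup: "subgroup_set f_ideal"
proof
  show "0 \<in> f_ideal"
    by (simp add: f_ideal_iff additive.zero[OF additive_lift] subgroup_set.zero_mem[OF ideal_of_subgroup])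
  fix p q assume "p \<in> f_ideal" "q \<in> f_ideal"
  then show "p - q \<in> f_ideal"
    by (simp add: f_ideal_iff additive.diff[OF additive_lift] subgroup_set.diff_mem[OF ideal_of_subgroup])
qed

lemma coset_eq_iff: "coset p = coset q \<longleftrightarrow> p - q \<in> f_ideal"
proof
  assume "coset p = coset q"
  moreover have "0 + p \<in> coset p"
    unfolding coset_def using subgroup_set.zero_mem[OF f_ideal_subgroup] by blast
  ultimately obtain h where "h \<in> f_ideal" "p = h + q" by (auto simp: coset_def)
  then show "p - q \<in> f_ideal" by simp
next
  assume pq: "p - q \<in> f_ideal"
  have sub: "coset p \<subseteq> coset q" if "p - q \<in> f_ideal" for p q
  proof
    fix x assume "x \<in> coset p"
    then obtain h where "h \<in> f_ideal" "x = h + p" by (auto simp: coset_def)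
    then have "x = (h + (p - q)) + q" "h + (p - q) \<in> f_ideal"
      using subgroup_set.add_mem[OF f_ideal_subgroup _ that] by simp_all
    then show "x \<in> coset q" unfolding coset_def by blast
  qed
  have "q - p \<in> f_ideal" using subgroup_set.uminus_mem[OF f_ideal_subgroup pq] by simp
  then show "coset p = coset q" by (intro equalityI sub pq)
qed

lemma grB_carrier: "carrier grB = coset ` carrier C"
  unfolding gr_B_def quot_module_def f_ideal_def[symmetric]
  by (auto simp: A_RCOSETS_def' coset_eq_grC)

lemma grB_zero: "\<zero>\<^bsub>grB\<^esub> = coset 0"
  unfolding gr_B_def quot_module_def f_ideal_def[symmetric] by (simp add: coset_def)

lemma grB_add: "coset p \<oplus>\<^bsub>grB\<^esub> coset q = coset (p + q)"
proof -
  have "set_add grC (coset p) (coset q) = coset (p + q)"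
  proof (intro equalityI subsetI)
    fix x assume "x \<in> set_add grC (coset p) (coset q)"
    then obtain h h' where "h \<in> f_ideal" "h' \<in> f_ideal" "x = (h + p) + (h' + q)"
      by (auto simp: set_add_def' coset_def)
    then have "x = (h + h') + (p + q)" "h + h' \<in> f_ideal"
      by (simp_all add: subgroup_set.add_mem[OF f_ideal_subgroup] algebra_simps)
    then show "x \<in> coset (p + q)" unfolding coset_def by blast
  next
    fix x assume "x \<in> coset (p + q)"
    then obtain h where "h \<in> f_ideal" "x = (h + p) + (0 + q)" by (auto simp: coset_def algebra_simps)
    moreover have "h + p \<in> coset p" "0 + q \<in> coset q"
      unfolding coset_def using \<open>h \<in> f_ideal\<close> subgroup_set.zero_mem[OF f_ideal_subgroup] by blast+
    ultimately show "x \<in> set_add grC (coset p) (coset q)"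
      unfolding set_add_def' grC_simps by blast
  qed
  then show ?thesis by (simp add: gr_B_def quot_module_def)
qed

lemma grB_smult:
  assumes a: "a \<in> carrier C"
  shows "a \<odot>\<^bsub>grB\<^esub> coset p = coset (a * p)"
proof -
  have "coset (a * x) = coset (a * p)" if "x \<in> coset p" for x
  proof -
    from that obtain h where h: "h \<in> f_ideal" "x = h + p" by (auto simp: coset_def)
    then have "a * x - a * p = a * h" by (simp add: algebra_simps)
    moreover have "a * h \<in> f_ideal"
      using h(1) a by (simp add: f_ideal_iff C_iff lift_mult ideal_of_mult)
    ultimately show ?thesis by (simp add: coset_eq_iff)
  qed
  then have "(\<Union>x\<in>coset p. coset (a * x)) = (\<Union>x\<in>coset p. coset (a * p))" by (rule SUP_cong[OF refl])
  also have "coset p \<noteq> {}" using subgroup_set.zero_mem[OF f_ideal_subgroup] by (auto simp: coset_def)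
  then have "(\<Union>x\<in>coset p. coset (a * p)) = coset (a * p)" by simp
  finally show ?thesis
    unfolding gr_B_def quot_module_def f_ideal_def[symmetric] by (simp add: coset_eq_grC)
qed

lemma represented_grB: "represented (carrier C) coset f_ideal grB"
proof
  show "0 \<in> carrier C" using C.zero_closed by simp
qed (simp_all add: C_closed grB_carrier grB_zero grB_add coset_eq_iff)

lemma module_grB: "module C grB"
proof -
  interpret B: represented "carrier C" coset f_ideal grB by (rule represented_grB)
  have one: "1 \<in> carrier C" using C.one_closed by simp
  show ?thesis
  proof (rule moduleI)
    show "cring C" by (rule C.cring_axioms)
    show "abelian_group grB" by (rule B.abelian_group_axioms)
  qed (auto simp: grB_carrier grB_smult grB_add C_closed one algebra_simps)
qed

end

section \<open>Localizations of B as quotients of Laurent polynomials\<close>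


lemma lookup_monomial_mult:
  fixes x :: "lexp \<Rightarrow>\<^sub>0 'a::comm_ring_1"
  shows "lookup (single a 1 * x) \<beta> = lookup x (\<beta> - a)"
  using lookup_single_mult[of a 1 x "\<beta> - a"] by simp

lemma monomial_power: "(single a 1 :: lexp \<Rightarrow>\<^sub>0 'a::comm_ring_1) ^ k = single (\<Sum>i<k. a) 1"
  by (induction k) (simp_all add: mult_single add.commute)

context generic_system
begin

definition expo_sum :: "nat set \<Rightarrow> xexp" where "expo_sum J = (\<Sum>k\<in>J. expo s (tup k) (\<lambda>_. 1))"

definition sig :: "nat set \<Rightarrow> 'k cpoly" where "sig J = single (expo_sum J) 1"

definition sigma :: "nat set \<Rightarrow> 'k lpoly" where "sigma J = single (emb (expo_sum J)) 1"

definition sigma_inv :: "nat set \<Rightarrow> 'k lpoly" where "sigma_inv J = single (- emb (expo_sum J)) 1"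

lemma lift_sig: "lift (sig J) = sigma J"
  by (simp add: sig_def sigma_def lift_single)

lemma sigma_sigma_inv: "sigma J * sigma_inv J = 1"
  by (simp add: sigma_def sigma_inv_def mult_single)

lemma sigma_sigma_inv_power: "sigma J ^ k * sigma_inv J ^ k = 1"
  by (simp add: power_mult_distrib[symmetric] sigma_sigma_inv)

lemma lookup_expo_sum_pos:
  assumes "finite J" "v \<in> V J"
  shows "0 < lookup (expo_sum J) v"
proof -
  from assms(2) obtain k where k: "k \<in> J" "v \<in> supp k" by (auto simp: V_def)
  obtain j l where v: "v = (j, l)" by (cases v)
  have "lookup (expo s (tup k) (\<lambda>_. 1)) v \<le> lookup (expo_sum J) v"
    unfolding expo_sum_def lookup_sum by (rule member_le_sum[OF k(1)]) (simp_all add: assms(1))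
  moreover have "lookup (expo s (tup k) (\<lambda>_. 1)) v = 1"
    using k(2) by (simp add: v lookup_expo supp_iff)
  ultimately show ?thesis by simp
qed

lemma keys_expo_sum: "keys (expo_sum J) \<subseteq> V J"
proof
  fix v assume v: "v \<in> keys (expo_sum J)"
  obtain j l where jl: "v = (j, l)" by (cases v)
  have "(\<Sum>k\<in>J. lookup (expo s (tup k) (\<lambda>_. 1)) v) \<noteq> 0"
    using v by (simp only: expo_sum_def lookup_sum in_keys_iff) simp
  then obtain k where "k \<in> J" "lookup (expo s (tup k) (\<lambda>_. 1)) v \<noteq> 0"
    by (rule sum.not_neutral_contains_not_neutral)
  then show "v \<in> V J" by (auto simp: V_def jl lookup_expo supp_iff split: if_splits intro!: bexI[of _ k])
qed

lemma V_xvars: "J \<subseteq> K \<Longrightarrow> V J \<subseteq> xvars s n"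
  using supp_sub unfolding V_def by blast

lemma sigma_laur: "J \<subseteq> K \<Longrightarrow> sigma J \<in> laur W"
  unfolding sigma_def using keys_expo_sum[of J] V_xvars[of J] by (intro single_laur A.one_mem) auto

lemma sigma_inv_laur: "J \<subseteq> K \<Longrightarrow> sigma_inv J \<in> laur (V J)"
  unfolding sigma_inv_def
proof (intro single_laur A.one_mem)
  assume J: "J \<subseteq> K"
  show "keys (- emb (expo_sum J)) \<subseteq> xvars s n" using keys_expo_sum V_xvars[OF J] by auto
  have "{v. lookup (- emb (expo_sum J)) v < 0} \<subseteq> keys (expo_sum J)" by (auto simp: in_keys_iff)
  then show "{v. lookup (- emb (expo_sum J)) v < 0} \<subseteq> V J" using keys_expo_sum by blast
qed

lemma laur_power: "x \<in> laur W \<Longrightarrow> x ^ k \<in> laur W"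
  by (induction k) (simp_all add: laur.one_mem laur.mult_mem)

lemma sig_C: "J \<subseteq> K \<Longrightarrow> sig J \<in> carrier C"
  by (simp add: C_iff lift_sig sigma_laur)

lemma xdeg_expo_sum:
  assumes J: "J \<subseteq> K" and j: "j \<in> {1..s}"
  shows "xdeg n (expo_sum J) j = card J"
proof -
  have "xdeg n (expo_sum J) j = (\<Sum>l = 1..n j + 1. \<Sum>k\<in>J. if tup k j = l then 1 else 0)"
    unfolding xdeg_def expo_sum_def lookup_sum using j by (intro sum.cong refl) (simp add: lookup_expo)
  also have "\<dots> = (\<Sum>k\<in>J. \<Sum>l = 1..n j + 1. if tup k j = l then 1 else 0)" by (rule sum.swap)
  also have "\<dots> = (\<Sum>k\<in>J. 1)"
  proof (rule sum.cong[OF refl])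
    fix k assume "k \<in> J"
    then have "tup k j \<in> {1..n j + 1}" using tup(1)[of k] J j by (auto simp: PiE_iff)
    then show "(\<Sum>l = 1..n j + 1. if tup k j = l then 1 else 0) = (1::nat)" by simp
  qed
  finally show ?thesis by simp
qed

lemma sigma_homog: "J \<subseteq> K \<Longrightarrow> sigma J \<in> homog s n (\<lambda>_. int (card J))"
  by (auto simp: homog_def sigma_def lookup_single when_def ldeg_emb xdeg_expo_sum)

lemma sigma_inv_homog: "J \<subseteq> K \<Longrightarrow> sigma_inv J \<in> homog s n (\<lambda>_. - int (card J))"
  by (auto simp: homog_def sigma_inv_def lookup_single when_def ldeg_emb ldeg_uminus xdeg_expo_sum)

lemma homog_power:
  fixes x :: "'k lpoly"
  assumes "x \<in> homog s n (\<lambda>_. m)"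
  shows "x ^ k \<in> homog s n (\<lambda>_. int k * m)"
proof (induction k)
  case 0
  show ?case by (auto simp: homog_def lookup_one when_def ldeg_def)
next
  case (Suc k)
  show ?case unfolding power_Suc by (rule homog_mult[OF assms Suc]) (simp add: algebra_simps)
qed

lemma g_eq: "k \<in> K \<Longrightarrow> g ! k = sig {k}"
  by (simp add: tup(2) sig_def expo_sum_def)

lemma sig_insert: "finite J \<Longrightarrow> k \<notin> J \<Longrightarrow> sig (insert k J) = sig {k} * sig J"
  by (simp add: sig_def expo_sum_def mult_single)

lemma finprod_sig:
  assumes J: "J \<subseteq> K"
  shows "(\<Otimes>\<^bsub>C\<^esub>k\<in>J. g ! k) = sig J"
proof -
  have "finite J" using J by (rule finite_subset) simp
  then show ?thesis using J
  proof (induction J)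
    case empty
    show ?case by (simp add: sig_def expo_sum_def)
  next
    case (insert k J)
    have "(\<lambda>k. g ! k) \<in> J \<rightarrow> carrier C" "g ! k \<in> carrier C"
      using insert.prems by (auto simp: g_eq sig_C)
    then have "(\<Otimes>\<^bsub>C\<^esub>k\<in>insert k J. g ! k) = g ! k * (\<Otimes>\<^bsub>C\<^esub>k\<in>J. g ! k)"
      using insert.hyps by simp
    then show ?case using insert by (simp add: sig_insert[of J k] g_eq)
  qed
qed

lemma clear_denominators:
  assumes J: "J \<subseteq> K" and x: "x \<in> laur (V J)"
  shows "\<exists>k. sigma J ^ k * x \<in> laur {}"
proof -
  have fin: "finite J" using J by (rule finite_subset) simp
  \<comment> \<open>a crude bound for all negative exponents in \<open>x\<close>\<close>
  define k where "k = (\<Sum>b\<in>keys x. \<Sum>v\<in>xvars s n. nat (- lookup b v))"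
  have k: "- lookup b v \<le> int k" if "b \<in> keys x" "v \<in> xvars s n" for b v
  proof -
    have "nat (- lookup b v) \<le> (\<Sum>v\<in>xvars s n. nat (- lookup b v))"
      by (rule member_le_sum[OF that(2)]) (simp_all add: finite_xvars)
    also have "\<dots> \<le> k" unfolding k_def by (rule member_le_sum[OF that(1)]) simp_all
    finally show ?thesis by simp
  qed
  define a where "a = (\<Sum>i<k. emb (expo_sum J))"
  have a: "lookup a v = int k * int (lookup (expo_sum J) v)" for v
    by (simp add: a_def lookup_sum)
  have mem: "sigma J ^ k * x \<in> laur (V J)" by (intro laur.mult_mem laur_power sigma_laur J x)
  have "\<not> lookup \<beta> v < 0" if "lookup (sigma J ^ k * x) \<beta> \<noteq> 0" for \<beta> v
  proof
    assume neg: "lookup \<beta> v < 0"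
    have b: "lookup x (\<beta> - a) \<noteq> 0"
      using that by (simp add: sigma_def monomial_power a_def lookup_monomial_mult)
    have "lookup (\<beta> - a) v = lookup \<beta> v - lookup a v" by (simp add: lookup_minus)
    with neg have neg': "lookup (\<beta> - a) v < 0" by (simp add: a) (smt (verit) mult_nonneg_nonneg of_nat_0_le_iff)
    then have v: "v \<in> V J" using b x unfolding laur_def by blast
    then have "int k \<le> lookup a v"
      using lookup_expo_sum_pos[OF fin v] by (simp add: a mult_le_cancel_left1)
    moreover have "- lookup (\<beta> - a) v \<le> int k"
      using b v V_xvars[OF J] by (intro k) (auto simp: in_keys_iff)
    ultimately show False using neg by (simp add: lookup_minus)
  qed
  then have "sigma J ^ k * x \<in> laur {}" using mem unfolding laur_def by blast
  then show ?thesis ..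
qed

text \<open>
  The Laurent polynomial \<open>p / \<sigma>\<^sup>k\<close>.
\<close>
definition fraction :: "nat set \<Rightarrow> 'k cpoly \<Rightarrow> nat \<Rightarrow> 'k lpoly" where "fraction J p k = lift p * sigma_inv J ^ k"

lemma fraction_laur: "J \<subseteq> K \<Longrightarrow> p \<in> carrier C \<Longrightarrow> fraction J p k \<in> laur (V J)"
  using laur_mono[of "{}" "V J"] unfolding fraction_def C_iff
  by (intro laur.mult_mem laur_power sigma_inv_laur) auto

lemma sigma_power_fraction: "sigma J ^ k * fraction J p k = lift p"
  by (simp add: fraction_def mult.left_commute[of _ "lift p"] sigma_sigma_inv_power)

text \<open>
  Localization is exact: the localization of \<open>B = C / (f)\<close> is the ring of Laurent polynomials modulo
  the ideal generated by the \<open>f\<^sub>i\<close> there.  The exponent \<open>e\<close> in the definition of equality of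
  fractions clears the denominators of the coefficients of the \<open>f\<^sub>i\<close>.
\<close>
lemma mfrac_eq_iff_fraction:
  assumes J: "J \<subseteq> K" and p: "p \<in> carrier C" "p' \<in> carrier C"
  shows "mfrac C grB (sig J) (coset p) k = mfrac C grB (sig J) (coset p') k' \<longleftrightarrow>
    fraction J p k - fraction J p' k' \<in> ideal_of (V J)"
proof -
  have mem: "coset p \<in> carrier grB" "coset p' \<in> carrier grB" using p by (auto simp: grB_carrier)
  have key: "lift (sig J ^ (e + k') * p - sig J ^ (e + k) * p') =
      sigma J ^ (e + k + k') * (fraction J p k - fraction J p' k')" for e
  proof -
    have "sigma J ^ (e + k + k') * fraction J p k = sigma J ^ (e + k') * (sigma J ^ k * fraction J p k)"
      by (simp add: power_add ac_simps)
    moreover have "sigma J ^ (e + k + k') * fraction J p' k' = sigma J ^ (e + k) * (sigma J ^ k' * fraction J p' k')"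
      by (simp add: power_add ac_simps)
    ultimately show ?thesis
      by (simp add: sigma_power_fraction right_diff_distrib additive.diff[OF additive_lift] lift_mult lift_power lift_sig)
  qed
  have "mfrac C grB (sig J) (coset p) k = mfrac C grB (sig J) (coset p') k' \<longleftrightarrow>
    (\<exists>e::nat. sig J ^ (e + k') * p - sig J ^ (e + k) * p' \<in> f_ideal)"
    unfolding mfrac_eq_iff[OF module_grB sig_C[OF J] mem] C_pow
    by (simp add: grB_smult C_closed sig_C[OF J] coset_eq_iff)
  also have "\<dots> \<longleftrightarrow> (\<exists>e. sigma J ^ (e + k + k') * (fraction J p k - fraction J p' k') \<in> ideal_of {})"
    by (simp only: f_ideal_iff key)
  also have "\<dots> \<longleftrightarrow> fraction J p k - fraction J p' k' \<in> ideal_of (V J)" (is "?L \<longleftrightarrow> ?d \<in> _")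
  proof
    assume ?L
    then obtain e where "sigma J ^ (e + k + k') * ?d \<in> ideal_of {}" by blast
    then have "sigma J ^ (e + k + k') * ?d \<in> ideal_of (V J)" using ideal_of_mono[of "{}" "V J"] by blast
    then have "sigma_inv J ^ (e + k + k') * (sigma J ^ (e + k + k') * ?d) \<in> ideal_of (V J)"
      by (rule ideal_of_mult) (intro laur_power sigma_inv_laur J)
    also have "sigma_inv J ^ (e + k + k') * (sigma J ^ (e + k + k') * ?d) = ?d"
      using sigma_sigma_inv_power[of J "e + k + k'"] by (simp add: mult.assoc[symmetric] mult.commute)
    finally show "?d \<in> ideal_of (V J)" .
  next
    assume "?d \<in> ideal_of (V J)"
    then obtain z where z: "\<forall>i\<in>{1..r}. z i \<in> laur (V J)" "?d = (\<Sum>i\<in>{1..r}. F i * z i)"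
      by (rule ideal_ofE)
    have "\<forall>i\<in>{1..r}. \<exists>t. sigma J ^ t * z i \<in> laur {}" using z(1) clear_denominators[OF J] by blast
    then obtain t where t: "\<forall>i\<in>{1..r}. sigma J ^ t i * z i \<in> laur {}" by (rule bchoice[THEN exE])
    \<comment> \<open>a common bound for the denominators of all coefficients\<close>
    define e where "e = (\<Sum>i\<in>{1..r}. t i)"
    have "sigma J ^ (e + k + k') * ?d = (\<Sum>i\<in>{1..r}. F i * (sigma J ^ (e + k + k') * z i))"
      unfolding z(2) sum_distrib_left by (intro sum.cong refl) (simp add: mult.left_commute)
    moreover have "sigma J ^ (e + k + k') * z i \<in> laur {}" if i: "i \<in> {1..r}" for i
    proof -
      have "t i \<le> e" unfolding e_def by (rule member_le_sum[OF i]) simp_all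
      then have "sigma J ^ (e + k + k') * z i = sigma J ^ (e + k + k' - t i) * (sigma J ^ t i * z i)"
        by (simp add: mult.assoc[symmetric] power_add[symmetric])
      also have "\<dots> \<in> laur {}"
        by (rule laur.mult_mem[OF laur_power[OF sigma_laur[OF J]]]) (rule bspec[OF t i])
      finally show ?thesis .
    qed
    ultimately show ?L using ideal_ofI[of "\<lambda>i. sigma J ^ (e + k + k') * z i" "{}"] by (intro exI[of _ e]) simp
  qed
  finally show ?thesis .
qed

definition den :: "nat set \<Rightarrow> 'k lpoly \<Rightarrow> nat" where "den J x = (SOME k. sigma J ^ k * x \<in> laur {})"

definition num :: "nat set \<Rightarrow> 'k lpoly \<Rightarrow> 'k cpoly" where "num J x = unlift (sigma J ^ den J x * x)"

text \<open>
  The class of a Laurent polynomial in the localization of \<open>B\<close>, defined by a fraction that represents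
  it; by \<open>theta_fraction\<close> the choice of the fraction does not matter.
\<close>
definition theta :: "nat set \<Rightarrow> 'k lpoly \<Rightarrow> ('k cpoly set \<times> nat) set" where
  "theta J x = mfrac C grB (sig J) (coset (num J x)) (den J x)"

lemma num_den:
  assumes J: "J \<subseteq> K" and x: "x \<in> laur (V J)"
  shows "sigma J ^ den J x * x \<in> laur {}" "num J x \<in> carrier C" "fraction J (num J x) (den J x) = x"
proof -
  show *: "sigma J ^ den J x * x \<in> laur {}"
    unfolding den_def using clear_denominators[OF assms] by (rule someI_ex)
  then show "num J x \<in> carrier C" unfolding num_def by (rule unlift_C)
  show "fraction J (num J x) (den J x) = x"
    using sigma_sigma_inv_power[of J "den J x"]
    unfolding fraction_def num_def lift_unlift[OF *] by (simp add: mult.commute mult.left_commute)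
qed

lemma theta_fraction:
  assumes J: "J \<subseteq> K" and p: "p \<in> carrier C"
  shows "theta J (fraction J p k) = mfrac C grB (sig J) (coset p) k"
  unfolding theta_def
  using num_den[OF J fraction_laur[OF J p]] p
  by (subst mfrac_eq_iff_fraction[OF J]) (simp_all add: subgroup_set.zero_mem[OF ideal_of_subgroup])

lemma theta_eq_iff:
  assumes J: "J \<subseteq> K" and x: "x \<in> laur (V J)" "y \<in> laur (V J)"
  shows "theta J x = theta J y \<longleftrightarrow> x - y \<in> ideal_of (V J)"
  unfolding theta_def using num_den[OF J x(1)] num_den[OF J x(2)]
  by (subst mfrac_eq_iff_fraction[OF J]) simp_all

abbreviation locB :: "nat set \<Rightarrow> ('k cpoly, ('k cpoly set \<times> nat) set) graded_module" where
  "locB \<equiv> cech_loc C grB g (\<lambda>_ _. 1)"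

lemma cech_loc_eq:
  assumes "J \<subseteq> K"
  shows "locB J = localization C grB (sig J) (\<lambda>j. int (card J))"
  by (simp add: cech_loc_def finprod_sig[OF assms])

lemma represented_cech_loc:
  assumes J: "J \<subseteq> K"
  shows "represented (laur (V J)) (theta J) (ideal_of (V J)) (locB J)"
proof (unfold cech_loc_eq[OF J], rule represented.intro)
  show "subgroup_set (laur (V J))" by (rule laur.subgroup_set_axioms)
  let ?L = "localization C grB (sig J) (\<lambda>j. int (card J))"
  show "represented_axioms (laur (V J)) (theta J) (ideal_of (V J)) ?L"
  proof
    show "carrier ?L = theta J ` laur (V J)"
    proof (intro equalityI subsetI)
      fix X assume "X \<in> carrier ?L"
      then obtain p k where p: "p \<in> carrier C" "X = mfrac C grB (sig J) (coset p) k"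
        by (auto simp: localization_def grB_carrier)
      then show "X \<in> theta J ` laur (V J)" using fraction_laur[OF J] theta_fraction[OF J] by (metis image_eqI)
    next
      fix X assume "X \<in> theta J ` laur (V J)"
      then obtain x where "x \<in> laur (V J)" "X = theta J x" by blast
      then show "X \<in> carrier ?L"
        using num_den(2)[OF J] unfolding theta_def localization_def grB_carrier by auto
    qed
    show "\<zero>\<^bsub>?L\<^esub> = theta J 0"
      using theta_fraction[OF J, of 0 0] C.zero_closed
      by (simp add: localization_def fraction_def grB_zero additive.zero[OF additive_lift])
    fix x assume x: "x \<in> laur (V J)"
    show "theta J x = theta J 0 \<longleftrightarrow> x \<in> ideal_of (V J)"
      using theta_eq_iff[OF J x laur.zero_mem] by simp
    fix y assume y: "y \<in> laur (V J)"
    let ?p = "num J x" and ?k = "den J x" and ?q = "num J y" and ?m = "den J y"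
    have pq: "?p \<in> carrier C" "?q \<in> carrier C" using num_den[OF J] x y by auto
    have mem: "coset ?p \<in> carrier grB" "coset ?q \<in> carrier grB" using pq by (auto simp: grB_carrier)
    have "theta J x \<oplus>\<^bsub>?L\<^esub> theta J y =
        mfrac C grB (sig J) (coset (sig J ^ ?m * ?p + sig J ^ ?k * ?q)) (?k + ?m)"
      unfolding theta_def localization_add[OF module_grB sig_C[OF J] mem] C_pow
      by (simp add: grB_smult C_closed sig_C[OF J] grB_add)
    also have "\<dots> = theta J (fraction J (sig J ^ ?m * ?p + sig J ^ ?k * ?q) (?k + ?m))"
      by (rule theta_fraction[OF J, symmetric]) (intro C_closed sig_C J pq)
    also have "fraction J (sig J ^ ?m * ?p + sig J ^ ?k * ?q) (?k + ?m) =
        (sigma J ^ ?m * sigma_inv J ^ ?m) * fraction J ?p ?k + (sigma J ^ ?k * sigma_inv J ^ ?k) * fraction J ?q ?m"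
      by (simp add: fraction_def additive.add[OF additive_lift] lift_mult lift_power lift_sig power_add algebra_simps)
    also have "\<dots> = x + y" by (simp add: sigma_sigma_inv_power num_den(3)[OF J] x y)
    finally show "theta J x \<oplus>\<^bsub>?L\<^esub> theta J y = theta J (x + y)" .
  qed
qed

lemma unlift_hpart:
  assumes "x \<in> laur {}" "x \<in> homog s n \<nu>"
  shows "unlift x \<in> hpart grC \<nu>"
proof -
  have "int (xdeg n \<alpha> j) = \<nu> j" if "\<alpha> \<in> keys (unlift x)" "j \<in> {1..s}" for \<alpha> j
  proof -
    have "lookup x (emb \<alpha>) \<noteq> 0" using that(1) by (simp add: in_keys_iff lookup_unlift)
    then have "ldeg n (emb \<alpha>) j = \<nu> j" using assms(2) that(2) by (simp add: homog_def)
    then show ?thesis by (simp add: ldeg_emb)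
  qed
  then show ?thesis using unlift_C[OF assms(1)] by simp
qed

lemma lift_homog:
  assumes "p \<in> hpart grC \<nu>"
  shows "lift p \<in> homog s n \<nu>"
  unfolding homog_def
proof (intro CollectI allI impI ballI)
  fix \<beta> j assume ne: "lookup (lift p) \<beta> \<noteq> 0" and j: "j \<in> {1..s}"
  have "\<beta> \<in> range emb" using ne by (simp add: lookup_lift split: if_splits)
  then obtain \<alpha> where \<alpha>: "\<beta> = emb \<alpha>" by blast
  then have "\<alpha> \<in> keys p" using ne by (simp add: in_keys_iff)
  then show "ldeg n \<beta> j = \<nu> j" using assms j by (simp add: \<alpha> ldeg_emb)
qed

lemma hpart_cech_loc:
  assumes J: "J \<subseteq> K"
  shows "hpart (locB J) \<nu> = theta J ` (laur (V J) \<inter> homog s n \<nu>)"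
proof -
  have hB: "hpart grB \<mu> = coset ` hpart grC \<mu>" for \<mu>
    unfolding gr_B_def quot_module_def f_ideal_def[symmetric] by (simp add: coset_eq_grC)
  show ?thesis
    unfolding cech_loc_eq[OF J]
  proof (intro equalityI subsetI)
    fix X assume "X \<in> hpart (localization C grB (sig J) (\<lambda>j. int (card J))) \<nu>"
    then obtain k p where p: "p \<in> hpart grC (\<lambda>j. \<nu> j + int k * int (card J))"
      "X = mfrac C grB (sig J) (coset p) k"
      unfolding localization_def by (auto simp only: graded_module.simps hB)
    have pC: "p \<in> carrier C" using p(1) by simp
    have "fraction J p k \<in> homog s n \<nu>"
      unfolding fraction_def
      by (rule homog_mult[OF lift_homog[OF p(1)] homog_power[OF sigma_inv_homog[OF J]]]) simp
    then show "X \<in> theta J ` (laur (V J) \<inter> homog s n \<nu>)"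
      using theta_fraction[OF J pC] fraction_laur[OF J pC] p(2) by (metis IntI image_eqI)
  next
    fix X assume "X \<in> theta J ` (laur (V J) \<inter> homog s n \<nu>)"
    then obtain x where x: "x \<in> laur (V J)" "x \<in> homog s n \<nu>" "X = theta J x" by blast
    have "sigma J ^ den J x * x \<in> homog s n (\<lambda>j. \<nu> j + int (den J x) * int (card J))"
      by (rule homog_mult[OF homog_power[OF sigma_homog[OF J]] x(2)]) simp
    then have "num J x \<in> hpart grC (\<lambda>j. \<nu> j + int (den J x) * int (card J))"
      unfolding num_def by (intro unlift_hpart num_den(1)[OF J x(1)])
    then have "coset (num J x) \<in> hpart grB (\<lambda>j. \<nu> j + int (den J x) * int (card J))"
      unfolding hB by (rule imageI)
    then show "X \<in> hpart (localization C grB (sig J) (\<lambda>j. int (card J))) \<nu>"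
      unfolding localization_def x(3) theta_def graded_module.simps by blast
  qed
qed

lemma theta_members:
  assumes J: "J \<subseteq> K" and x: "x \<in> laur (V J)" and mk: "(m, k) \<in> theta J x"
  obtains p where "p \<in> carrier C" "m = coset p" "x - fraction J p k \<in> ideal_of (V J)"
proof -
  have m: "m \<in> carrier grB" using mk by (simp add: theta_def mfrac_def)
  then obtain p where p: "p \<in> carrier C" "m = coset p" by (auto simp: grB_carrier)
  have n: "coset (num J x) \<in> carrier grB" using num_den(2)[OF J x] by (auto simp: grB_carrier)
  have "theta J x = mfrac C grB (sig J) m k"
    unfolding theta_def using mk m
    by (subst mfrac_eq_iff[OF module_grB sig_C[OF J] n m]) (simp add: theta_def mfrac_def)
  then have "theta J x = theta J (fraction J p k)" by (simp add: p theta_fraction[OF J p(1)])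
  then have "x - fraction J p k \<in> ideal_of (V J)" using theta_eq_iff[OF J x fraction_laur[OF J p(1)]] by simp
  with p that show thesis by blast
qed

lemma theta_nonempty: "J \<subseteq> K \<Longrightarrow> x \<in> laur (V J) \<Longrightarrow> theta J x \<noteq> {}"
proof -
  assume J: "J \<subseteq> K" and x: "x \<in> laur (V J)"
  have "coset (num J x) \<in> carrier grB" using num_den(2)[OF J x] by (auto simp: grB_carrier)
  then have "(coset (num J x), den J x) \<in> theta J x" by (simp add: theta_def mfrac_def)
  then show ?thesis by blast
qed

text \<open>
  The operations on localizations are unions over all representatives of a fraction.  Such a union
  is evaluated by showing that all representatives give the same result.
\<close>
lemma theta_UN:
  assumes J: "J \<subseteq> K" and x: "x \<in> laur (V J)"
    and f: "\<And>p k. p \<in> carrier C \<Longrightarrow> x - fraction J p k \<in> ideal_of (V J) \<Longrightarrow> f (coset p) k = Y"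
  shows "(\<Union>(m, k)\<in>theta J x. f m k) = Y"
proof -
  have "(\<Union>(m, k)\<in>theta J x. f m k) = (\<Union>(m, k)\<in>theta J x. Y)"
  proof (rule SUP_cong[OF refl])
    fix z assume z: "z \<in> theta J x"
    obtain m k where mk: "z = (m, k)" by (cases z)
    from theta_members[OF J x z[unfolded mk]] obtain p where
      "p \<in> carrier C" "m = coset p" "x - fraction J p k \<in> ideal_of (V J)" .
    then show "(case z of (m, k) \<Rightarrow> f m k) = (case z of (m, k) \<Rightarrow> Y)" by (simp add: mk f)
  qed
  then show ?thesis using theta_nonempty[OF J x] by auto
qed

lemma loc_map_theta:
  assumes J: "J \<subseteq> K" and k: "k \<in> J" and x: "x \<in> laur (V (J - {k}))"
  shows "loc_map C grB (g ! k) (\<Otimes>\<^bsub>C\<^esub>k'\<in>J. g ! k') (theta (J - {k}) x) = theta J x"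
  unfolding loc_map_def finprod_sig[OF J]
proof (rule theta_UN[OF _ x])
  show J': "J - {k} \<subseteq> K" using J by blast
  have kK: "k \<in> K" using k J by blast
  have fin: "finite J" using J by (rule finite_subset) simp
  have "emb (expo_sum J) = emb (expo_sum {k}) + emb (expo_sum (J - {k}))"
    unfolding expo_sum_def by (simp add: sum.remove[OF fin k] emb_add)
  then have sigma: "sigma {k} * sigma_inv J = sigma_inv (J - {k})"
    by (simp add: sigma_def sigma_inv_def mult_single)
  fix p e assume p: "p \<in> carrier C" and eq: "x - fraction (J - {k}) p e \<in> ideal_of (V (J - {k}))"
  have gC: "g ! k \<in> carrier C" using kK by (simp add: g_eq sig_C)
  have "fraction J ((g ! k) ^ e * p) e = lift p * (sigma {k} * sigma_inv J) ^ e"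
    by (simp add: fraction_def lift_mult lift_power g_eq[OF kK] lift_sig power_mult_distrib ac_simps)
  then have fr: "fraction J ((g ! k) ^ e * p) e = fraction (J - {k}) p e" by (simp add: sigma fraction_def)
  have "mfrac C grB (sig J) (((g ! k) [^]\<^bsub>C\<^esub> e) \<odot>\<^bsub>grB\<^esub> coset p) e = theta J (fraction (J - {k}) p e)"
    unfolding fr[symmetric] C_pow
    using theta_fraction[OF J, of "(g ! k) ^ e * p" e] p gC by (simp add: grB_smult C_closed)
  also have "\<dots> = theta J x"
  proof -
    have "V (J - {k}) \<subseteq> V J" by (rule V_mono) blast
    then have "x \<in> laur (V J)" "x - fraction (J - {k}) p e \<in> ideal_of (V J)"
      "fraction (J - {k}) p e \<in> laur (V J)"
      using x eq laur_mono ideal_of_mono fraction_laur[OF J' p] by blast+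
    then have "theta J x = theta J (fraction (J - {k}) p e)" using theta_eq_iff[OF J] by blast
    then show ?thesis by (rule sym)
  qed
  finally show "mfrac C grB (sig J) (((g ! k) [^]\<^bsub>C\<^esub> e) \<odot>\<^bsub>grB\<^esub> coset p) e = theta J x" .
qed

lemma smult_theta:
  assumes J: "J \<subseteq> K" and a: "a \<in> carrier C" and x: "x \<in> laur (V J)"
  shows "a \<odot>\<^bsub>locB J\<^esub> theta J x = theta J (lift a * x)"
proof -
  have la: "lift a \<in> laur (V J)" using a laur_mono[of "{}" "V J"] by (auto simp: C_iff)
  have "(\<Union>(m, k)\<in>theta J x. mfrac C grB (sig J) (a \<odot>\<^bsub>grB\<^esub> m) k) = theta J (lift a * x)"
  proof (rule theta_UN[OF J x])
    fix p k assume p: "p \<in> carrier C" and eq: "x - fraction J p k \<in> ideal_of (V J)"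
    have fr: "fraction J (a * p) k = lift a * fraction J p k" by (simp add: fraction_def lift_mult mult.assoc)
    have "mfrac C grB (sig J) (a \<odot>\<^bsub>grB\<^esub> coset p) k = theta J (lift a * fraction J p k)"
      using theta_fraction[OF J, of "a * p" k] a p by (simp add: grB_smult C_closed fr)
    also have "\<dots> = theta J (lift a * x)"
    proof (rule sym, subst theta_eq_iff[OF J])
      show "lift a * x - lift a * fraction J p k \<in> ideal_of (V J)"
        using ideal_of_mult[OF eq la] by (simp add: right_diff_distrib)
    qed (intro laur.mult_mem la x fraction_laur J p)+
    finally show "mfrac C grB (sig J) (a \<odot>\<^bsub>grB\<^esub> coset p) k = theta J (lift a * x)" .
  qed
  then show ?thesis unfolding cech_loc_eq[OF J] localization_def by simp
qed

end

section \<open>From the double complex to the cohomology modules\<close>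


context generic_system
begin

abbreviation XU :: "int \<Rightarrow> int \<Rightarrow> 'k bicochain set" where "XU \<equiv> bicochains (\<lambda>_. UNIV)"

abbreviation N :: nat where "N \<equiv> bigN s n"

sublocale DC: double_complex A scale X cech koszul "int r" "int N"
  by (rule double_complex)

lemma XU_subgroup: "subgroup_set (XU p q)"
  by (rule bicochains_subgroup[OF is_grading_UNIV])

lemma X_subset_XU: "X p q \<subseteq> XU p q"
  by (rule bicochains_mono) simp

lemma X_negative: "p < 0 \<or> q < 0 \<Longrightarrow> X p q = {0}"
proof -
  assume pq: "p < 0 \<or> q < 0"
  have "w = 0" if w: "w \<in> X p q" for w
  proof (intro ext, rule ccontr)
    fix J I assume "w J I \<noteq> 0 J I"
    then have "int (card J) = p" "int (card I) = q" using bicochainsD(3)[OF w, of J I] by auto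
    then show False using pq by auto
  qed
  then show ?thesis using DC.X_zero by blast
qed

lemma scale_add: "scale (a + b) x = scale a x + scale b x"
  by (simp add: scale_def fun_eq_iff Poly_Mapping.single_add distrib_right)

lemma scale_mult: "scale (a * b) x = scale a (scale b x)"
  by (simp add: scale_def fun_eq_iff mult.assoc[symmetric] mult_single)

lemma mpoly_const_C: "a \<in> A \<Longrightarrow> mpoly_const a \<in> carrier C"
  by (simp add: C_iff mpoly_const_def lift_single single_laur)

definition free_module :: "('k apoly, 'b) module \<Rightarrow> bool" where
  "free_module M \<longleftrightarrow> free_of_rank (ring_A s r n d) M 1 \<and> module_iso (ring_A s r n d) M (self_module (ring_A s r n d))"

text \<open>
  The common conclusion for the two complexes, once their cohomology in degree \<open>\<delta>\<close> has been presented
  by the groups \<open>Z p q\<close> and \<open>B p q\<close> of the double complex.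
\<close>
lemma cohomology_result:
  assumes rep: "represented cyc cls bnd M"
    and cyc: "cyc = DC.Z p q" and bnd: "bnd = cyc \<inter> DC.B p q"
    and smult: "\<And>a x. a \<in> A \<Longrightarrow> x \<in> cyc \<Longrightarrow> a \<odot>\<^bsub>M\<^esub> cls x = cls (scale a x)"
    and scale: "\<And>a x. a \<in> A \<Longrightarrow> x \<in> cyc \<Longrightarrow> scale a x \<in> cyc"
    and pq: "0 \<le> p" "0 \<le> q" "q \<le> int r"
  shows "p + int r - q \<noteq> int N \<Longrightarrow> zero_module M" and "p + int r - q = int N \<Longrightarrow> free_module M"
proof -
  show "zero_module M" if "p + int r - q \<noteq> int N"
    unfolding zero_module_represented[OF rep] bnd using DC.Z_subset_B[OF pq that] cyc by blast
  assume "p + int r - q = int N"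
  from DC.free_quotient_Z_B[OF pq this] obtain y0 where y0: "y0 \<in> cyc"
    and uniq: "\<And>y. y \<in> cyc \<Longrightarrow> \<exists>!a. a \<in> A \<and> y - scale a y0 \<in> DC.B p q"
    unfolding free_quotient_def cyc by blast
  interpret represented cyc cls bnd M by (rule rep)
  have R: "carrier (ring_A s r n d) = A" "add (ring_A s r n d) = (+)" "mult (ring_A s r n d) = (*)"
    by (simp_all add: A_def) (simp_all add: ring_A_def mpoly_ring_def)
  have "free_quotient A scale cyc bnd"
    unfolding free_quotient_def
  proof (intro bexI[OF _ y0] ballI)
    fix y assume y: "y \<in> cyc"
    have "a \<in> A \<and> y - scale a y0 \<in> bnd \<longleftrightarrow> a \<in> A \<and> y - scale a y0 \<in> DC.B p q" for a
      unfolding bnd using diff_mem[OF y scale[OF _ y0]] by blast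
    then show "\<exists>!a. a \<in> A \<and> y - scale a y0 \<in> bnd" using uniq[OF y] by simp
  qed
  then have "free_of_rank (ring_A s r n d) M 1" "module_iso (ring_A s r n d) M (self_module (ring_A s r n d))"
    by (intro free_represented[OF rep, of "ring_A s r n d" scale];
        simp add: R scale smult scale_add scale_mult A.add_mem A.mult_mem)+
  then show "free_module M" by (simp add: free_module_def)
qed

section \<open>Local cohomology of B\<close>

abbreviation Jset :: "int \<Rightarrow> nat set set" where "Jset p \<equiv> {J. J \<subseteq> K \<and> int (card J) = p}"

definition cech_class :: "int \<Rightarrow> 'k bicochain \<Rightarrow> nat set \<Rightarrow> ('k cpoly set \<times> nat) set" where
  "cech_class p w = (\<lambda>J\<in>Jset p. theta J (w J {}))"

text \<open>
  The cochains that vanish in the Cech complex of \<open>B\<close>.  They are the image of the Koszul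
  differential, see \<open>cech_null_eq\<close>, and this links the complex of \<open>B\<close> to the double complex.
\<close>
definition cech_null :: "int \<Rightarrow> 'k bicochain set" where
  "cech_null p = {w \<in> XU p 0. \<forall>J\<in>Jset p. w J {} \<in> ideal_of (V J)}"

abbreviation cech_terms :: "int \<Rightarrow> ('k cpoly, nat set \<Rightarrow> ('k cpoly set \<times> nat) set) graded_module" where
  "cech_terms \<equiv> cech_term C grB g (\<lambda>_ _. 1)"

lemma additive_get: "additive (\<lambda>w. w J I :: 'b::ab_group_add)"
  by unfold_locales simp

lemma cech_surj:
  assumes G: "is_grading G" and x: "\<And>J. J \<in> Jset p \<Longrightarrow> x J \<in> laur (V J) \<inter> G {}"
  shows "\<exists>w\<in>bicochains G p 0. \<forall>J\<in>Jset p. w J {} = x J"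
proof -
  define w where "w J I = (if J \<in> Jset p \<and> I = {} then x J else 0)" for J and I :: "nat set"
  have "w \<in> bicochains G p 0"
    by (rule bicochainsI)
       (use x subgroup_set.zero_mem[OF is_gradingD(1)[OF G]] in
         \<open>auto simp: w_def laur.zero_mem split: if_splits\<close>)
  moreover have "\<forall>J\<in>Jset p. w J {} = x J" by (simp add: w_def)
  ultimately show ?thesis by blast
qed

lemma represented_cech_term: "represented (XU p 0) (cech_class p) (cech_null p) (cech_terms p)"
proof -
  have "represented (XU p 0) (\<lambda>w. \<lambda>J\<in>Jset p. theta J (w J {}))
    {w \<in> XU p 0. \<forall>J\<in>Jset p. w J {} \<in> ideal_of (V J)}
    (prod_module (Jset p) (locB))"
  proof (rule represented_prod_module[OF XU_subgroup])
    show "represented (laur (V J)) (theta J) (ideal_of (V J)) (locB J)" if "J \<in> Jset p" for J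
      using that represented_cech_loc by blast
    show "w J {} \<in> laur (V J)" if "w \<in> XU p 0" for J w using bicochainsD(1)[OF that] .
    show "\<exists>w\<in>XU p 0. \<forall>J\<in>Jset p. w J {} = x J" if "\<And>J. J \<in> Jset p \<Longrightarrow> x J \<in> laur (V J)" for x
      using that by (intro cech_surj is_grading_UNIV) simp
  qed (rule additive_get)
  then show ?thesis unfolding cech_term_def cech_class_def[abs_def] cech_null_def .
qed

lemma deg_empty: "deg {} = delta r n d"
  by (simp add: deg_def)

lemma hpart_cech_term: "hpart (cech_terms p) (delta r n d) = cech_class p ` X p 0"
proof -
  have "hpart (cech_terms p) (delta r n d) =
      (\<Pi>\<^sub>E J\<in>Jset p. theta J ` (laur (V J) \<inter> homog s n (delta r n d)))"
    unfolding cech_term_def prod_module_def by (auto intro!: PiE_cong simp: hpart_cech_loc)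
  also have "\<dots> = cech_class p ` X p 0"
    unfolding cech_class_def[abs_def]
  proof (rule PiE_image)
    show "w J {} \<in> laur (V J) \<inter> homog s n (delta r n d)" if "w \<in> X p 0" for J w
      using bicochainsD(1,2)[OF that, of J "{}"] by (simp add: Gdeg_def deg_empty)
    show "\<exists>w\<in>X p 0. \<forall>J\<in>Jset p. w J {} = x J"
      if "\<And>J. J \<in> Jset p \<Longrightarrow> x J \<in> laur (V J) \<inter> homog s n (delta r n d)" for x
      using that by (intro cech_surj is_grading_Gdeg) (simp add: Gdeg_def deg_empty)
  qed
  finally show ?thesis .
qed

lemma cech_diff_class:
  assumes x: "x \<in> XU p 0"
  shows "cech_diff C grB g (\<lambda>_ _. 1) p (cech_class p x) = cech_class (p + 1) (cech x)"
  unfolding cech_diff_def cech_class_def[of "p + 1"]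
proof (rule restrict_ext)
  fix J assume "J \<in> Jset (p + 1)"
  then have J: "J \<subseteq> K" "int (card J) = p + 1" by auto
  then have fin: "finite J" by (meson finite_lessThan finite_subset)
  interpret L: represented "laur (V J)" "theta J" "ideal_of (V J)" "locB J"
    by (rule represented_cech_loc[OF J(1)])
  have xl: "x (J - {k}) {} \<in> laur (V (J - {k}))" "x (J - {k}) {} \<in> laur (V J)" for k
    using bicochainsD(1)[OF x, of "J - {k}" "{}"] laur_mono[OF V_mono[of "J - {k}" J]] by auto
  have summand: "alt_sign (locB J) J k
        (loc_map C grB (g ! k) (\<Otimes>\<^bsub>C\<^esub>k'\<in>J. g ! k') (cech_class p x (J - {k}))) =
      theta J (sg J k (x (J - {k}) {}))" if k: "k \<in> J" for k
  proof -
    have "int (card (J - {k})) = p" using J(2) card_Suc_Diff1[OF fin k] by linarith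
    then have "cech_class p x (J - {k}) = theta (J - {k}) (x (J - {k}) {})"
      using J(1) by (auto simp: cech_class_def)
    then show ?thesis using loc_map_theta[OF J(1) k xl(1)] L.alt_sign_eq[OF xl(2)] by simp
  qed
  have "(\<Oplus>\<^bsub>locB J\<^esub>k\<in>J. alt_sign (locB J) J k
        (loc_map C grB (g ! k) (\<Otimes>\<^bsub>C\<^esub>k'\<in>J. g ! k') (cech_class p x (J - {k})))) =
      (\<Oplus>\<^bsub>locB J\<^esub>k\<in>J. theta J (sg J k (x (J - {k}) {})))"
  proof (rule L.finsum_cong'[OF refl])
    show "(\<lambda>k. theta J (sg J k (x (J - {k}) {}))) \<in> J \<rightarrow> carrier (locB J)"
      unfolding L.carrier_eq by (intro Pi_I imageI laur.sg_mem xl(2))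
  qed (rule summand)
  also have "\<dots> = theta J (\<Sum>k\<in>J. sg J k (x (J - {k}) {}))"
    by (rule L.finsum_eq[OF fin]) (intro laur.sg_mem xl(2))
  also have "(\<Sum>k\<in>J. sg J k (x (J - {k}) {})) = cech x J {}"
    using J(1) by (simp add: cech_apply cob_def)
  finally show "(\<Oplus>\<^bsub>locB J\<^esub>k\<in>J. alt_sign (locB J) J k
        (loc_map C grB (g ! k) (\<Otimes>\<^bsub>C\<^esub>k'\<in>J. g ! k') (cech_class p x (J - {k})))) = theta J (cech x J {})" .
qed

lemma koszul_to_empty: "koszul v J {} = (\<Sum>i\<in>{1..r}. F i * v J {i})"
  by (simp add: koszul_def kos_def sg_def)

lemma cech_null_eq: "cech_null p = koszul ` XU p 1"
proof (intro equalityI subsetI)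
  fix w assume "w \<in> cech_null p"
  then have w: "w \<in> XU p 0" "\<And>J. J \<in> Jset p \<Longrightarrow> w J {} \<in> ideal_of (V J)" by (auto simp: cech_null_def)
  have "\<forall>J\<in>Jset p. \<exists>z. (\<forall>i\<in>{1..r}. z i \<in> laur (V J)) \<and> w J {} = (\<Sum>i\<in>{1..r}. F i * z i)"
    using w(2) unfolding ideal_of_def by blast
  from bchoice[OF this] obtain z where
    z: "\<forall>J\<in>Jset p. (\<forall>i\<in>{1..r}. z J i \<in> laur (V J)) \<and> w J {} = (\<Sum>i\<in>{1..r}. F i * z J i)" by blast
  define v where "v J I = (if J \<in> Jset p \<and> (\<exists>i\<in>{1..r}. I = {i}) then z J (the_elem I) else 0)" for J I
  have "v \<in> XU p 1"
  proof (rule bicochainsI)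
    fix J I
    show "v J I \<in> laur (V J)" using z by (auto simp: v_def laur.zero_mem)
    show "J \<subseteq> K \<and> I \<subseteq> {1..r} \<and> int (card J) = p \<and> int (card I) = 1" if "v J I \<noteq> 0"
      using that by (auto simp: v_def split: if_splits)
  qed simp
  moreover have "w J I = koszul v J I" for J I
  proof (cases "J \<in> Jset p")
    case J: True
    show ?thesis
    proof (cases "I = {}")
      case True
      have "(\<Sum>i\<in>{1..r}. F i * v J {i}) = (\<Sum>i\<in>{1..r}. F i * z J i)"
        using J by (intro sum.cong refl) (simp add: v_def)
      then show ?thesis using z J by (simp add: True koszul_to_empty)
    next
      case False
      then have "w J I = 0" using bicochainsD(3)[OF w(1), of J I] by (metis card_gt_0_iff finite_subset finite_atLeastAtMost of_nat_0_eq_iff less_irrefl)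
      moreover have "v J (insert i I) = 0" if "i \<notin> I" for i
        using that False by (auto simp: v_def)
      ultimately show ?thesis by (simp add: koszul_def kos_def)
    qed
  next
    case False
    then have "w J I = 0" using bicochainsD(3)[OF w(1), of J I] by blast
    moreover have "v J I' = 0" for I' using False by (auto simp: v_def)
    ultimately show ?thesis by (simp add: koszul_def kos_def)
  qed
  then have "w = koszul v" by blast
  ultimately show "w \<in> koszul ` XU p 1" by blast
next
  fix w assume "w \<in> koszul ` XU p 1"
  then obtain v where v: "v \<in> XU p 1" "w = koszul v" by blast
  have "w \<in> XU p 0" using koszul_bicochains[OF is_grading_UNIV v(1)] v(2) by simp
  moreover have "w J {} \<in> ideal_of (V J)" for J
    unfolding v(2) koszul_to_empty by (intro ideal_ofI bicochainsD(1)[OF v(1)])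
  ultimately show "w \<in> cech_null p" by (simp add: cech_null_def)
qed

text \<open>
  A primitive may be replaced by its homogeneous part.
\<close>
lemma koszul_XU_X:
  assumes "y \<in> X p q" "y = koszul v" "v \<in> XU p' q'"
  shows "\<exists>v\<in>X p' q'. y = koszul v"
  using pr_id[OF assms(1)] pr_koszul[of v] pr_bicochains[OF assms(3)] assms(2) by metis

lemma represented_complex_cech:
  "represented_complex cech_terms (cech_diff C grB g (\<lambda>_ _. 1)) i (\<lambda>p. XU p 0) cech_null cech_class cech
    (X i 0) (delta r n d)"
proof (rule represented_complex.intro)
  show "subgroup_set (cech_null k)" for k
  proof
    show "0 \<in> cech_null k"
      by (simp add: cech_null_def subgroup_set.zero_mem[OF XU_subgroup]
        subgroup_set.zero_mem[OF ideal_of_subgroup])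
    show "x - y \<in> cech_null k" if "x \<in> cech_null k" "y \<in> cech_null k" for x y
      using that by (simp add: cech_null_def subgroup_set.diff_mem[OF XU_subgroup]
        subgroup_set.diff_mem[OF ideal_of_subgroup])
  qed
  show "subgroup_set (X i 0)" by (rule DC.X_subgroup)
qed (rule represented_cech_term additive_cech cech_bicochains[OF is_grading_UNIV] cech_diff_class
      X_subset_XU hpart_cech_term; assumption?)+

text \<open>
  A cochain of \<open>B\<close> is a cocycle iff its Cech coboundary is in the image of the Koszul differential,
  that is iff it starts a zigzag at \<open>(i, 0)\<close>.
\<close>
lemma HMB_cohomology:
  assumes i: "0 \<le> i"
  shows "i + int r \<noteq> int N \<Longrightarrow> zero_module (HMB g s r n d i (delta r n d))"
    and "i + int r = int N \<Longrightarrow> free_module (HMB g s r n d i (delta r n d))"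
proof -
  interpret H: represented_complex cech_terms "cech_diff C grB g (\<lambda>_ _. 1)" i "\<lambda>p. XU p 0" cech_null
    cech_class cech "X i 0" "delta r n d"
    by (rule represented_complex_cech)
  have cyc: "H.cyc = DC.Z i 0"
  proof (intro equalityI subsetI)
    fix y assume "y \<in> H.cyc"
    then obtain v where y: "y \<in> X i 0" and v: "v \<in> XU (i + 1) 1" "cech y = koszul v"
      by (auto simp: H.cyc_def cech_null_eq)
    from koszul_XU_X[OF DC.dC_mem[OF y] v(2,1)] show "y \<in> DC.Z i 0" using y by (simp add: DC.Z_def)
  next
    fix y assume "y \<in> DC.Z i 0"
    then show "y \<in> H.cyc" using X_subset_XU[of "i + 1" 1] by (auto simp: H.cyc_def cech_null_eq DC.Z_def)
  qed
  have bnd: "H.bnd = H.cyc \<inter> DC.B i 0"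
  proof (intro equalityI subsetI IntI)
    fix y assume y: "y \<in> H.bnd"
    then show "y \<in> H.cyc" by (simp add: H.bnd_def)
    from y obtain u v where yX: "y \<in> X i 0" and u: "u \<in> XU (i - 1) 0" and v: "v \<in> XU i 1"
      and eq: "y - cech u = koszul v"
      by (auto simp: H.bnd_def H.cyc_def cech_null_eq)
    have "y = cech u + koszul v" using eq by (simp add: algebra_simps)
    then have "y = pr (cech u + koszul v)" using pr_id[OF yX] by simp
    also have "\<dots> = cech (pr u) + koszul (pr v)" by (simp add: additive.add[OF additive_pr] pr_cech pr_koszul)
    finally show "y \<in> DC.B i 0"
      using pr_bicochains[OF u] pr_bicochains[OF v] by (auto simp: DC.B_def)
  next
    fix y assume y: "y \<in> H.cyc \<inter> DC.B i 0"
    then obtain u v where "u \<in> X (i - 1) 0" "v \<in> X i 1" "y = cech u + koszul v" by (auto simp: DC.B_def)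
    then have "u \<in> XU (i - 1) 0" "y - cech u \<in> cech_null i"
      using X_subset_XU by (auto simp: cech_null_eq)
    then show "y \<in> H.bnd" using y by (auto simp: H.bnd_def)
  qed
  have HMB: "HMB g s r n d i (delta r n d) = hpart_module mpoly_const (cohomology cech_terms (cech_diff C grB g (\<lambda>_ _. 1)) i) (delta r n d)"
    by (simp add: HMB_def cech_cohomology_def)
  have rep: "represented H.cyc H.cls H.bnd (HMB g s r n d i (delta r n d))"
    unfolding HMB by (rule H.represented_cohomology)
  have smult: "a \<odot>\<^bsub>HMB g s r n d i (delta r n d)\<^esub> H.cls x = H.cls (scale a x)" if a: "a \<in> A" and x: "x \<in> H.cyc" for a x
    unfolding HMB
  proof (rule H.smult_cls)
    show "additive (scale a)" by (rule additive_scale)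
    show "cech (scale a y) = scale a (cech y)" for y by (rule cech_scale)
    show "scale a y \<in> XU k 0" if "y \<in> XU k 0" for k y
      by (rule scale_bicochains[OF is_grading_UNIV a that])
    show "x \<in> XU i 0" using x X_subset_XU by (auto simp: H.cyc_def)
    show "mpoly_const a \<odot>\<^bsub>cech_terms i\<^esub> cech_class i y = cech_class i (scale a y)" if y: "y \<in> XU i 0" for y
    proof -
      have "mpoly_const a \<odot>\<^bsub>cech_terms i\<^esub> cech_class i y =
          (\<lambda>J\<in>Jset i. mpoly_const a \<odot>\<^bsub>locB J\<^esub> cech_class i y J)"
        by (simp add: cech_term_def prod_module_def)
      also have "\<dots> = cech_class i (scale a y)"
        unfolding cech_class_def
      proof (rule restrict_ext)
        fix J assume J: "J \<in> Jset i"
        then show "mpoly_const a \<odot>\<^bsub>locB J\<^esub> (\<lambda>J\<in>Jset i. theta J (y J {})) J =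
            theta J (scale a y J {})"
          using smult_theta[OF _ mpoly_const_C[OF a] bicochainsD(1)[OF y], of J "{}"]
          by (simp add: scale_def mpoly_const_def lift_single)
      qed
      finally show ?thesis .
    qed
  qed
  have scale: "scale a x \<in> H.cyc" if "a \<in> A" "x \<in> H.cyc" for a x
    using that scale_bicochains[OF is_grading_Gdeg that(1)] scale_bicochains[OF is_grading_UNIV that(1), of _ "i + 1" 1]
    by (auto simp: H.cyc_def cech_null_eq cech_scale koszul_scale[symmetric])
  show "zero_module (HMB g s r n d i (delta r n d))" if "i + int r \<noteq> int N"
    by (rule cohomology_result(1)[OF rep cyc bnd smult scale]) (use i that in auto)
  show "free_module (HMB g s r n d i (delta r n d))" if "i + int r = int N"
    by (rule cohomology_result(2)[OF rep cyc bnd smult scale]) (use i that in auto)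
qed

section \<open>Koszul cohomology\<close>

abbreviation Iset :: "int \<Rightarrow> nat set set" where "Iset p \<equiv> {I. I \<subseteq> {1..r} \<and> int (card I) = - p}"

definition koszul_class :: "int \<Rightarrow> 'k bicochain \<Rightarrow> nat set \<Rightarrow> 'k cpoly" where
  "koszul_class p w = (\<lambda>I\<in>Iset p. unlift (w {} I))"

abbreviation koszul_terms :: "int \<Rightarrow> ('k cpoly, nat set \<Rightarrow> 'k cpoly) graded_module" where
  "koszul_terms \<equiv> koszul_term grC r (\<lambda>i j. int (d i j))"

lemma represented_unlift: 
  assumes "carrier M = carrier C" "add M = (+)" "\<zero>\<^bsub>M\<^esub> = 0"
  shows "represented (laur {}) unlift {0} M"
proof (rule represented.intro)
  show "subgroup_set (laur {})" by (rule laur.subgroup_set_axioms)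
  show "represented_axioms (laur {}) unlift {0} M"
  proof
    show "carrier M = unlift ` laur {}"
      unfolding assms(1)
    proof (intro equalityI subsetI)
      fix p assume "p \<in> carrier C"
      then have "p = unlift (lift p)" "lift p \<in> laur {}" by (simp_all add: C_iff)
      then show "p \<in> unlift ` laur {}" by blast
    qed (auto intro: unlift_C)
    show "unlift x = unlift 0 \<longleftrightarrow> x \<in> {0}" if "x \<in> laur {}" for x
      using lift_unlift[OF that] lift_unlift[OF laur.zero_mem] by auto
  qed (simp_all add: assms additive.zero[OF additive_unlift] additive.add[OF additive_unlift])
qed

lemma koszul_surj:
  assumes G: "is_grading G" and x: "\<And>I. I \<in> Iset p \<Longrightarrow> x I \<in> laur {} \<inter> G I"
  shows "\<exists>w\<in>bicochains G 0 (- p). \<forall>I\<in>Iset p. w {} I = x I"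
proof -
  define w where "w J I = (if I \<in> Iset p \<and> J = {} then x I else 0)" for I and J :: "nat set"
  have "w \<in> bicochains G 0 (- p)"
    by (rule bicochainsI)
       (use x subgroup_set.zero_mem[OF is_gradingD(1)[OF G]] in
         \<open>auto simp: w_def laur.zero_mem V_def split: if_splits\<close>)
  moreover have "\<forall>I\<in>Iset p. w {} I = x I" by (simp add: w_def)
  ultimately show ?thesis by blast
qed

lemma V_empty: "V {} = {}" by (simp add: V_def)

lemma XU_0_eq_0: "w \<in> XU 0 (- p) \<Longrightarrow> (\<forall>I\<in>Iset p. w {} I \<in> {0}) \<longleftrightarrow> w = 0"
proof
  assume w: "w \<in> XU 0 (- p)" and 0: "\<forall>I\<in>Iset p. w {} I \<in> {0}"
  show "w = 0"
  proof (intro ext, rule ccontr)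
    fix J I assume "w J I \<noteq> 0 J I"
    then have ne: "w J I \<noteq> 0" by simp
    from bicochainsD(3)[OF w ne] have "J = {}" "I \<in> Iset p"
      by (auto dest: finite_subset)
    then show False using 0 ne by blast
  qed
qed auto

lemma represented_koszul_term: "represented (XU 0 (- p)) (koszul_class p) {0} (koszul_terms p)"
proof -
  have "represented (XU 0 (- p)) (\<lambda>w. \<lambda>I\<in>Iset p. unlift (w {} I))
    {w \<in> XU 0 (- p). \<forall>I\<in>Iset p. w {} I \<in> {0}}
    (prod_module (Iset p) (\<lambda>I. shift_module grC (\<lambda>j. - (\<Sum>i\<in>I. int (d i j)))))"
  proof (rule represented_prod_module[OF XU_subgroup])
    show "represented (laur {}) unlift {0} (shift_module grC (\<lambda>j. - (\<Sum>i\<in>I. int (d i j))))" for I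
      by (rule represented_unlift) (simp_all add: shift_module_def)
    show "w {} I \<in> laur {}" if "w \<in> XU 0 (- p)" for I w using bicochainsD(1)[OF that, of "{}"] by (simp add: V_empty)
    show "\<exists>w\<in>XU 0 (- p). \<forall>I\<in>Iset p. w {} I = x I" if "\<And>I. I \<in> Iset p \<Longrightarrow> x I \<in> laur {}" for x
      using that by (intro koszul_surj is_grading_UNIV) simp
  qed (rule additive_get)
  moreover have "{w \<in> XU 0 (- p). \<forall>I\<in>Iset p. w {} I \<in> {0}} = {0}"
    using XU_0_eq_0 subgroup_set.zero_mem[OF XU_subgroup] by blast
  ultimately show ?thesis unfolding koszul_term_def koszul_class_def[abs_def] by simp
qed

lemma hpart_koszul_term: "hpart (koszul_terms p) (delta r n d) = koszul_class p ` X 0 (- p)"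
proof -
  have hp: "hpart (shift_module grC (\<lambda>j. - (\<Sum>i\<in>I. int (d i j)))) (delta r n d) =
      unlift ` (laur {} \<inter> Gdeg I)" for I
  proof -
    have "hpart (shift_module grC (\<lambda>j. - (\<Sum>i\<in>I. int (d i j)))) (delta r n d) = hpart grC (deg I)"
      by (simp add: shift_module_def deg_def)
    also have "\<dots> = unlift ` (laur {} \<inter> homog s n (deg I))"
    proof (intro equalityI subsetI)
      fix p assume p: "p \<in> hpart grC (deg I)"
      then have "lift p \<in> laur {}" by (simp add: C_iff)
      then have "lift p \<in> laur {} \<inter> homog s n (deg I)" using lift_homog[OF p] by blast
      then show "p \<in> unlift ` (laur {} \<inter> homog s n (deg I))" by (metis image_eqI unlift_lift)
    next
      fix p assume "p \<in> unlift ` (laur {} \<inter> homog s n (deg I))"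
      then show "p \<in> hpart grC (deg I)" using unlift_hpart by blast
    qed
    finally show ?thesis by (simp add: Gdeg_def)
  qed
  have "hpart (koszul_terms p) (delta r n d) = (\<Pi>\<^sub>E I\<in>Iset p. unlift ` (laur {} \<inter> Gdeg I))"
    unfolding koszul_term_def prod_module_def by (simp only: graded_module.simps hp)
  also have "\<dots> = koszul_class p ` X 0 (- p)"
    unfolding koszul_class_def[abs_def]
  proof (rule PiE_image)
    show "w {} I \<in> laur {} \<inter> Gdeg I" if "w \<in> X 0 (- p)" for I w
      using bicochainsD(1,2)[OF that, of "{}" I] by (simp add: V_empty)
    show "\<exists>w\<in>X 0 (- p). \<forall>I\<in>Iset p. w {} I = x I"
      if "\<And>I. I \<in> Iset p \<Longrightarrow> x I \<in> laur {} \<inter> Gdeg I" for x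
      using that by (intro koszul_surj is_grading_Gdeg)
  qed
  finally show ?thesis .
qed

lemma koszul_diff_class:
  assumes x: "x \<in> XU 0 (- p)"
  shows "koszul_diff grC r (gen_f s n d) p (koszul_class p x) = koszul_class (p + 1) (koszul x)"
  unfolding koszul_diff_def koszul_class_def[of "p + 1"]
proof (rule restrict_ext)
  fix J assume "J \<in> Iset (p + 1)"
  then have J: "J \<subseteq> {1..r}" "int (card J) = - (p + 1)" by auto
  then have fin: "finite J" by (meson finite_atLeastAtMost finite_subset)
  interpret L: represented "laur {}" unlift "{0}" grC
    by (rule represented_unlift) simp_all
  have xl: "x {} I \<in> laur {}" for I using bicochainsD(1)[OF x, of "{}" I] by (simp add: V_empty)
  have mem: "sg J i (F i * x {} (insert i J)) \<in> laur {}" if "i \<in> {1..r} - J" for i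
    using that by (intro laur.sg_mem laur.mult_mem F_laur xl) blast
  have summand: "alt_sign grC J i (gen_f s n d i \<otimes>\<^bsub>grC\<^esub> koszul_class p x (insert i J)) =
      unlift (sg J i (F i * x {} (insert i J)))" if i: "i \<in> {1..r} - J" for i
  proof -
    have "insert i J \<in> Iset p" using J fin i by auto
    then have "koszul_class p x (insert i J) = unlift (x {} (insert i J))"
      unfolding koszul_class_def by (rule restrict_apply')
    moreover have "F i * x {} (insert i J) = lift (gen_f s n d i * unlift (x {} (insert i J)))"
      by (simp add: lift_mult lift_gen_f lift_unlift xl)
    then have "unlift (F i * x {} (insert i J)) = gen_f s n d i * unlift (x {} (insert i J))" by simp
    moreover have "F i * x {} (insert i J) \<in> laur {}" using i by (intro laur.mult_mem F_laur xl) blast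
    ultimately show ?thesis using L.alt_sign_eq[of "F i * x {} (insert i J)" J i] by simp
  qed
  have "(\<Oplus>\<^bsub>grC\<^esub>i\<in>{1..r} - J. alt_sign grC J i (gen_f s n d i \<otimes>\<^bsub>grC\<^esub> koszul_class p x (insert i J))) =
      (\<Oplus>\<^bsub>grC\<^esub>i\<in>{1..r} - J. unlift (sg J i (F i * x {} (insert i J))))"
  proof (rule L.finsum_cong'[OF refl])
    show "(\<lambda>i. unlift (sg J i (F i * x {} (insert i J)))) \<in> {1..r} - J \<rightarrow> carrier grC"
      unfolding L.carrier_eq by (intro Pi_I imageI mem)
  qed (rule summand)
  also have "\<dots> = unlift (\<Sum>i\<in>{1..r} - J. sg J i (F i * x {} (insert i J)))"
    by (rule L.finsum_eq) (use mem in auto)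
  also have "(\<Sum>i\<in>{1..r} - J. sg J i (F i * x {} (insert i J))) = koszul x {} J"
    using J(1) by (simp add: koszul_def kos_def)
  finally show "(\<Oplus>\<^bsub>grC\<^esub>i\<in>{1..r} - J. alt_sign grC J i (gen_f s n d i \<otimes>\<^bsub>grC\<^esub> koszul_class p x (insert i J))) =
      unlift (koszul x {} J)" .
qed

lemma represented_complex_koszul:
  "represented_complex koszul_terms (koszul_diff grC r (gen_f s n d)) i (\<lambda>p. XU 0 (- p)) (\<lambda>_. {0}) koszul_class koszul
    (X 0 (- i)) (delta r n d)"
proof (rule represented_complex.intro)
  show "subgroup_set {0 :: 'k bicochain}" by unfold_locales simp_all
  show "subgroup_set (X 0 (- i))" by (rule DC.X_subgroup)
  show "koszul x \<in> XU 0 (- (k + 1))" if "x \<in> XU 0 (- k)" for x k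
    using koszul_bicochains[OF is_grading_UNIV that] by simp
qed (rule represented_koszul_term additive_koszul koszul_diff_class
      X_subset_XU hpart_koszul_term; assumption?)+

text \<open>
  For \<open>- r \<le> i < 0\<close> a Koszul cocycle of degree \<open>i\<close> starts a zigzag at \<open>(0, - i)\<close>; outside this range
  there are no cochains in nonzero degrees.
\<close>
lemma HK_cohomology:
  assumes i: "i \<noteq> 0"
  shows "i \<noteq> int N - int r \<or> 0 < i \<Longrightarrow> zero_module (HK s r n d i (delta r n d) :: ('k apoly, _) module)"
    and "i = int N - int r \<Longrightarrow> N < r \<Longrightarrow> free_module (HK s r n d i (delta r n d))"
proof -
  interpret H: represented_complex koszul_terms "koszul_diff grC r (gen_f s n d)" i "\<lambda>p. XU 0 (- p)" "\<lambda>_. {0}"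
    koszul_class koszul "X 0 (- i)" "delta r n d"
    by (rule represented_complex_koszul)
  let ?M = "HK s r n d i (delta r n d) :: ('k apoly, _) module"
  have HK: "?M = hpart_module mpoly_const (cohomology koszul_terms (koszul_diff grC r (gen_f s n d)) i) (delta r n d)"
    by (simp add: HK_def koszul_cohomology_def)
  have rep: "represented H.cyc H.cls H.bnd ?M"
    unfolding HK by (rule H.represented_cohomology)
  have smult: "a \<odot>\<^bsub>?M\<^esub> H.cls x = H.cls (scale a x)" if a: "a \<in> A" and x: "x \<in> H.cyc" for a x
    unfolding HK
  proof (rule H.smult_cls)
    show "additive (scale a)" by (rule additive_scale)
    show "koszul (scale a y) = scale a (koszul y)" for y by (rule koszul_scale)
    show "scale a y \<in> XU 0 (- k)" if "y \<in> XU 0 (- k)" for k y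
      by (rule scale_bicochains[OF is_grading_UNIV a that])
    show "x \<in> XU 0 (- i)" using x X_subset_XU by (auto simp: H.cyc_def)
    show "mpoly_const a \<odot>\<^bsub>koszul_terms i\<^esub> koszul_class i y = koszul_class i (scale a y)" if y: "y \<in> XU 0 (- i)" for y
    proof -
      have "mpoly_const a \<odot>\<^bsub>koszul_terms i\<^esub> koszul_class i y =
          (\<lambda>I\<in>Iset i. mpoly_const a * koszul_class i y I)"
        by (simp add: koszul_term_def prod_module_def shift_module_def)
      also have "\<dots> = koszul_class i (scale a y)"
        unfolding koszul_class_def
      proof (rule restrict_ext)
        fix I assume I: "I \<in> Iset i"
        have yl: "y {} I \<in> laur {}" using bicochainsD(1)[OF y, of "{}" I] by (simp add: V_empty)
        have "scale a y {} I = lift (mpoly_const a * unlift (y {} I))"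
          by (simp add: scale_def lift_mult lift_unlift[OF yl] mpoly_const_def lift_single)
        then have "unlift (scale a y {} I) = mpoly_const a * unlift (y {} I)" by simp
        moreover have "(\<lambda>I\<in>Iset i. unlift (y {} I)) I = unlift (y {} I)" using I by (rule restrict_apply')
        ultimately show "mpoly_const a * (\<lambda>I\<in>Iset i. unlift (y {} I)) I = unlift (scale a y {} I)" by simp
      qed
      finally show ?thesis .
    qed
  qed
  have scale: "scale a x \<in> H.cyc" if "a \<in> A" "x \<in> H.cyc" for a x
    using that scale_bicochains[OF is_grading_Gdeg that(1)]
    by (auto simp: H.cyc_def koszul_scale additive.zero[OF additive_scale])
  have cyc: "H.cyc = DC.Z 0 (- i)" if q: "0 < - i" "- i \<le> int r"
  proof -
    have "X (- 1) (- i - 1) = {0}" by (rule X_negative) simp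
    from DC.Z_at_0[OF q this] show ?thesis by (simp add: H.cyc_def)
  qed
  have bnd: "H.bnd = H.cyc \<inter> DC.B 0 (- i)" 
  proof -
    have neg: "X (- 1) (- i) = {0}" by (rule X_negative) simp
    have "(\<exists>u\<in>XU 0 (- (i - 1)). y - koszul u \<in> {0}) \<longleftrightarrow> y \<in> koszul ` X 0 (- i + 1)" if "y \<in> X 0 (- i)" for y
    proof
      assume "\<exists>u\<in>XU 0 (- (i - 1)). y - koszul u \<in> {0}"
      then obtain u where u: "u \<in> XU 0 (- i + 1)" "y = koszul u" by auto
      from koszul_XU_X[OF that u(2,1)] show "y \<in> koszul ` X 0 (- i + 1)" by blast
    next
      assume "y \<in> koszul ` X 0 (- i + 1)"
      then show "\<exists>u\<in>XU 0 (- (i - 1)). y - koszul u \<in> {0}" using X_subset_XU[of 0 "- i + 1"] by auto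
    qed
    then show ?thesis unfolding DC.B_at_0[OF neg] by (auto simp: H.bnd_def H.cyc_def)
  qed
  show "zero_module ?M" if "i \<noteq> int N - int r \<or> 0 < i"
  proof (cases "0 < - i \<and> - i \<le> int r")
    case True
    then show ?thesis
      by (intro cohomology_result(1)[OF rep cyc bnd smult scale]) (use that in auto)
  next
    case False
    then consider "- i < 0" | "int r < - i" using i by linarith
    then have "X 0 (- i) = {0}"
    proof cases
      case 1
      then show ?thesis by (intro X_negative disjI2)
    next
      case 2
      then show ?thesis by (rule DC.X_top)
    qed
    then have "H.cyc \<subseteq> {0}" unfolding H.cyc_def by blast
    moreover have "0 \<in> H.bnd"
    proof -
      have "0 \<in> H.cyc" using represented.axioms(1)[OF rep] by (rule subgroup_set.zero_mem)
      from represented.eq_zero_iff[OF rep this] show ?thesis by blast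
    qed
    ultimately show ?thesis unfolding zero_module_represented[OF rep] by blast
  qed
  show "free_module ?M" if "i = int N - int r" "N < r"
    by (rule cohomology_result(2)[OF rep cyc bnd smult scale]) (use that in auto)
qed

end

theorem mainTheorem6:
  fixes s r :: nat
    and n :: "nat \<Rightarrow> nat"
    and d :: "nat \<Rightarrow> nat \<Rightarrow> nat"
    and g :: "'k::idom cpoly list"
  assumes "1 \<le> s" and "1 \<le> n 1" and "\<forall>j\<in>{1..<s}. n j \<le> n (Suc j)"
    and "\<forall>i\<in>{1..r}. \<forall>j\<in>{1..s}. 1 \<le> d i j"
    and "distinct g" and "set g = sigmas s n"
  shows
    "(r < bigN s n \<longrightarrow>
       (\<forall>i::int. i \<noteq> 0 \<longrightarrow>
          zero_module (HK s r n d i (delta r n d) :: ('k apoly, _) module)) \<and>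
       (\<forall>i::int. 0 \<le> i \<and> i \<noteq> int (bigN s n) - int r \<longrightarrow>
          zero_module (HMB g s r n d i (delta r n d)))) \<and>
     (r = bigN s n \<longrightarrow>
       (\<forall>i::int. i \<noteq> 0 \<longrightarrow>
          zero_module (HK s r n d i (delta r n d) :: ('k apoly, _) module)) \<and>
       free_of_rank (ring_A s r n d) (HMB g s r n d 0 (delta r n d)) 1 \<and>
       (\<forall>i::int. 0 < i \<longrightarrow> zero_module (HMB g s r n d i (delta r n d)))) \<and>
     (bigN s n < r \<longrightarrow>
       (\<forall>i::int. i \<noteq> 0 \<longrightarrow>
          (if i = int (bigN s n) - int r
           then module_iso (ring_A s r n d)
                  (HK s r n d i (delta r n d) :: ('k apoly, _) module)
                  (self_module (ring_A s r n d))
           else zero_module (HK s r n d i (delta r n d) :: ('k apoly, _) module))) \<and>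
       (\<forall>i::int. 0 \<le> i \<longrightarrow> zero_module (HMB g s r n d i (delta r n d))))"
proof -
  interpret generic_system s r n d g
    using assms by unfold_locales auto
  note HK_free = HK_cohomology(2)[unfolded free_module_def] and HMB_free = HMB_cohomology(2)[unfolded free_module_def]
  show ?thesis
  proof (intro conjI impI allI)
    show "zero_module (HK s r n d i (delta r n d) :: ('k apoly, _) module)" if "r < bigN s n" "i \<noteq> 0" for i
      using that by (intro HK_cohomology(1)) linarith+
    show "zero_module (HMB g s r n d i (delta r n d))"
      if "r < bigN s n" "0 \<le> i \<and> i \<noteq> int (bigN s n) - int r" for i
      using that by (intro HMB_cohomology(1)) linarith+
    show "zero_module (HK s r n d i (delta r n d) :: ('k apoly, _) module)" if "r = bigN s n" "i \<noteq> 0" for i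
      using that by (intro HK_cohomology(1)) linarith+
    show "free_of_rank (ring_A s r n d) (HMB g s r n d 0 (delta r n d)) 1" if "r = bigN s n"
      using that by (intro HMB_free[THEN conjunct1]) linarith+
    show "zero_module (HMB g s r n d i (delta r n d))" if "r = bigN s n" "0 < i" for i
      using that by (intro HMB_cohomology(1)) linarith+
    show "if i = int (bigN s n) - int r
        then module_iso (ring_A s r n d) (HK s r n d i (delta r n d) :: ('k apoly, _) module)
          (self_module (ring_A s r n d))
        else zero_module (HK s r n d i (delta r n d) :: ('k apoly, _) module)"
      if "bigN s n < r" "i \<noteq> 0" for i
    proof (cases "i = int (bigN s n) - int r")
      case True
      then show ?thesis using HK_free[THEN conjunct2, OF that(2) True that(1)] by (simp add: True)
    next
      case False
      then show ?thesis using HK_cohomology(1)[OF that(2)] by (simp only: if_False) blast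
    qed
    show "zero_module (HMB g s r n d i (delta r n d))" if "bigN s n < r" "0 \<le> i" for i
      using that by (intro HMB_cohomology(1)) linarith+
  qed
qed

end
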